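(* Let $E,F$ be symmetric Banach function spaces on $I=(0,\infty)$ (or symmetric Banach sequence spaces) with the Fatou property such that the operator $H$ is bounded on $E$ and on $F$. Assume that $F$ factorizes through $E$, that is, $F=E\odot M(E,F)$. Then $$M(CE,CF)=\widetilde{M(E,F)}$$ (equal as sets, with equivalent norms).
   Context: Equalities of spaces mean equality as sets with equivalent (quasi-)norms. $L^0(I)$ is the space of (classes of) real measurable functions on $I=(0,\infty)$ with Lebesgue measure $m$. A Banach ideal (function) space on $I$ is a linear subspace $E\subset L^0(I)$ with a complete norm such that $y\in E$, $x\in L^0$, $|x|\le|y|$ a.e. imply $x\in E$, $\|x\|_E\le\|y\|_E$; it is assumed to contain a weak unit (an element positive a.e.). It is symmetric if, whenever $x\in E$ and $y\in L^0$ have the same distribution function ($m\{|x|>\lambda\}=m\{|y|>\lambda\}$ for all $\lambda\ge0$), then $y\in E$ and $\|y\|_E=\|x\|_E$. $E$ has the Fatou property if $0\le x_n\uparrow x\in L^0$, $x_n\in E$, $\sup_n\|x_n\|_E<\infty$ imply $x\in E$ and $\|x_n\|_E\uparrow\|x\|_E$. In the sequence case, $I$ with Lebesgue measure is replaced by $\mathbb N=\{1,2,\dots\}$ with counting measure. $Hx(t)=\frac1t\int_0^tx(s)\,ds$ (in the sequence case $(Hx)_n=\frac1n\sum_{k=1}^nx_k$). $H$ is bounded on $E$ if it maps $E$ into $E$ with $\|Hx\|_E\le C\|x\|_E$. Product space: $E\odot F=\{xy:x\in E,y\in F\}$ with $\|u\|_{E\odot F}=\inf\{\|x\|_E\|y\|_F:u=xy,\,x\in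 E,\,y\in F\}$. Multipliers: $M(E,F)=\{x\in L^0:xy\in F\text{ for each }y\in E\}$ with $\|x\|_{M(E,F)}=\sup_{\|y\|_E=1}\|xy\|_F$. Cesàro space: $CE=\{f\in L^0:H|f|\in E\}$ with $\|f\|_{CE}=\|H|f|\|_E$. Tandori space: $\widetilde E=\{f\in L^0:\widetilde f\in E\}$ with $\|f\|_{\widetilde E}=\|\widetilde f\|_E$, where $\widetilde f(x)=\operatorname{ess\,sup}_{t\ge x}|f(t)|$ (in the sequence case $\widetilde f_n=\sup_{k\ge n}|f_k|$). *)

theory Defs
  imports "HOL-Analysis.Analysis" "HOL-Probability.Essential_Supremum"
begin

text \<open>
  Elements of \<open>L\<^sup>0\<close> are represented by \<open>M\<close>-measurable real functions, and a space of classes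
  by the set of all their representatives together with a norm on representatives.  For a Banach
  ideal space, the ideal property makes both the set and the norm invariant under changes on
  \<open>M\<close>-null sets and outside \<open>space M\<close>.
\<close>

record 'a fn_space =
  elems :: "('a \<Rightarrow> real) set"
  fnorm :: "('a \<Rightarrow> real) \<Rightarrow> real"

abbreviation half_line :: "real measure" where
  "half_line \<equiv> lebesgue_on {0<..}"

abbreviation pos_nat :: "nat measure" where
  "pos_nat \<equiv> count_space {1..}"


definition linear_subspace :: "'a measure \<Rightarrow> 'a fn_space \<Rightarrow> bool" where
  "linear_subspace M E \<longleftrightarrow>
     elems E \<subseteq> borel_measurable M \<and>
     (\<lambda>_. 0) \<in> elems E \<and>
     (\<forall>x\<in>elems E. \<forall>y\<in>elems E. (\<lambda>t. x t + y t) \<in> elems E) \<and>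
     (\<forall>c. \<forall>x\<in>elems E. (\<lambda>t. c * x t) \<in> elems E)"

definition is_norm :: "'a measure \<Rightarrow> 'a fn_space \<Rightarrow> bool" where
  "is_norm M E \<longleftrightarrow>
     (\<forall>x\<in>elems E. 0 \<le> fnorm E x) \<and>
     (\<forall>x\<in>elems E. fnorm E x = 0 \<longleftrightarrow> (AE t in M. x t = 0)) \<and>
     (\<forall>c. \<forall>x\<in>elems E. fnorm E (\<lambda>t. c * x t) = \<bar>c\<bar> * fnorm E x) \<and>
     (\<forall>x\<in>elems E. \<forall>y\<in>elems E. fnorm E (\<lambda>t. x t + y t) \<le> fnorm E x + fnorm E y)"

definition norm_complete :: "'a fn_space \<Rightarrow> bool" where
  "norm_complete E \<longleftrightarrow>
     (\<forall>X :: nat \<Rightarrow> 'a \<Rightarrow> real.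
        (\<forall>n. X n \<in> elems E) \<and>
        (\<forall>e>0. \<exists>N. \<forall>m\<ge>N. \<forall>n\<ge>N. fnorm E (\<lambda>t. X m t - X n t) < e) \<longrightarrow>
        (\<exists>x\<in>elems E. (\<lambda>n. fnorm E (\<lambda>t. X n t - x t)) \<longlonglongrightarrow> 0))"

definition ideal_property :: "'a measure \<Rightarrow> 'a fn_space \<Rightarrow> bool" where
  "ideal_property M E \<longleftrightarrow>
     (\<forall>y\<in>elems E. \<forall>x\<in>borel_measurable M.
        (AE t in M. \<bar>x t\<bar> \<le> \<bar>y t\<bar>) \<longrightarrow> x \<in> elems E \<and> fnorm E x \<le> fnorm E y)"

definition banach_ideal_space :: "'a measure \<Rightarrow> 'a fn_space \<Rightarrow> bool" where
  "banach_ideal_space M E \<longleftrightarrow>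
     linear_subspace M E \<and> is_norm M E \<and> norm_complete E \<and> ideal_property M E \<and>
     (\<exists>w\<in>elems E. AE t in M. 0 < w t)"

definition equimeasurable :: "'a measure \<Rightarrow> ('a \<Rightarrow> real) \<Rightarrow> ('a \<Rightarrow> real) \<Rightarrow> bool" where
  "equimeasurable M x y \<longleftrightarrow>
     (\<forall>l\<ge>0. emeasure M {t \<in> space M. \<bar>x t\<bar> > l} = emeasure M {t \<in> space M. \<bar>y t\<bar> > l})"

definition symmetric_space :: "'a measure \<Rightarrow> 'a fn_space \<Rightarrow> bool" where
  "symmetric_space M E \<longleftrightarrow>
     banach_ideal_space M E \<and>
     (\<forall>x\<in>elems E. \<forall>y\<in>borel_measurable M.
        equimeasurable M x y \<longrightarrow> y \<in> elems E \<and> fnorm E y = fnorm E x)"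

definition fatou_property :: "'a measure \<Rightarrow> 'a fn_space \<Rightarrow> bool" where
  "fatou_property M E \<longleftrightarrow>
     (\<forall>(X :: nat \<Rightarrow> 'a \<Rightarrow> real) x.
        (\<forall>n. X n \<in> elems E) \<and> x \<in> borel_measurable M \<and>
        (AE t in M. (\<forall>n. 0 \<le> X n t \<and> X n t \<le> X (Suc n) t) \<and> (\<lambda>n. X n t) \<longlonglongrightarrow> x t) \<and>
        bdd_above (range (\<lambda>n. fnorm E (X n))) \<longrightarrow>
        x \<in> elems E \<and> incseq (\<lambda>n. fnorm E (X n)) \<and>
        (\<lambda>n. fnorm E (X n)) \<longlonglongrightarrow> fnorm E x)"

definition eq_equiv_norms :: "'a fn_space \<Rightarrow> 'a fn_space \<Rightarrow> bool"  (infix "\<approx>" 50) where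
  "A \<approx> B \<longleftrightarrow>
     elems A = elems B \<and>
     (\<exists>c>0. \<exists>C>0. \<forall>x\<in>elems A. c * fnorm A x \<le> fnorm B x \<and> fnorm B x \<le> C * fnorm A x)"


definition product_space :: "'a measure \<Rightarrow> 'a fn_space \<Rightarrow> 'a fn_space \<Rightarrow> 'a fn_space" where
  "product_space M E F =
     \<lparr> elems = {u \<in> borel_measurable M.
                  \<exists>x\<in>elems E. \<exists>y\<in>elems F. AE t in M. u t = x t * y t},
       fnorm = (\<lambda>u. Inf {fnorm E x * fnorm F y | x y.
                  x \<in> elems E \<and> y \<in> elems F \<and> (AE t in M. u t = x t * y t)}) \<rparr>"

text \<open>
  The supremum below is a real one.  If \<open>E\<close> and \<open>F\<close> are Banach ideal spaces and \<open>x\<close> is a multiplier,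
  the set is nonempty (a weak unit can be normalised) and bounded (multiplication by \<open>x\<close> from \<open>E\<close>
  to \<open>F\<close> has closed graph).
\<close>

definition multiplier_space :: "'a measure \<Rightarrow> 'a fn_space \<Rightarrow> 'a fn_space \<Rightarrow> 'a fn_space" where
  "multiplier_space M E F =
     \<lparr> elems = {x \<in> borel_measurable M. \<forall>y\<in>elems E. (\<lambda>t. x t * y t) \<in> elems F},
       fnorm = (\<lambda>x. SUP y\<in>{y \<in> elems E. fnorm E y = 1}. fnorm F (\<lambda>t. x t * y t)) \<rparr>"


text \<open>
  The Bochner integral of a non-integrable function is \<open>0\<close>, and \<open>real_of_ereal\<close> maps \<open>\<infinity>\<close> to \<open>0\<close>.
  Wherever the Hardy operator or the least decreasing majorant is used, its finiteness on the
  underlying set is therefore demanded explicitly.  Both \<open>\<integral>\<^sub>0\<^sup>t |f|\<close> and the tail supremum are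
  monotone in their argument, so finiteness almost everywhere and everywhere coincide.
\<close>

definition hardy_fun :: "(real \<Rightarrow> real) \<Rightarrow> real \<Rightarrow> real" where
  "hardy_fun x t = (1 / t) * (\<integral>s. x s \<partial>lebesgue_on {0<..t})"

definition hardy_defined :: "(real \<Rightarrow> real) \<Rightarrow> bool" where
  "hardy_defined x \<longleftrightarrow> (\<forall>t>0. integrable (lebesgue_on {0<..t}) x)"

definition hardy_seq :: "(nat \<Rightarrow> real) \<Rightarrow> nat \<Rightarrow> real" where
  "hardy_seq x n = (1 / real n) * (\<Sum>k=1..n. x k)"

definition hardy_bounded_fun :: "real fn_space \<Rightarrow> bool" where
  "hardy_bounded_fun E \<longleftrightarrow>
     (\<exists>C. \<forall>x\<in>elems E. hardy_defined x \<and> hardy_fun x \<in> elems E \<and>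
                      fnorm E (hardy_fun x) \<le> C * fnorm E x)"

definition hardy_bounded_seq :: "nat fn_space \<Rightarrow> bool" where
  "hardy_bounded_seq E \<longleftrightarrow>
     (\<exists>C. \<forall>x\<in>elems E. hardy_seq x \<in> elems E \<and> fnorm E (hardy_seq x) \<le> C * fnorm E x)"

definition cesaro_fun :: "real fn_space \<Rightarrow> real fn_space" where
  "cesaro_fun E =
     \<lparr> elems = {f \<in> borel_measurable half_line.
                  hardy_defined (\<lambda>s. \<bar>f s\<bar>) \<and> hardy_fun (\<lambda>s. \<bar>f s\<bar>) \<in> elems E},
       fnorm = (\<lambda>f. fnorm E (hardy_fun (\<lambda>s. \<bar>f s\<bar>))) \<rparr>"

definition cesaro_seq :: "nat fn_space \<Rightarrow> nat fn_space" where
  "cesaro_seq E =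
     \<lparr> elems = {f \<in> borel_measurable pos_nat. hardy_seq (\<lambda>k. \<bar>f k\<bar>) \<in> elems E},
       fnorm = (\<lambda>f. fnorm E (hardy_seq (\<lambda>k. \<bar>f k\<bar>))) \<rparr>"

definition majorant_fun :: "(real \<Rightarrow> real) \<Rightarrow> real \<Rightarrow> ereal" where
  "majorant_fun f x = esssup (lebesgue_on {x..}) (\<lambda>t. ereal \<bar>f t\<bar>)"

definition majorant_seq :: "(nat \<Rightarrow> real) \<Rightarrow> nat \<Rightarrow> ereal" where
  "majorant_seq f n = (SUP k\<in>{n..}. ereal \<bar>f k\<bar>)"

definition tandori_fun :: "real fn_space \<Rightarrow> real fn_space" where
  "tandori_fun E =
     \<lparr> elems = {f \<in> borel_measurable half_line.
                  (\<forall>x>0. majorant_fun f x < \<infinity>) \<and>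
                  (\<lambda>x. real_of_ereal (majorant_fun f x)) \<in> elems E},
       fnorm = (\<lambda>f. fnorm E (\<lambda>x. real_of_ereal (majorant_fun f x))) \<rparr>"

definition tandori_seq :: "nat fn_space \<Rightarrow> nat fn_space" where
  "tandori_seq E =
     \<lparr> elems = {f \<in> borel_measurable pos_nat.
                  (\<forall>n\<ge>1. majorant_seq f n < \<infinity>) \<and>
                  (\<lambda>n. real_of_ereal (majorant_seq f n)) \<in> elems E},
       fnorm = (\<lambda>f. fnorm E (\<lambda>n. real_of_ereal (majorant_seq f n))) \<rparr>"

end

theory Submission
  imports Defs
begin

text \<open>
  Multiplying by a decreasing \<open>d\<close> in \<open>M(E,F)\<close> maps \<open>CE\<close> to \<open>CF\<close>: the function \<open>H g\<close> is at most twice its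
  decreasing rearrangement, so Hardy's lemma gives \<open>H (d g) \<le> 2 H (d (H g)\<^sup>*)\<close>, and \<open>H\<close> is bounded on \<open>F\<close>.
  For the converse, factorization first lifts to Cesaro spaces: if \<open>H v = e m\<close> with \<open>e\<close> in \<open>E\<close> and \<open>m\<close> in
  \<open>M(E,F)\<close>, both may be replaced by decreasing functions, and then \<open>H (v / m) \<le> H v / m\<close>.  Hence \<open>CF\<close> is
  contained in the product of \<open>CE\<close> and the Tandori space of \<open>M(E,F)\<close>, and the factor \<open>CE\<close> is cancelled by
  iterating this factorization and passing to \<open>n\<close>-th roots, where the geometric means of the decreasing
  factors are bounded by their arithmetic means and the Fatou property yields the limit.
\<close>

section \<open>Ideal spaces and their multipliers\<close>

text \<open>Dividing by a factor of \<open>H |v|\<close> requires that factor to be decreasing, but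
  \<open>M(E,F)\<close> is not known in advance to be symmetric. That a dilated rearrangement of a
  multiplier is again a multiplier is therefore proved separately (\<open>rearr_multiplier\<close>)
  and is the hardest step. Dilations enter because the rearrangement of a product is controlled only
  by the rearrangements of the factors at half the argument; they cost just constants, since a
  bounded Hardy operator makes dilations bounded. Arithmetic means are forced in the cancellation:
  norms of sums can be estimated in \<open>F\<close>, norms of roots of products cannot. The unit
  vectors produced by the iteration may grow pointwise, but at most like \<open>2 ^ n\<close>, which
  an n-th root turns into a factor 2. Functions and sequences share one argument. The price is
  atoms: not every measure is attained by a subset, so measures are rounded up to attained values,
  and several identities for rearrangements become inequalities.\<close>

lemma idealD:
  assumes "ideal_property M X" "y \<in> elems X" "x \<in> borel_measurable M"
    and "AE t in M. \<bar>x t\<bar> \<le> \<bar>y t\<bar>"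
  shows "x \<in> elems X" "fnorm X x \<le> fnorm X y"
  using assms unfolding ideal_property_def by blast+

text \<open>
  The domination clause replaces completeness: it is what the closed graph argument and the
  cancellation argument need, and Cesaro spaces inherit it from the underlying space.
\<close>

definition dominating_ideal :: "'a measure \<Rightarrow> 'a fn_space \<Rightarrow> bool" where
  "dominating_ideal M X \<longleftrightarrow>
     elems X \<subseteq> borel_measurable M \<and> ideal_property M X \<and>
     (\<forall>x\<in>elems X. 0 \<le> fnorm X x \<and> (fnorm X x = 0 \<longleftrightarrow> (AE t in M. x t = 0))) \<and>
     (\<forall>c. \<forall>x\<in>elems X. (\<lambda>t. c * x t) \<in> elems X \<and> fnorm X (\<lambda>t. c * x t) = \<bar>c\<bar> * fnorm X x) \<and>
     (\<forall>x. (\<forall>n::nat. x n \<in> elems X \<and> fnorm X (x n) \<le> 1) \<longrightarrow>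
        (\<exists>u\<in>elems X. \<forall>n. AE t in M. \<bar>x n t\<bar> \<le> 2 ^ n * u t)) \<and>
     (\<exists>w\<in>elems X. AE t in M. 0 < w t)"

context
  fixes M :: "'a measure" and X :: "'a fn_space"
  assumes X: "dominating_ideal M X"
begin

lemma di_meas: "x \<in> elems X \<Longrightarrow> x \<in> borel_measurable M"
  using X by (auto simp: dominating_ideal_def)

lemma di_ideal: "ideal_property M X"
  using X by (auto simp: dominating_ideal_def)

lemma di_nonneg: "x \<in> elems X \<Longrightarrow> 0 \<le> fnorm X x"
  using X by (auto simp: dominating_ideal_def)

lemma di_zero_iff: "x \<in> elems X \<Longrightarrow> fnorm X x = 0 \<longleftrightarrow> (AE t in M. x t = 0)"
  using X by (auto simp: dominating_ideal_def)

lemma di_scale: "x \<in> elems X \<Longrightarrow> (\<lambda>t. c * x t) \<in> elems X"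
  using X by (auto simp: dominating_ideal_def)

lemma di_norm_scale: "x \<in> elems X \<Longrightarrow> fnorm X (\<lambda>t. c * x t) = \<bar>c\<bar> * fnorm X x"
  using X by (auto simp: dominating_ideal_def)

lemma di_dominate:
  assumes "\<And>n::nat. x n \<in> elems X" "\<And>n. fnorm X (x n) \<le> 1"
  obtains u where "u \<in> elems X" "\<And>n. AE t in M. \<bar>x n t\<bar> \<le> 2 ^ n * u t"
  using X assms unfolding dominating_ideal_def by meson

lemma di_weak_unit: obtains w where "w \<in> elems X" "AE t in M. 0 < w t"
  using X by (auto simp: dominating_ideal_def)

lemmas di_idealD = idealD[OF di_ideal]

lemma di_abs:
  assumes "x \<in> elems X"
  shows "(\<lambda>t. \<bar>x t\<bar>) \<in> elems X" "fnorm X (\<lambda>t. \<bar>x t\<bar>) = fnorm X x"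
proof -
  have m: "x \<in> borel_measurable M" using assms by (rule di_meas)
  then show 1: "(\<lambda>t. \<bar>x t\<bar>) \<in> elems X" by (intro di_idealD[OF assms]) auto
  show "fnorm X (\<lambda>t. \<bar>x t\<bar>) = fnorm X x"
    by (intro antisym di_idealD(2)[OF assms] di_idealD(2)[OF 1]) (use m in auto)
qed

lemma di_normalize:
  assumes "x \<in> elems X" "fnorm X x > 0"
  shows "(\<lambda>t. inverse (fnorm X x) * x t) \<in> elems X"
    "fnorm X (\<lambda>t. inverse (fnorm X x) * x t) = 1"
  using assms di_scale di_norm_scale by auto

text \<open>The multiplier norm is a supremum over the unit sphere; a normalised weak unit shows
  that the sphere is not empty. On a null space every norm would be zero, hence the assumption on
  the measure.\<close>

lemma di_unit_vector:
  assumes "emeasure M (space M) > 0"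
  obtains w where "w \<in> elems X" "fnorm X w = 1" "AE t in M. 0 < w t"
proof -
  obtain v where v: "v \<in> elems X" "AE t in M. 0 < v t" by (rule di_weak_unit)
  have "fnorm X v \<noteq> 0"
  proof
    assume "fnorm X v = 0"
    with v have "AE t in M. v t = 0" by (simp add: di_zero_iff)
    with v(2) have "AE t in M. False" by eventually_elim auto
    then show False using assms by (simp add: AE_iff_null null_sets_def)
  qed
  then have pos: "fnorm X v > 0" using di_nonneg[OF v(1)] by simp
  show ?thesis
    by (rule that[of "\<lambda>t. inverse (fnorm X v) * v t"])
      (use di_normalize[OF v(1) pos] v(2) pos in \<open>auto elim!: eventually_mono\<close>)
qed

end

lemma multiplier_elems:
  "x \<in> elems (multiplier_space M E F) \<longleftrightarrow>
     x \<in> borel_measurable M \<and> (\<forall>y\<in>elems E. (\<lambda>t. x t * y t) \<in> elems F)"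
  by (simp add: multiplier_space_def)

section \<open>Boundedness and norm estimates of multipliers\<close>

context
  fixes M :: "'a measure" and X Y :: "'a fn_space"
  assumes X: "dominating_ideal M X" and Y: "dominating_ideal M Y"
    and pos: "emeasure M (space M) > 0"
begin

text \<open>The closed graph theorem in domination form. If unit vectors \<open>x n\<close> gave
  products of norm above \<open>4 ^ n\<close>, one function \<open>u\<close> with
  \<open>|x n| \<le> 2 ^ n * u\<close> would make the norm of \<open>f u\<close> at least
  \<open>2 ^ n\<close> for every \<open>n\<close>. The growth \<open>4 ^ n\<close> is chosen to beat
  the weight \<open>2 ^ n\<close>.\<close>

lemma multiplier_bounded:
  assumes f: "f \<in> elems (multiplier_space M X Y)"
  obtains K where "\<And>x. x \<in> elems X \<Longrightarrow> fnorm X x = 1 \<Longrightarrow> fnorm Y (\<lambda>t. f t * x t) \<le> K"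
proof (rule ccontr)
  assume *: "\<not> thesis"
  have "\<exists>x. x \<in> elems X \<and> fnorm X x = 1 \<and> fnorm Y (\<lambda>t. f t * x t) > 4 ^ n" for n :: nat
    using * that[of "4 ^ n"] by (meson not_le)
  then obtain x where x: "\<And>n::nat. x n \<in> elems X" "\<And>n. fnorm X (x n) = 1"
      "\<And>n. fnorm Y (\<lambda>t. f t * x n t) > 4 ^ n" by metis
  obtain u where u: "u \<in> elems X" "\<And>n. AE t in M. \<bar>x n t\<bar> \<le> 2 ^ n * u t"
    using di_dominate[OF X, of x] x by auto
  have fm: "f \<in> borel_measurable M" and fx: "\<And>z. z \<in> elems X \<Longrightarrow> (\<lambda>t. f t * z t) \<in> elems Y"
    using f by (auto simp: multiplier_elems)
  have "4 ^ n \<le> 2 ^ n * fnorm Y (\<lambda>t. f t * u t)" for n :: nat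
  proof -
    have "fnorm Y (\<lambda>t. f t * x n t) \<le> fnorm Y (\<lambda>t. 2 ^ n * (f t * u t))"
    proof (rule di_idealD(2)[OF Y])
      show "(\<lambda>t. 2 ^ n * (f t * u t)) \<in> elems Y" by (intro di_scale[OF Y] fx u)
      show "(\<lambda>t. f t * x n t) \<in> borel_measurable M"
        using fx[OF x(1)] by (rule di_meas[OF Y])
      show "AE t in M. \<bar>f t * x n t\<bar> \<le> \<bar>2 ^ n * (f t * u t)\<bar>"
        using u(2)[of n]
      proof eventually_elim
        case (elim t)
        then have "\<bar>f t\<bar> * \<bar>x n t\<bar> \<le> \<bar>f t\<bar> * \<bar>2 ^ n * u t\<bar>" by (intro mult_left_mono) auto
        then show ?case by (simp add: abs_mult mult_ac)
      qed
    qed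
    also have "\<dots> = 2 ^ n * fnorm Y (\<lambda>t. f t * u t)"
      using di_norm_scale[OF Y fx[OF u(1)], of "2 ^ n"] by simp
    finally show ?thesis using x(3)[of n] by simp
  qed
  moreover have "(4::real) ^ n = 2 ^ n * 2 ^ n" for n :: nat
    by (simp flip: power_mult_distrib)
  ultimately have "2 ^ n \<le> fnorm Y (\<lambda>t. f t * u t)" for n :: nat by simp
  moreover obtain n where "fnorm Y (\<lambda>t. f t * u t) < 2 ^ n"
    using real_arch_pow[of 2 "fnorm Y (\<lambda>t. f t * u t)"] by auto
  ultimately show False using not_less by blast
qed

lemma multiplier_norm_nonneg:
  assumes f: "f \<in> elems (multiplier_space M X Y)"
  shows "0 \<le> fnorm (multiplier_space M X Y) f"
proof -
  obtain K where K: "\<And>x. x \<in> elems X \<Longrightarrow> fnorm X x = 1 \<Longrightarrow> fnorm Y (\<lambda>t. f t * x t) \<le> K"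
    by (rule multiplier_bounded[OF f]) blast
  obtain w where w: "w \<in> elems X" "fnorm X w = 1" by (rule di_unit_vector[OF X pos]) blast
  have "0 \<le> fnorm Y (\<lambda>t. f t * w t)"
    using f w di_nonneg[OF Y] by (auto simp: multiplier_elems)
  also have "\<dots> \<le> (SUP y\<in>{y \<in> elems X. fnorm X y = 1}. fnorm Y (\<lambda>t. f t * y t))"
    by (rule cSUP_upper) (use K w in \<open>auto intro!: bdd_aboveI\<close>)
  finally show ?thesis by (simp add: multiplier_space_def)
qed

text \<open>Homogeneity reduces the bound to the unit sphere, except for vectors of norm zero: these
  vanish almost everywhere, so does the product, and both sides are zero.\<close>

lemma multiplier_norm_bound:
  assumes f: "f \<in> elems (multiplier_space M X Y)" and x: "x \<in> elems X"
  shows "fnorm Y (\<lambda>t. f t * x t) \<le> fnorm (multiplier_space M X Y) f * fnorm X x"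
proof -
  have fx: "\<And>z. z \<in> elems X \<Longrightarrow> (\<lambda>t. f t * z t) \<in> elems Y"
    using f by (auto simp: multiplier_elems)
  show ?thesis
  proof (cases "fnorm X x = 0")
    case True
    with x have "AE t in M. f t * x t = 0" by (auto simp: di_zero_iff[OF X] elim: eventually_mono)
    then show ?thesis using di_zero_iff[OF Y fx[OF x]] True by simp
  next
    case False
    then have p: "fnorm X x > 0" using di_nonneg[OF X x] by simp
    let ?c = "inverse (fnorm X x)" and ?z = "\<lambda>t. inverse (fnorm X x) * x t"
    obtain K where K: "\<And>x. x \<in> elems X \<Longrightarrow> fnorm X x = 1 \<Longrightarrow> fnorm Y (\<lambda>t. f t * x t) \<le> K"
      by (rule multiplier_bounded[OF f]) blast
    have "?c * fnorm Y (\<lambda>t. f t * x t) = fnorm Y (\<lambda>t. f t * ?z t)"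
      using di_norm_scale[OF Y fx[OF x], of ?c] p by (simp add: mult_ac)
    also have "\<dots> \<le> (SUP y\<in>{y \<in> elems X. fnorm X y = 1}. fnorm Y (\<lambda>t. f t * y t))"
      by (rule cSUP_upper) (use K di_normalize[OF X x p] in \<open>auto intro!: bdd_aboveI\<close>)
    finally show ?thesis using p by (simp add: multiplier_space_def field_simps)
  qed
qed

lemma multiplier_norm_leI:
  assumes "\<And>x. x \<in> elems X \<Longrightarrow> fnorm Y (\<lambda>t. f t * x t) \<le> C * fnorm X x"
  shows "fnorm (multiplier_space M X Y) f \<le> C"
proof -
  obtain w where w: "w \<in> elems X" "fnorm X w = 1" by (rule di_unit_vector[OF X pos]) blast
  have "(SUP y\<in>{y \<in> elems X. fnorm X y = 1}. fnorm Y (\<lambda>t. f t * y t)) \<le> C"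
    by (rule cSUP_least) (use w assms in fastforce)+
  then show ?thesis by (simp add: multiplier_space_def)
qed

end

section \<open>Banach ideal spaces and the domination of sequences\<close>

context
  fixes M :: "'a measure" and E :: "'a fn_space"
  assumes E: "banach_ideal_space M E"
begin

lemma bis_meas: "x \<in> elems E \<Longrightarrow> x \<in> borel_measurable M"
  using E by (auto simp: banach_ideal_space_def linear_subspace_def)

lemma bis_ideal: "ideal_property M E"
  using E by (auto simp: banach_ideal_space_def)

lemma bis_zero: "(\<lambda>_. 0) \<in> elems E"
  using E by (auto simp: banach_ideal_space_def linear_subspace_def)

lemma bis_norm_zero: "fnorm E (\<lambda>_. 0) = 0"
  using E bis_zero by (auto simp: banach_ideal_space_def is_norm_def)

lemma bis_add: "x \<in> elems E \<Longrightarrow> y \<in> elems E \<Longrightarrow> (\<lambda>t. x t + y t) \<in> elems E"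
  using E by (auto simp: banach_ideal_space_def linear_subspace_def)

lemma bis_triangle:
  "x \<in> elems E \<Longrightarrow> y \<in> elems E \<Longrightarrow> fnorm E (\<lambda>t. x t + y t) \<le> fnorm E x + fnorm E y"
  using E by (auto simp: banach_ideal_space_def is_norm_def)

lemma bis_scale: "x \<in> elems E \<Longrightarrow> (\<lambda>t. c * x t) \<in> elems E"
  using E by (auto simp: banach_ideal_space_def linear_subspace_def)

lemma bis_norm_scale: "x \<in> elems E \<Longrightarrow> fnorm E (\<lambda>t. c * x t) = \<bar>c\<bar> * fnorm E x"
  using E by (auto simp: banach_ideal_space_def is_norm_def)

lemma bis_sum:
  assumes "finite I" "\<And>i. i \<in> I \<Longrightarrow> x i \<in> elems E"
  shows "(\<lambda>t. \<Sum>i\<in>I. x i t) \<in> elems E \<and> fnorm E (\<lambda>t. \<Sum>i\<in>I. x i t) \<le> (\<Sum>i\<in>I. fnorm E (x i))"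
  using assms
proof (induction I)
  case empty
  then show ?case using bis_zero bis_norm_zero by simp
next
  case (insert i I)
  then show ?case using bis_add[of "x i" "\<lambda>t. \<Sum>i\<in>I. x i t"] bis_triangle[of "x i" "\<lambda>t. \<Sum>i\<in>I. x i t"]
    by auto
qed

text \<open>
  The norm limit of increasing partial sums dominates each of them: the positive part of
  \<open>S\<^sub>n - u\<close> is at most \<open>S\<^sub>m - u\<close> in modulus for all \<open>m \<ge> n\<close>.
\<close>

lemma bis_series_dominated:
  assumes x: "\<And>n::nat. x n \<in> elems E" "\<And>n t. 0 \<le> x n t" "\<And>n. fnorm E (x n) \<le> (1/2) ^ n"
  obtains u where "u \<in> elems E" "\<And>n. AE t in M. (\<Sum>i<n. x i t) \<le> u t"
proof -
  define S where "S n t = (\<Sum>i<n. x i t)" for n t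
  have S: "S n \<in> elems E" for n unfolding S_def using bis_sum[of "{..<n}" x] x by auto
  have diff: "fnorm E (\<lambda>t. S m t - S n t) \<le> 2 * (1/2) ^ n" if "n \<le> m" for m n
  proof -
    have eq: "S m t - S n t = (\<Sum>i\<in>{n..<m}. x i t)" for t
      unfolding S_def using that
      by (metis atLeast0LessThan sum_diff_nat_ivl zero_le)
    have "fnorm E (\<lambda>t. S m t - S n t) \<le> (\<Sum>i\<in>{n..<m}. fnorm E (x i))"
      unfolding eq using bis_sum[of "{n..<m}" x] x by auto
    also have "\<dots> \<le> (\<Sum>i\<in>{n..<m}. (1/2) ^ i)" by (intro sum_mono x)
    also have "\<dots> = 2 * ((1/2) ^ n - (1/2) ^ m)"
      using that by (induction m rule: dec_induct) (auto simp: sum.atLeastLessThan_Suc)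
    also have "\<dots> \<le> 2 * (1/2) ^ n" by (simp add: right_diff_distrib)
    finally show ?thesis .
  qed
  have neg: "fnorm E (\<lambda>t. S m t - S n t) = fnorm E (\<lambda>t. S n t - S m t)" for m n
  proof -
    have "(\<lambda>t. S m t + (-1) * S n t) \<in> elems E" by (intro bis_add bis_scale S)
    from bis_norm_scale[OF this, of "-1"] show ?thesis by (simp add: algebra_simps)
  qed
  have diff': "fnorm E (\<lambda>t. S m t - S n t) \<le> 2 * (1/2) ^ N" if "N \<le> m" "N \<le> n" for m n N
  proof (cases "n \<le> m")
    case True
    have "(1/2::real) ^ n \<le> (1/2) ^ N" using that by (intro power_decreasing) auto
    with diff[OF True] show ?thesis by linarith
  next
    case False
    have "(1/2::real) ^ m \<le> (1/2) ^ N" using that by (intro power_decreasing) auto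
    moreover have "fnorm E (\<lambda>t. S n t - S m t) \<le> 2 * (1/2) ^ m" using False by (intro diff) simp
    ultimately show ?thesis using neg[of m n] by linarith
  qed
  have cauchy: "\<exists>N. \<forall>m\<ge>N. \<forall>n\<ge>N. fnorm E (\<lambda>t. S m t - S n t) < e" if e: "e > 0" for e
  proof -
    obtain N where "(1/2::real) ^ N < e / 2" using real_arch_pow_inv[of "e/2" "1/2"] e by auto
    then have "2 * (1/2::real) ^ N < e" by simp
    then have "\<forall>m\<ge>N. \<forall>n\<ge>N. fnorm E (\<lambda>t. S m t - S n t) < e"
      using diff' le_less_trans by blast
    then show ?thesis by blast
  qed
  have "norm_complete E" using E by (simp add: banach_ideal_space_def)
  moreover have "(\<forall>n. S n \<in> elems E) \<and>
      (\<forall>e>0. \<exists>N. \<forall>m\<ge>N. \<forall>n\<ge>N. fnorm E (\<lambda>t. S m t - S n t) < e)"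
    using S cauchy by (intro conjI allI impI)
  ultimately have "\<exists>u\<in>elems E. (\<lambda>n. fnorm E (\<lambda>t. S n t - u t)) \<longlonglongrightarrow> 0"
    unfolding norm_complete_def by (elim allE[of _ S]) (rule mp)
  then obtain u where u: "u \<in> elems E" "(\<lambda>n. fnorm E (\<lambda>t. S n t - u t)) \<longlonglongrightarrow> 0" by blast
  have "AE t in M. S n t \<le> u t" for n
  proof -
    define p where "p t = max 0 (S n t - u t)" for t
    have mp: "p \<in> borel_measurable M"
      using bis_meas[OF S[of n]] bis_meas[OF u(1)] unfolding p_def by measurable
    have du: "(\<lambda>t. S m t - u t) \<in> elems E" for m
      using bis_add[OF S[of m] bis_scale[OF u(1), of "-1"]] by simp
    have dom: "p \<in> elems E \<and> fnorm E p \<le> fnorm E (\<lambda>t. S m t - u t)" if "n \<le> m" for m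
    proof -
      have "\<bar>p t\<bar> \<le> \<bar>S m t - u t\<bar>" for t
      proof -
        have "S n t \<le> S m t" unfolding S_def using that x by (intro sum_mono2) auto
        then show ?thesis by (auto simp: p_def)
      qed
      then show ?thesis using idealD[OF bis_ideal du mp] by blast
    qed
    have "fnorm E p \<le> 0"
      by (rule LIMSEQ_le_const[OF u(2)]) (use dom in blast)
    moreover have "p \<in> elems E" using dom by blast
    ultimately have "AE t in M. p t = 0"
      using E unfolding banach_ideal_space_def is_norm_def by (metis antisym)
    then show ?thesis by eventually_elim (auto simp: p_def max_def split: if_splits)
  qed
  with u(1) show ?thesis by (intro that[of u]) (auto simp: S_def)
qed

text \<open>Completeness yields the domination clause: the partial sums of
  \<open>(1/2) ^ n * |x n|\<close> lie under one element of \<open>E\<close>, and each summand is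
  below the partial sums that contain it.\<close>

lemma bis_dominating: "dominating_ideal M E"
proof -
  have "\<exists>u\<in>elems E. \<forall>n. AE t in M. \<bar>x n t\<bar> \<le> 2 ^ n * u t"
    if x: "\<forall>n::nat. x n \<in> elems E \<and> fnorm E (x n) \<le> 1" for x
  proof -
    define y where "y n t = (1/2) ^ n * \<bar>x n t\<bar>" for n t
    have ax: "(\<lambda>t. \<bar>x n t\<bar>) \<in> elems E" "fnorm E (\<lambda>t. \<bar>x n t\<bar>) \<le> 1" for n
    proof -
      have xn: "x n \<in> elems E" "fnorm E (x n) \<le> 1" using x by auto
      have "(\<lambda>t. \<bar>x n t\<bar>) \<in> borel_measurable M" using bis_meas[OF xn(1)] by measurable
      from idealD[OF bis_ideal xn(1) this] xn(2)
      show "(\<lambda>t. \<bar>x n t\<bar>) \<in> elems E" "fnorm E (\<lambda>t. \<bar>x n t\<bar>) \<le> 1" by auto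
    qed
    have y: "y n \<in> elems E" "fnorm E (y n) \<le> (1/2) ^ n" for n
      using bis_scale[OF ax(1)] bis_norm_scale[OF ax(1)[of n], of "(1/2) ^ n"] ax(2)[of n]
      unfolding y_def by (auto simp: mult_left_le)
    obtain u where u: "u \<in> elems E" "\<And>n. AE t in M. (\<Sum>i<n. y i t) \<le> u t"
      by (rule bis_series_dominated[of y]) (use y in \<open>auto simp: y_def\<close>)
    have "AE t in M. \<bar>x n t\<bar> \<le> 2 ^ n * u t" for n
      using u(2)[of "Suc n"]
    proof eventually_elim
      case (elim t)
      have "0 \<le> (\<Sum>i<n. y i t)" by (intro sum_nonneg) (auto simp: y_def)
      with elim have "y n t \<le> u t" by simp
      then show ?case by (simp add: y_def field_simps)
    qed
    with u(1) show ?thesis by blast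
  qed
  then show ?thesis
    using E unfolding dominating_ideal_def banach_ideal_space_def linear_subspace_def is_norm_def
    by (intro conjI ballI allI impI) blast+
qed

end

section \<open>Rearrangements over an ordered measure space\<close>

text \<open>
  The half line and the positive integers are treated together: \<open>r t\<close> is the measure of the
  initial segment up to \<open>t\<close>, and \<open>tk k\<close> (\<open>k \<in> K\<close>) are dyadic points.  The two
  \<open>quantile\<close> conditions say that \<open>r\<close> pushes the measure forward to one that a rearrangement may
  use as its time axis; \<open>subset_exact\<close> accommodates atoms by rounding \<open>e\<close> up to an attained value.
\<close>

locale ordered_measure =
  fixes M :: "'a::linorder measure" and r :: "'a \<Rightarrow> real" and K :: "int set" and tk :: "int \<Rightarrow> 'a"
  assumes sigma_finite: "sigma_finite_measure M"
    and r_pos: "t \<in> space M \<Longrightarrow> 0 < r t"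
    and initial: "t \<in> space M \<Longrightarrow> emeasure M ({..t} \<inter> space M) = ennreal (r t)"
    and down_closed: "D \<subseteq> space M \<Longrightarrow> (\<And>s t. t \<in> D \<Longrightarrow> s \<in> space M \<Longrightarrow> s \<le> t \<Longrightarrow> s \<in> D) \<Longrightarrow>
      D \<in> sets M \<and> (\<exists>T. countable T \<and> T \<subseteq> D \<and> (AE s in M. s \<in> D \<longrightarrow> (\<exists>t\<in>T. s \<le> t)))"
    and quantile_le: "emeasure M {t \<in> space M. ennreal (r t) \<le> v} \<le> v"
    and quantile_eq: "A \<in> sets M \<Longrightarrow>
      emeasure M {t \<in> space M. ennreal (r t) \<le> emeasure M A} = emeasure M A"
    and double: "t \<in> space M \<Longrightarrow> ennreal (r t) \<le> emeasure M {s \<in> space M. t \<le> s \<and> r s \<le> 2 * r t}"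
    and subset_exact: "0 < e \<Longrightarrow> \<exists>\<rho>\<ge>e. (\<forall>t\<in>space M. e \<le> r t \<longrightarrow> \<rho> \<le> r t) \<and>
      (\<forall>A\<in>sets M. ennreal e \<le> emeasure M A \<longrightarrow> (\<exists>P\<in>sets M. P \<subseteq> A \<and> emeasure M P = ennreal \<rho>))"
    and zero_K: "0 \<in> K"
    and tk: "k \<in> K \<Longrightarrow> tk k \<in> space M \<and> r (tk k) = 2 powi k"
    and dyadic: "t \<in> space M \<Longrightarrow> \<exists>k\<in>K. tk k \<le> t \<and> r t \<le> 2 * 2 powi k"
begin

lemma initial_sets: "t \<in> space M \<Longrightarrow> {..t} \<inter> space M \<in> sets M"
  by (rule down_closed[THEN conjunct1]) auto

lemma initial_mono: "s \<in> space M \<Longrightarrow> t \<in> space M \<Longrightarrow> s \<le> t \<Longrightarrow> r s \<le> r t"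
proof -
  assume st: "s \<in> space M" "t \<in> space M" "s \<le> t"
  have "emeasure M ({..s} \<inter> space M) \<le> emeasure M ({..t} \<inter> space M)"
    by (intro emeasure_mono initial_sets st) (use st in auto)
  then show ?thesis using st r_pos[of t] by (simp add: initial)
qed

lemma space_ge_1: "1 \<le> emeasure M (space M)"
proof -
  have "emeasure M ({..tk 0} \<inter> space M) = 1" using tk[OF zero_K] initial[of "tk 0"] by simp
  moreover have "emeasure M ({..tk 0} \<inter> space M) \<le> emeasure M (space M)"
    by (intro emeasure_mono) auto
  ultimately show ?thesis by simp
qed

lemma space_pos: "0 < emeasure M (space M)"
  using space_ge_1 by (rule less_le_trans[rotated]) simp

lemma antimono_on_measurable:
  fixes f :: "'a \<Rightarrow> real"
  assumes "antimono_on (space M) f"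
  shows "f \<in> borel_measurable M"
  unfolding borel_measurable_iff_greater
proof
  fix a
  show "{w \<in> space M. a < f w} \<in> sets M"
    by (rule down_closed[THEN conjunct1])
      (use assms in \<open>auto simp: monotone_on_def intro: less_le_trans\<close>)
qed

lemma mono_on_measurable:
  fixes f :: "'a \<Rightarrow> real"
  assumes "mono_on (space M) f"
  shows "f \<in> borel_measurable M"
  unfolding borel_measurable_iff_le
proof
  fix a
  show "{w \<in> space M. f w \<le> a} \<in> sets M"
    by (rule down_closed[THEN conjunct1])
      (use assms in \<open>auto simp: monotone_on_def intro: order_trans\<close>)
qed

lemma AE_below:
  assumes "AE s in M. P s" "t \<in> space M"
  obtains s where "s \<in> space M" "s \<le> t" "P s"
proof (rule ccontr)
  assume *: "\<not> thesis"
  have "AE s in M. s \<notin> {..t} \<inter> space M"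
    using assms(1) by eventually_elim (use * that in auto)
  then have "emeasure M ({..t} \<inter> space M) = 0"
    using AE_iff_measurable[OF initial_sets[OF assms(2)], of "\<lambda>s. s \<notin> {..t} \<inter> space M"] by auto
  with initial[OF assms(2)] r_pos[OF assms(2)] show False by simp
qed

text \<open>By \<open>double\<close> the points from \<open>t\<close> on with measure scale up to
  \<open>2 * r t\<close> form a set of positive measure, which cannot avoid an almost sure event.
  Together with \<open>AE_below\<close> this upgrades almost everywhere bounds of monotone functions
  to bounds at every point.\<close>

lemma AE_above:
  assumes "AE s in M. P s" "t \<in> space M"
  obtains s where "s \<in> space M" "t \<le> s" "P s"
proof (rule ccontr)
  assume *: "\<not> thesis"
  let ?A = "{s \<in> space M. t \<le> s \<and> r s \<le> 2 * r t}"
  have "AE s in M. s \<notin> ?A"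
    using assms(1) by eventually_elim (use * that in auto)
  \<comment> \<open>A set outside \<open>sets M\<close> has \<open>emeasure\<close> zero by
    convention, so the positive lower bound in \<open>double\<close> already forces
    measurability.\<close>
  moreover have "?A \<in> sets M"
  proof (rule ccontr)
    assume "?A \<notin> sets M"
    then have "emeasure M ?A = 0" by (rule emeasure_notin_sets)
    then show False using double[OF assms(2)] r_pos[OF assms(2)] by simp
  qed
  ultimately have "emeasure M ?A = 0"
    using AE_iff_measurable[of ?A M "\<lambda>s. s \<notin> ?A"] by auto
  with double[OF assms(2)] r_pos[OF assms(2)] show False by simp
qed

section \<open>Distribution functions and decreasing rearrangements\<close>

definition dfun :: "('a \<Rightarrow> real) \<Rightarrow> real \<Rightarrow> ennreal" where
  "dfun x l = emeasure M {s \<in> space M. l < \<bar>x s\<bar>}"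

text \<open>Exactly the functions whose rearrangement is finite.\<close>

definition tame :: "('a \<Rightarrow> real) \<Rightarrow> bool" where
  "tame x \<longleftrightarrow> (\<forall>e>0. \<exists>l\<ge>0. dfun x l < ennreal e)"

text \<open>On the half line this is \<open>x\<^sup>*(c t)\<close>.\<close>

definition rearr :: "real \<Rightarrow> ('a \<Rightarrow> real) \<Rightarrow> 'a \<Rightarrow> real" where
  "rearr c x t = Inf {l. 0 \<le> l \<and> dfun x l < ennreal (c * r t)}"

lemma dfun_sets:
  fixes x :: "'a \<Rightarrow> real"
  assumes [measurable]: "x \<in> borel_measurable M"
  shows "{s \<in> space M. l < \<bar>x s\<bar>} \<in> sets M"
  by measurable

lemma dfun_antimono: "x \<in> borel_measurable M \<Longrightarrow> l \<le> l' \<Longrightarrow> dfun x l' \<le> dfun x l"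
  unfolding dfun_def by (intro emeasure_mono dfun_sets) auto

lemma dfun_le:
  assumes "y \<in> borel_measurable M" "AE s in M. \<bar>x s\<bar> \<le> \<bar>y s\<bar>"
  shows "dfun x l \<le> dfun y l"
  unfolding dfun_def
  by (rule emeasure_mono_AE) (use assms in \<open>auto elim: eventually_mono\<close>)

lemma equimeasurable_dfun: "equimeasurable M x y \<longleftrightarrow> (\<forall>l\<ge>0. dfun x l = dfun y l)"
  by (simp add: equimeasurable_def dfun_def)

lemma rearr_bdd: "bdd_below {l. 0 \<le> l \<and> dfun x l < ennreal v}"
  by (auto intro: bdd_belowI[of _ 0])

lemma rearr_le: "0 \<le> l \<Longrightarrow> dfun x l < ennreal (c * r t) \<Longrightarrow> rearr c x t \<le> l"
  unfolding rearr_def by (intro cInf_lower rearr_bdd) auto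

lemma rearr_gtD: "0 \<le> l \<Longrightarrow> l < rearr c x t \<Longrightarrow> ennreal (c * r t) \<le> dfun x l"
  using rearr_le[of l x c t] by force

context
  fixes x :: "'a \<Rightarrow> real" and c :: real
  assumes x: "x \<in> borel_measurable M" "tame x" and c: "0 < c"
begin

lemma rearr_nonempty: "t \<in> space M \<Longrightarrow> {l. 0 \<le> l \<and> dfun x l < ennreal (c * r t)} \<noteq> {}"
  using x(2) c r_pos[of t] unfolding tame_def by (auto dest: spec[of _ "c * r t"])

lemma rearr_nonneg: "t \<in> space M \<Longrightarrow> 0 \<le> rearr c x t"
  unfolding rearr_def by (rule cInf_greatest[OF rearr_nonempty]) auto

lemma rearr_lessD:
  assumes "t \<in> space M" "rearr c x t < l"
  shows "dfun x l < ennreal (c * r t)"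
proof -
  obtain l' where "l' < l" "dfun x l' < ennreal (c * r t)"
    using cInf_lessD[OF rearr_nonempty[OF assms(1)], of l] assms(2) unfolding rearr_def by blast
  then show ?thesis using dfun_antimono[OF x(1), of l' l] by simp
qed

lemma rearr_ge: "t \<in> space M \<Longrightarrow> ennreal (c * r t) \<le> dfun x l \<Longrightarrow> l \<le> rearr c x t"
  using rearr_lessD[of t l] by force

lemma rearr_antimono: "antimono_on (space M) (rearr c x)"
proof (rule monotone_onI)
  fix s t assume st: "s \<in> space M" "t \<in> space M" "s \<le> t"
  have "c * r s \<le> c * r t" using initial_mono[OF st] c by simp
  then have "{l. 0 \<le> l \<and> dfun x l < ennreal (c * r s)} \<subseteq> {l. 0 \<le> l \<and> dfun x l < ennreal (c * r t)}"
    by (auto intro: less_le_trans ennreal_leI)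
  then show "rearr c x t \<le> rearr c x s"
    unfolding rearr_def by (intro cInf_superset_mono rearr_nonempty st rearr_bdd)
qed

lemma rearr_measurable: "rearr c x \<in> borel_measurable M"
  by (rule antimono_on_measurable[OF rearr_antimono])

text \<open>If the rearrangement exceeds \<open>l\<close> at \<open>t\<close>, then
  \<open>c * r t\<close> is at most \<open>dfun x l\<close>, and \<open>quantile_le\<close> bounds
  the measure of all such \<open>t\<close>. With atoms, rounding can make the inequality
  strict.\<close>

lemma dfun_rearr_le:
  assumes "0 \<le> l"
  shows "dfun (rearr c x) l \<le> ennreal (1 / c) * dfun x l"
proof -
  have "dfun (rearr c x) l \<le> emeasure M {t \<in> space M. ennreal (r t) \<le> ennreal (1 / c) * dfun x l}"
    unfolding dfun_def[of "rearr c x"]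
  proof (rule emeasure_mono)
    show "{t \<in> space M. ennreal (r t) \<le> ennreal (1 / c) * dfun x l} \<in> sets M"
      by (rule down_closed[THEN conjunct1]) (auto intro: order_trans initial_mono ennreal_leI)
    show "{s \<in> space M. l < \<bar>rearr c x s\<bar>} \<subseteq> {t \<in> space M. ennreal (r t) \<le> ennreal (1 / c) * dfun x l}"
    proof safe
      fix t assume t: "t \<in> space M" "l < \<bar>rearr c x t\<bar>"
      then have "ennreal (c * r t) \<le> dfun x l" using rearr_nonneg assms by (intro rearr_gtD) auto
      then have "ennreal (1 / c) * ennreal (c * r t) \<le> ennreal (1 / c) * dfun x l"
        by (rule mult_left_mono) simp
      moreover have "ennreal (1 / c) * ennreal (c * r t) = ennreal (r t)"
        using c by (subst ennreal_mult'[symmetric]) auto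
      ultimately show "ennreal (r t) \<le> ennreal (1 / c) * dfun x l" by simp
    qed
  qed
  also have "\<dots> \<le> ennreal (1 / c) * dfun x l" by (rule quantile_le)
  finally show ?thesis .
qed

lemma tame_rearr: "tame (rearr c x)"
  unfolding tame_def
proof (intro allI impI)
  fix e :: real assume e: "0 < e"
  then obtain l where l: "0 \<le> l" "dfun x l < ennreal (c * e)"
    using x(2) c unfolding tame_def by (meson mult_pos_pos)
  have "dfun (rearr c x) l \<le> ennreal (1 / c) * dfun x l" by (rule dfun_rearr_le[OF l(1)])
  also have "\<dots> < ennreal (1 / c) * ennreal (c * e)"
    using c by (intro ennreal_mult_strict_left_mono l) auto
  also have "\<dots> = ennreal e" using c by (subst ennreal_mult'[symmetric]) auto
  finally show "\<exists>l\<ge>0. dfun (rearr c x) l < ennreal e" using l by blast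
qed

end

text \<open>The level set is the increasing union of the level sets at slightly larger heights. The
  slack \<open>1 / Suc n\<close> turns the weak bound of \<open>rearr_ge\<close> into a strict one
  in the proof of equimeasurability.\<close>

lemma dfun_right_continuous:
  assumes x: "x \<in> borel_measurable M"
  shows "dfun x l = (SUP n. dfun x (l + 1 / Suc n))"
proof -
  let ?A = "\<lambda>n. {s \<in> space M. l + 1 / Suc n < \<bar>x s\<bar>}"
  have "{s \<in> space M. l < \<bar>x s\<bar>} = (\<Union>n. ?A n)"
  proof (intro equalityI subsetI)
    fix s assume "s \<in> {s \<in> space M. l < \<bar>x s\<bar>}"
    then have s: "s \<in> space M" "0 < \<bar>x s\<bar> - l" by auto
    obtain n where "inverse (real (Suc n)) < \<bar>x s\<bar> - l" using reals_Archimedean[OF s(2)] by blast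
    then show "s \<in> (\<Union>n. ?A n)" using s by (auto simp: inverse_eq_divide algebra_simps)
  next
    fix s assume "s \<in> (\<Union>n. ?A n)"
    then obtain n where "s \<in> space M" "l + 1 / Suc n < \<bar>x s\<bar>" by auto
    moreover have "0 < 1 / real (Suc n)" by simp
    ultimately have "s \<in> space M" "l < \<bar>x s\<bar>" by linarith+
    then show "s \<in> {s \<in> space M. l < \<bar>x s\<bar>}" by simp
  qed
  moreover have "incseq ?A"
  proof (rule incseq_SucI, safe)
    fix n s assume "l + 1 / real (Suc n) < \<bar>x s\<bar>"
    moreover have "1 / real (Suc (Suc n)) \<le> 1 / real (Suc n)" by (intro divide_left_mono) auto
    ultimately show "l + 1 / real (Suc (Suc n)) < \<bar>x s\<bar>" by linarith
  qed
  ultimately show ?thesis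
    unfolding dfun_def using SUP_emeasure_incseq[of ?A M] dfun_sets[OF x] by (auto simp: image_subset_iff)
qed

text \<open>Since \<open>dfun x l\<close> is the measure of a set, \<open>quantile_eq\<close> says
  that the points with \<open>r t\<close> at most this value have exactly this measure, and there
  the rearrangement is at least \<open>l\<close>. The strict inequality inside \<open>rearr\<close>
  matters for sequences: at \<open>n\<close> it yields the n-th largest value, a weak one would
  yield the next.\<close>

lemma rearr_equimeasurable:
  assumes x: "x \<in> borel_measurable M" "tame x"
  shows "equimeasurable M x (rearr 1 x)"
  unfolding equimeasurable_dfun
proof (intro allI impI antisym)
  fix l :: real assume l: "0 \<le> l"
  show "dfun (rearr 1 x) l \<le> dfun x l" using dfun_rearr_le[OF x, of 1 l] l by simp
  show "dfun x l \<le> dfun (rearr 1 x) l"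
    unfolding dfun_right_continuous[OF x(1), of l]
  proof (rule SUP_least)
    fix n
    let ?l = "l + 1 / real (Suc n)"
    have "dfun x ?l = emeasure M {t \<in> space M. ennreal (r t) \<le> dfun x ?l}"
      unfolding dfun_def by (rule quantile_eq[symmetric, OF dfun_sets[OF x(1)]])
    also have "\<dots> \<le> dfun (rearr 1 x) l"
      unfolding dfun_def[of "rearr 1 x"]
    proof (rule emeasure_mono)
      show "{s \<in> space M. l < \<bar>rearr 1 x s\<bar>} \<in> sets M"
        by (intro dfun_sets rearr_measurable x) simp
      show "{t \<in> space M. ennreal (r t) \<le> dfun x ?l} \<subseteq> {s \<in> space M. l < \<bar>rearr 1 x s\<bar>}"
      proof safe
        fix t assume t: "t \<in> space M" "ennreal (r t) \<le> dfun x ?l"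
        then have "?l \<le> rearr 1 x t" by (intro rearr_ge x) auto
        moreover have "0 < 1 / real (Suc n)" by simp
        ultimately show "l < \<bar>rearr 1 x t\<bar>" by linarith
      qed
    qed
    finally show "dfun x ?l \<le> dfun (rearr 1 x) l" .
  qed
qed

lemma dfun_mult_le:
  assumes "a \<in> borel_measurable M" "b \<in> borel_measurable M" "0 \<le> l" "0 \<le> l'"
  shows "dfun (\<lambda>t. a t * b t) (l * l') \<le> dfun a l + dfun b l'"
proof -
  have "{s \<in> space M. l * l' < \<bar>a s * b s\<bar>} \<subseteq> {s \<in> space M. l < \<bar>a s\<bar>} \<union> {s \<in> space M. l' < \<bar>b s\<bar>}"
  proof safe
    fix s assume *: "l * l' < \<bar>a s * b s\<bar>" "\<not> l' < \<bar>b s\<bar>"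
    show "l < \<bar>a s\<bar>"
    proof (rule ccontr)
      assume "\<not> l < \<bar>a s\<bar>"
      then have "\<bar>a s\<bar> * \<bar>b s\<bar> \<le> l * l'" using * assms by (intro mult_mono) auto
      with * show False by (simp add: abs_mult)
    qed
  qed
  then have "dfun (\<lambda>t. a t * b t) (l * l') \<le> emeasure M ({s \<in> space M. l < \<bar>a s\<bar>} \<union> {s \<in> space M. l' < \<bar>b s\<bar>})"
    unfolding dfun_def by (intro emeasure_mono sets.Un dfun_sets assms)
  also have "\<dots> \<le> dfun a l + dfun b l'"
    unfolding dfun_def by (intro emeasure_subadditive dfun_sets assms)
  finally show ?thesis .
qed

lemma tame_mult:
  assumes a: "a \<in> borel_measurable M" "tame a" and b: "b \<in> borel_measurable M" "tame b"
  shows "tame (\<lambda>t. a t * b t)"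
  unfolding tame_def
proof (intro allI impI)
  fix e :: real assume "0 < e"
  then obtain l l' where l: "0 \<le> l" "dfun a l < ennreal (e/2)" "0 \<le> l'" "dfun b l' < ennreal (e/2)"
    using a(2) b(2) unfolding tame_def by (meson half_gt_zero)
  have "dfun (\<lambda>t. a t * b t) (l * l') \<le> dfun a l + dfun b l'"
    by (rule dfun_mult_le[OF a(1) b(1) l(1,3)])
  also have "\<dots> < ennreal (e/2) + ennreal (e/2)" by (intro add_strict_mono l)
  also have "\<dots> = ennreal e" using \<open>0 < e\<close> by (simp flip: ennreal_plus)
  finally show "\<exists>l\<ge>0. dfun (\<lambda>t. a t * b t) l < ennreal e" using l by (intro exI[of _ "l * l'"]) auto
qed

text \<open>The admissible measure \<open>c * r t\<close> of a level set of the product is split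
  evenly between the two factors. The infima need not be attained, so both levels are raised by
  \<open>e\<close>, and \<open>e\<close> tends to zero at the end.\<close>

lemma rearr_mult_le:
  assumes a: "a \<in> borel_measurable M" "tame a" and b: "b \<in> borel_measurable M" "tame b"
    and t: "t \<in> space M" and c: "0 < c"
  shows "rearr c (\<lambda>t. a t * b t) t \<le> rearr (c/2) a t * rearr (c/2) b t"
proof -
  let ?A = "rearr (c/2) a t" and ?B = "rearr (c/2) b t"
  have AB: "0 \<le> ?A" "0 \<le> ?B" using c by (auto intro!: rearr_nonneg a b t)
  have *: "rearr c (\<lambda>t. a t * b t) t \<le> (?A + e) * (?B + e)" if e: "0 < e" for e
  proof (rule rearr_le)
    have "dfun (\<lambda>t. a t * b t) ((?A + e) * (?B + e)) \<le> dfun a (?A + e) + dfun b (?B + e)"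
      using AB e by (intro dfun_mult_le a b) auto
    also have "\<dots> < ennreal (c/2 * r t) + ennreal (c/2 * r t)"
      using e c by (intro add_strict_mono rearr_lessD a b t) auto
    also have "\<dots> = ennreal (c * r t)" using r_pos[OF t] c by (simp flip: ennreal_plus)
    finally show "dfun (\<lambda>t. a t * b t) ((?A + e) * (?B + e)) < ennreal (c * r t)" .
  qed (use AB e in auto)
  have "((\<lambda>e. (?A + e) * (?B + e)) \<longlongrightarrow> (?A + 0) * (?B + 0)) (at_right 0)"
    by (intro tendsto_intros)
  then show ?thesis
    using * by (auto intro!: tendsto_lowerbound simp: eventually_at_right_less eventually_at_filter)
qed

text \<open>
  Since sets of a fixed measure have indicators of a fixed norm, a function which is large on
  such sets cannot have a bounded norm on them.
\<close>

definition attained :: "real \<Rightarrow> real \<Rightarrow> bool" where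
  "attained e \<rho> \<longleftrightarrow> (\<forall>A\<in>sets M. ennreal e \<le> emeasure M A \<longrightarrow>
     (\<exists>P\<in>sets M. P \<subseteq> A \<and> emeasure M P = ennreal \<rho>))"

text \<open>Some level set of a weak unit has measure above \<open>e\<close>, because the whole
  space has measure at least 1 and \<open>e < 1\<close>. A subset of measure \<open>\<rho>\<close>
  has its indicator below a multiple of the weak unit, and the indicators of all other sets of this
  measure are equimeasurable with it.\<close>

lemma indicator_norm:
  assumes F: "symmetric_space M F" and e: "0 < e" "e < 1" "e \<le> \<rho>" "attained e \<rho>"
  obtains a where "0 < a"
    "\<And>P. P \<in> sets M \<Longrightarrow> emeasure M P = ennreal \<rho> \<Longrightarrow>
      indicator P \<in> elems F \<and> fnorm F (indicator P) = a"
proof -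
  have bis: "banach_ideal_space M F" using F by (simp add: symmetric_space_def)
  note di = bis_dominating[OF bis]
  obtain w where w: "w \<in> elems F" "AE t in M. 0 < w t" by (rule di_weak_unit[OF di])
  have wm[measurable]: "w \<in> borel_measurable M" by (rule di_meas[OF di w(1)])
  let ?A = "\<lambda>n. {s \<in> space M. 1 / real (Suc n) < w s}"
  have "(SUP n. emeasure M (?A n)) = emeasure M (\<Union>n. ?A n)"
  proof (rule SUP_emeasure_incseq)
    show "incseq ?A"
    proof (rule incseq_SucI, safe)
      fix n s assume "1 / real (Suc n) < w s"
      moreover have "1 / real (Suc (Suc n)) \<le> 1 / real (Suc n)" by (intro divide_left_mono) auto
      ultimately show "1 / real (Suc (Suc n)) < w s" by linarith
    qed
  qed auto
  also have "\<dots> = emeasure M (space M)"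
  proof (rule emeasure_eq_AE)
    show "AE s in M. (s \<in> (\<Union>n. ?A n)) = (s \<in> space M)"
      using w(2)
    proof eventually_elim
      case (elim s)
      then obtain n where "inverse (real (Suc n)) < w s" using reals_Archimedean by blast
      then show ?case by (auto simp: inverse_eq_divide)
    qed
  qed auto
  finally have "ennreal e < (SUP n. emeasure M (?A n))"
    using space_ge_1 e by (simp add: less_le_trans[of _ 1] ennreal_less_one_iff)
  then obtain n where n: "ennreal e < emeasure M (?A n)" by (auto simp: less_SUP_iff)
  have "?A n \<in> sets M" by measurable
  then obtain P where P: "P \<in> sets M" "P \<subseteq> ?A n" "emeasure M P = ennreal \<rho>"
    using e(4) n unfolding attained_def by (meson less_imp_le)
  have iP: "indicator P \<in> elems F"
  proof (rule di_idealD(1)[OF di])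
    show "(\<lambda>t. real (Suc n) * w t) \<in> elems F" by (rule di_scale[OF di w(1)])
    show "AE t in M. \<bar>indicator P t\<bar> \<le> \<bar>real (Suc n) * w t\<bar>"
      using P(2) by (intro AE_I2) (auto simp: indicator_def field_simps subset_eq)
  qed (use P in measurable)
  show ?thesis
  proof
    have "\<not> (AE t in M. indicator P t = (0::real))"
    proof
      assume "AE t in M. indicator P t = (0::real)"
      then have "AE t in M. t \<notin> P" by eventually_elim (auto simp: indicator_def split: if_splits)
      then have "emeasure M P = 0"
        using AE_iff_measurable[OF P(1), of "\<lambda>t. t \<notin> P"] sets.sets_into_space[OF P(1)] by auto
      with P e show False by simp
    qed
    then show "0 < fnorm F (indicator P)"
      using di_nonneg[OF di iP] di_zero_iff[OF di iP] by (simp add: less_le)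
  next
    fix Q assume Q: "Q \<in> sets M" "emeasure M Q = ennreal \<rho>"
    have lev: "dfun (indicator S) l = (if l < 1 then emeasure M S else 0)" if "S \<in> sets M" "0 \<le> l" for S l
    proof -
      have "{s \<in> space M. l < \<bar>indicator S s :: real\<bar>} = (if l < 1 then S else {})"
        using sets.sets_into_space[OF that(1)] that(2) by (auto simp: indicator_def split: if_splits)
      then show ?thesis by (simp add: dfun_def)
    qed
    have "equimeasurable M (indicator P) (indicator Q)"
      using P Q by (simp add: equimeasurable_dfun lev)
    moreover have "indicator Q \<in> borel_measurable M" using Q by measurable
    ultimately show "indicator Q \<in> elems F \<and> fnorm F (indicator Q) = fnorm F (indicator P)"
      using F iP unfolding symmetric_space_def by blast
  qed
qed

lemma tameI:
  assumes F: "symmetric_space M F" and x[measurable]: "x \<in> borel_measurable M"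
    and bound: "\<And>e \<rho>. 0 < e \<Longrightarrow> e < 1 \<Longrightarrow> e \<le> \<rho> \<Longrightarrow> attained e \<rho> \<Longrightarrow>
      \<exists>C. \<forall>P\<in>sets M. emeasure M P = ennreal \<rho> \<longrightarrow>
        (\<lambda>t. x t * indicator P t) \<in> elems F \<and> fnorm F (\<lambda>t. x t * indicator P t) \<le> C"
  shows "tame x"
  unfolding tame_def
proof (intro allI impI)
  fix e0 :: real assume e0: "0 < e0"
  \<comment> \<open>\<open>indicator_norm\<close> works below 1 only; shrinking \<open>e\<close>
    strengthens what has to be shown.\<close>
  define e where "e = min e0 (1/2)"
  have e: "0 < e" "e < 1" "e \<le> e0" using e0 by (auto simp: e_def)
  obtain \<rho> where \<rho>: "e \<le> \<rho>" "attained e \<rho>" using subset_exact[OF e(1)] unfolding attained_def by blast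
  obtain a where a: "0 < a" "\<And>P. P \<in> sets M \<Longrightarrow> emeasure M P = ennreal \<rho> \<Longrightarrow>
      indicator P \<in> elems F \<and> fnorm F (indicator P) = a"
    by (rule indicator_norm[OF F e(1,2) \<rho>]) blast
  obtain C where C: "\<And>P. P \<in> sets M \<Longrightarrow> emeasure M P = ennreal \<rho> \<Longrightarrow>
        (\<lambda>t. x t * indicator P t) \<in> elems F \<and> fnorm F (\<lambda>t. x t * indicator P t) \<le> C"
    using bound[OF e(1,2) \<rho>] by blast
  \<comment> \<open>Chosen so that \<open>l * a\<close> exceeds \<open>C\<close>, the bound that the
    restrictions of \<open>x\<close> obey.\<close>
  define l where "l = (\<bar>C\<bar> + 1) / a"
  have l: "0 \<le> l" using a by (simp add: l_def)
  have "dfun x l < ennreal e"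
  proof (rule ccontr)
    assume "\<not> dfun x l < ennreal e"
    then have "ennreal e \<le> emeasure M {s \<in> space M. l < \<bar>x s\<bar>}" by (simp add: dfun_def)
    then obtain P where P: "P \<in> sets M" "P \<subseteq> {s \<in> space M. l < \<bar>x s\<bar>}" "emeasure M P = ennreal \<rho>"
      using \<rho>(2) dfun_sets[OF x] unfolding attained_def by meson
    have bis: "banach_ideal_space M F" using F by (simp add: symmetric_space_def)
    have "l * a = fnorm F (\<lambda>t. l * indicator P t)"
      using bis_norm_scale[OF bis, of "indicator P" l] a(2)[OF P(1,3)] l by simp
    also have "\<dots> \<le> fnorm F (\<lambda>t. x t * indicator P t)"
    proof (rule idealD(2)[OF bis_ideal[OF bis]])
      show "AE t in M. \<bar>l * indicator P t\<bar> \<le> \<bar>x t * indicator P t\<bar>"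
        using P(2) l by (intro AE_I2) (auto simp: indicator_def subset_eq)
    qed (use C[OF P(1,3)] P in auto)
    also have "\<dots> \<le> C" using C[OF P(1,3)] by blast
    finally show False using a by (simp add: l_def)
  qed
  also have "\<dots> \<le> ennreal e0" using e by (simp add: ennreal_leI)
  finally show "\<exists>l\<ge>0. dfun x l < ennreal e0" using l by blast
qed

lemma tame_elems:
  assumes F: "symmetric_space M F" and x: "x \<in> elems F"
  shows "tame x"
proof (rule tameI[OF F])
  have bis: "banach_ideal_space M F" using F by (simp add: symmetric_space_def)
  show xm: "x \<in> borel_measurable M" by (rule bis_meas[OF bis x])
  have "(\<lambda>t. x t * indicator P t) \<in> elems F \<and> fnorm F (\<lambda>t. x t * indicator P t) \<le> fnorm F x"
    if "P \<in> sets M" for P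
    using idealD[OF bis_ideal[OF bis] x, of "\<lambda>t. x t * indicator P t"] xm that
    by (auto simp: indicator_def)
  then show "\<exists>C. \<forall>P\<in>sets M. emeasure M P = ennreal \<rho> \<longrightarrow>
        (\<lambda>t. x t * indicator P t) \<in> elems F \<and> fnorm F (\<lambda>t. x t * indicator P t) \<le> C" for \<rho> by blast
qed

text \<open>On sets of measure \<open>\<rho>\<close> the restrictions of a multiplier are bounded in
  \<open>F\<close>: the indicators of these sets have one common norm in \<open>E\<close>, and
  multiplication by \<open>m\<close> is bounded.\<close>

lemma tame_multiplier:
  assumes E: "symmetric_space M E" and F: "symmetric_space M F"
    and m: "m \<in> elems (multiplier_space M E F)"
  shows "tame m"
proof (rule tameI[OF F])
  have di: "dominating_ideal M E" "dominating_ideal M F"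
    using E F by (auto simp: symmetric_space_def intro: bis_dominating)
  show "m \<in> borel_measurable M" using m by (simp add: multiplier_elems)
  fix e \<rho> :: real assume e: "0 < e" "e < 1" "e \<le> \<rho>" "attained e \<rho>"
  obtain a where a: "0 < a" "\<And>P. P \<in> sets M \<Longrightarrow> emeasure M P = ennreal \<rho> \<Longrightarrow>
      indicator P \<in> elems E \<and> fnorm E (indicator P) = a"
    by (rule indicator_norm[OF E e]) blast
  have "(\<lambda>t. m t * indicator P t) \<in> elems F \<and>
      fnorm F (\<lambda>t. m t * indicator P t) \<le> fnorm (multiplier_space M E F) m * a"
    if "P \<in> sets M" "emeasure M P = ennreal \<rho>" for P
    using m a(2)[OF that] multiplier_norm_bound[OF di space_pos m, of "indicator P"]
    by (auto simp: multiplier_elems)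
  then show "\<exists>C. \<forall>P\<in>sets M. emeasure M P = ennreal \<rho> \<longrightarrow>
        (\<lambda>t. m t * indicator P t) \<in> elems F \<and> fnorm F (\<lambda>t. m t * indicator P t) \<le> C" by blast
qed

end

section \<open>The Hardy operator\<close>

lemma term_le_suminf:
  fixes f :: "nat \<Rightarrow> ennreal"
  shows "f n \<le> (\<Sum>n. f n)"
proof -
  have "sum f {n} \<le> suminf f" by (rule sum_le_suminf) (auto intro: summableI)
  then show ?thesis by simp
qed

section \<open>Integrals over initial segments and decreasing weights\<close>

context ordered_measure
begin

text \<open>The Hardy average without the factor \<open>1 / r t\<close>. Values in
  \<open>ennreal\<close> allow comparisons before finiteness is known, and finiteness can then be
  deduced from them.\<close>

definition upto :: "('a \<Rightarrow> real) \<Rightarrow> 'a \<Rightarrow> ennreal" where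
  "upto g t = (\<integral>\<^sup>+ s. ennreal (g s) * indicator ({..t} \<inter> space M) s \<partial>M)"

text \<open>\<open>down_closed\<close>, applied to the whole space, supplies countably many
  thresholds below which almost every point lies, so only countably many null sets are
  united.\<close>

lemma AE_upto:
  assumes "\<And>t. t \<in> space M \<Longrightarrow> AE s in M. s \<le> t \<longrightarrow> P s"
  shows "AE s in M. P s"
proof -
  obtain T where T: "countable T" "T \<subseteq> space M" "AE s in M. s \<in> space M \<longrightarrow> (\<exists>t\<in>T. s \<le> t)"
    using down_closed[of "space M"] by auto
  have "AE s in M. \<forall>t\<in>T. s \<le> t \<longrightarrow> P s"
    using assms T(2) by (subst AE_ball_countable[OF T(1)]) blast
  with T(3) AE_space show ?thesis by eventually_elim auto
qed

lemma upto_mono_AE: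
  assumes "AE s in M. s \<le> t \<longrightarrow> g s \<le> h s"
  shows "upto g t \<le> upto h t"
  unfolding upto_def
  by (rule nn_integral_mono_AE) (use assms in \<open>auto elim!: eventually_mono simp: indicator_def intro: ennreal_leI\<close>)

lemma upto_cong_AE:
  assumes "AE s in M. s \<le> t \<longrightarrow> g s = h s"
  shows "upto g t = upto h t"
  by (intro antisym upto_mono_AE) (use assms in \<open>auto elim: eventually_mono\<close>)

lemma upto_incr:
  assumes "s \<in> space M" "t \<in> space M" "s \<le> t"
  shows "upto g s \<le> upto g t"
  unfolding upto_def by (intro nn_integral_mono mult_left_mono) (use assms in \<open>auto simp: indicator_def\<close>)

lemma upto_measurable:
  assumes [measurable]: "g \<in> borel_measurable M" and t: "t \<in> space M"
  shows "(\<lambda>s. ennreal (g s) * indicator ({..t} \<inter> space M) s) \<in> borel_measurable M"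
proof -
  have [measurable]: "{..t} \<inter> space M \<in> sets M" by (rule initial_sets[OF t])
  show ?thesis by measurable
qed

lemma upto_cmult:
  assumes g: "g \<in> borel_measurable M" and c: "0 \<le> c" and t: "t \<in> space M"
  shows "upto (\<lambda>s. c * g s) t = ennreal c * upto g t"
proof -
  have "upto (\<lambda>s. c * g s) t = (\<integral>\<^sup>+ s. ennreal c * (ennreal (g s) * indicator ({..t} \<inter> space M) s) \<partial>M)"
    unfolding upto_def using c by (simp add: ennreal_mult' mult.assoc)
  also have "\<dots> = ennreal c * upto g t"
    unfolding upto_def by (rule nn_integral_cmult[OF upto_measurable[OF g t]])
  finally show ?thesis .
qed

lemma upto_zero_AE:
  assumes [measurable]: "g \<in> borel_measurable M" and "t \<in> space M" "upto g t = 0"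
  shows "AE s in M. s \<le> t \<longrightarrow> g s \<le> 0"
proof -
  have "AE s in M. ennreal (g s) * indicator ({..t} \<inter> space M) s = 0"
    using assms nn_integral_0_iff_AE[OF upto_measurable[OF assms(1,2)]] unfolding upto_def by simp
  with AE_space show ?thesis
    by eventually_elim (auto simp: indicator_def ennreal_eq_0_iff split: if_splits)
qed

text \<open>Up to a null set, a down-closed set is a countable increasing union of initial segments,
  so the comparison passes to it by monotone convergence. If there are no segments, the set is null
  and the left side is zero.\<close>

lemma down_closed_integral_le:
  assumes D: "D \<subseteq> space M" "\<And>s t. t \<in> D \<Longrightarrow> s \<in> space M \<Longrightarrow> s \<le> t \<Longrightarrow> s \<in> D"
    and g[measurable]: "g \<in> borel_measurable M" and le: "\<And>t. t \<in> space M \<Longrightarrow> upto g t \<le> C * upto y t"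
  shows "(\<integral>\<^sup>+ s. ennreal (g s) * indicator D s \<partial>M) \<le> C * (\<integral>\<^sup>+ s. ennreal (y s) * indicator D s \<partial>M)"
proof -
  obtain T where T: "countable T" "T \<subseteq> D" "AE s in M. s \<in> D \<longrightarrow> (\<exists>t\<in>T. s \<le> t)"
    using down_closed[of D, OF D(1)] D(2) by metis
  show ?thesis
  proof (cases "T = {}")
    case True
    with T(3) have "AE s in M. ennreal (g s) * indicator D s = 0" by (auto elim: eventually_mono)
    then have "(\<integral>\<^sup>+ s. ennreal (g s) * indicator D s \<partial>M) = 0"
      by (subst nn_integral_cong_AE[of _ "\<lambda>_. 0"]) auto
    then show ?thesis by simp
  next
    case False
    define q where "q = from_nat_into T"
    \<comment> \<open>Running maxima turn the arbitrary enumeration of thresholds into an increasing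
      one.\<close>
    define Q where "Q n = Max (q ` {..n})" for n
    have q: "range q = T" unfolding q_def using False T(1) by (rule range_from_nat_into)
    have Q: "Q n \<in> D" "Q n \<in> space M" for n
    proof -
      have "Q n \<in> q ` {..n}" unfolding Q_def by (intro Max_in) auto
      then show "Q n \<in> D" "Q n \<in> space M" using q T(2) D(1) by auto
    qed
    have Qm: "Q n \<le> Q m" if "n \<le> m" for n m unfolding Q_def using that by (intro Max_mono) auto
    have qQ: "q n \<le> Q n" for n unfolding Q_def by (intro Max_ge) auto
    let ?f = "\<lambda>n s. ennreal (g s) * indicator ({..Q n} \<inter> space M) s"
    have "(\<integral>\<^sup>+ s. ennreal (g s) * indicator D s \<partial>M) = (\<integral>\<^sup>+ s. (SUP n. ?f n s) \<partial>M)"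
    proof (rule nn_integral_cong_AE)
      show "AE s in M. ennreal (g s) * indicator D s = (SUP n. ?f n s)"
        using T(3) AE_space
      proof eventually_elim
        case (elim s)
        show ?case
        proof (cases "s \<in> D")
          case True
          then obtain n where "s \<le> q n" using elim q by auto
          then have "s \<le> Q n" using qQ order_trans by blast
          then have "ennreal (g s) \<le> (SUP n. ?f n s)" using elim by (intro SUP_upper2[of n]) auto
          moreover have "(SUP n. ?f n s) \<le> ennreal (g s)" by (rule SUP_least) (auto simp: indicator_def)
          ultimately show ?thesis using True by simp
        next
          case False
          then have "\<not> s \<le> Q n" for n using D(2)[OF Q(1)] elim by blast
          then show ?thesis using False by simp
        qed
      qed
    qed
    also have "\<dots> = (SUP n. (\<integral>\<^sup>+ s. ?f n s \<partial>M))"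
    proof (rule nn_integral_monotone_convergence_SUP)
      show "incseq ?f"
      proof (intro monoI le_funI mult_left_mono)
        fix n m :: nat and s assume "n \<le> m"
        from order_trans[OF _ Qm[OF this], of s]
        show "indicator ({..Q n} \<inter> space M) s \<le> (indicator ({..Q m} \<inter> space M) s :: ennreal)"
          by (auto simp: indicator_def)
      qed simp
      show "?f n \<in> borel_measurable M" for n by (rule upto_measurable[OF g Q(2)])
    qed
    also have "\<dots> \<le> C * (\<integral>\<^sup>+ s. ennreal (y s) * indicator D s \<partial>M)"
    proof (rule SUP_least)
      fix n
      have "(\<integral>\<^sup>+ s. ?f n s \<partial>M) \<le> C * upto y (Q n)" using le[OF Q(2)] by (simp add: upto_def)
      also have "\<dots> \<le> C * (\<integral>\<^sup>+ s. ennreal (y s) * indicator D s \<partial>M)"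
        unfolding upto_def
        by (intro mult_left_mono nn_integral_mono) (use D(2)[OF Q(1)] in \<open>auto simp: indicator_def\<close>)
      finally show "(\<integral>\<^sup>+ s. ?f n s \<partial>M) \<le> C * (\<integral>\<^sup>+ s. ennreal (y s) * indicator D s \<partial>M)" .
    qed
    finally show ?thesis .
  qed
qed

text \<open>Hardy's lemma, through the layer cake decomposition of the decreasing weight.\<close>

lemma upto_antimono_weight:
  assumes g[measurable]: "g \<in> borel_measurable M" and y[measurable]: "y \<in> borel_measurable M"
    and d: "antimono_on (space M) d" "\<And>s. s \<in> space M \<Longrightarrow> 0 \<le> d s"
    and le: "\<And>t. t \<in> space M \<Longrightarrow> upto g t \<le> C * upto y t" and t: "t \<in> space M"
  shows "upto (\<lambda>s. d s * g s) t \<le> C * upto (\<lambda>s. d s * y s) t"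
proof -
  interpret M: sigma_finite_measure M by (rule sigma_finite)
  interpret pair_sigma_finite M lborel ..
  have [measurable]: "d \<in> borel_measurable M" by (rule antimono_on_measurable[OF d(1)])
  have [measurable]: "{..t} \<inter> space M \<in> sets M" by (rule initial_sets[OF t])
  \<comment> \<open>The layers of the weight, cut off at \<open>t\<close>. They are down-closed
    because \<open>d\<close> is decreasing, so the comparison of initial segments applies to
    each.\<close>
  define D where "D l = {s \<in> space M. s \<le> t \<and> 0 \<le> l \<and> l < d s}" for l
  have layer: "upto (\<lambda>s. d s * h s) t = (\<integral>\<^sup>+ l. (\<integral>\<^sup>+ s. ennreal (h s) * indicator (D l) s \<partial>M) \<partial>lborel)"
    if [measurable]: "h \<in> borel_measurable M" for h :: "'a \<Rightarrow> real"
  proof -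
    let ?k = "\<lambda>s l. ennreal (h s) * indicator ({..t} \<inter> space M) s * (if 0 \<le> l \<and> l < d s then 1 else 0)"
    have "upto (\<lambda>s. d s * h s) t = (\<integral>\<^sup>+ s. (\<integral>\<^sup>+ l. ?k s l \<partial>lborel) \<partial>M)"
      unfolding upto_def
    proof (rule nn_integral_cong)
      fix s assume s: "s \<in> space M"
      have "(\<integral>\<^sup>+ l. ?k s l \<partial>lborel) = ennreal (h s) * indicator ({..t} \<inter> space M) s *
          (\<integral>\<^sup>+ l. (if 0 \<le> l \<and> l < d s then 1 else 0) \<partial>lborel)"
        by (rule nn_integral_cmult) measurable
      also have "(\<integral>\<^sup>+ l. (if 0 \<le> l \<and> l < d s then 1 else 0) \<partial>lborel) = (\<integral>\<^sup>+ l. indicator {0..<d s} l \<partial>lborel)"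
        by (intro nn_integral_cong) (auto simp: indicator_def)
      also have "\<dots> = ennreal (d s)" using d(2)[OF s] by simp
      finally show "ennreal (d s * h s) * indicator ({..t} \<inter> space M) s = (\<integral>\<^sup>+ l. ?k s l \<partial>lborel)"
        using d(2)[OF s] by (simp add: ennreal_mult' mult_ac)
    qed
    also have "\<dots> = (\<integral>\<^sup>+ l. (\<integral>\<^sup>+ s. ?k s l \<partial>M) \<partial>lborel)"
      by (rule Fubini'[symmetric]) measurable
    also have "\<dots> = (\<integral>\<^sup>+ l. (\<integral>\<^sup>+ s. ennreal (h s) * indicator (D l) s \<partial>M) \<partial>lborel)"
      by (intro nn_integral_cong) (auto simp: D_def indicator_def)
    finally show ?thesis .
  qed
  \<comment> \<open>Written with an explicit condition on \<open>s\<close> and \<open>l\<close>, the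
    integrand is jointly measurable; this gives measurability in \<open>l\<close> after integrating
    out \<open>s\<close>.\<close>
  have Dm: "(\<lambda>l. \<integral>\<^sup>+ s. ennreal (y s) * indicator (D l) s \<partial>M) \<in> borel_measurable lborel"
  proof -
    have "(\<lambda>l. \<integral>\<^sup>+ s. ennreal (y s) * indicator ({..t} \<inter> space M) s * (if 0 \<le> l \<and> l < d s then 1 else 0) \<partial>M)
        \<in> borel_measurable lborel"
      by measurable
    also have "(\<lambda>l. \<integral>\<^sup>+ s. ennreal (y s) * indicator ({..t} \<inter> space M) s * (if 0 \<le> l \<and> l < d s then 1 else 0) \<partial>M)
        = (\<lambda>l. \<integral>\<^sup>+ s. ennreal (y s) * indicator (D l) s \<partial>M)"
      by (intro ext nn_integral_cong) (auto simp: D_def indicator_def)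
    finally show ?thesis .
  qed
  have "upto (\<lambda>s. d s * g s) t \<le> (\<integral>\<^sup>+ l. C * (\<integral>\<^sup>+ s. ennreal (y s) * indicator (D l) s \<partial>M) \<partial>lborel)"
    unfolding layer[OF g]
  proof (rule nn_integral_mono)
    fix l
    show "(\<integral>\<^sup>+ s. ennreal (g s) * indicator (D l) s \<partial>M) \<le> C * (\<integral>\<^sup>+ s. ennreal (y s) * indicator (D l) s \<partial>M)"
    proof (rule down_closed_integral_le[OF _ _ g le])
      show "D l \<subseteq> space M" by (auto simp: D_def)
      fix s t' assume "t' \<in> D l" "s \<in> space M" "s \<le> t'"
      then show "s \<in> D l"
        using monotone_onD[OF d(1), of s t'] by (auto simp: D_def)
    qed
  qed
  also have "\<dots> = C * upto (\<lambda>s. d s * y s) t"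
    unfolding layer[OF y] by (rule nn_integral_cmult[OF Dm])
  finally show ?thesis .
qed

end

text \<open>The Hardy operator is described on nonnegative functions only, through
  \<open>upto\<close>. The predicate \<open>hd\<close> expresses that it is finite there:
  integrability up to each point on the half line, no condition for sequences.
  \<open>maj_le\<close>, \<open>maj_ge\<close> and \<open>maj_antimono\<close> characterise the
  least decreasing majorant, with infinity as a possible value.\<close>

locale hardy_setting = ordered_measure M r K tk
  for M :: "'a::linorder measure" and r K tk +
  fixes hd :: "('a \<Rightarrow> real) \<Rightarrow> bool" and H :: "('a \<Rightarrow> real) \<Rightarrow> 'a \<Rightarrow> real"
    and maj :: "('a \<Rightarrow> real) \<Rightarrow> 'a \<Rightarrow> ereal"
  assumes hd_iff: "g \<in> borel_measurable M \<Longrightarrow> (\<And>s. s \<in> space M \<Longrightarrow> 0 \<le> g s) \<Longrightarrow>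
      hd g \<longleftrightarrow> (\<forall>t\<in>space M. upto g t < \<infinity>)"
    and H_eq: "g \<in> borel_measurable M \<Longrightarrow> (\<And>s. s \<in> space M \<Longrightarrow> 0 \<le> g s) \<Longrightarrow>
      hd g \<Longrightarrow> t \<in> space M \<Longrightarrow> H g t = enn2real (upto g t) / r t"
    and maj_le: "f \<in> borel_measurable M \<Longrightarrow> antimono_on (space M) b \<Longrightarrow>
      AE s in M. \<bar>f s\<bar> \<le> b s \<Longrightarrow> t \<in> space M \<Longrightarrow> maj f t \<le> ereal (b t)"
    and maj_ge: "f \<in> borel_measurable M \<Longrightarrow> AE s in M. ereal \<bar>f s\<bar> \<le> maj f s"
    and maj_antimono: "f \<in> borel_measurable M \<Longrightarrow> antimono_on (space M) (maj f)"
    and maj_nonneg: "f \<in> borel_measurable M \<Longrightarrow> t \<in> space M \<Longrightarrow> 0 \<le> maj f t"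
begin

definition hardy_bounded :: "'a fn_space \<Rightarrow> real \<Rightarrow> bool" where
  "hardy_bounded E C \<longleftrightarrow>
     (\<forall>x\<in>elems E. hd x \<and> H x \<in> elems E \<and> fnorm E (H x) \<le> C * fnorm E x)"

definition cesaro :: "'a fn_space \<Rightarrow> 'a fn_space" where
  "cesaro E = \<lparr> elems = {f \<in> borel_measurable M. hd (\<lambda>s. \<bar>f s\<bar>) \<and> H (\<lambda>s. \<bar>f s\<bar>) \<in> elems E},
                fnorm = (\<lambda>f. fnorm E (H (\<lambda>s. \<bar>f s\<bar>))) \<rparr>"

definition tandori :: "'a fn_space \<Rightarrow> 'a fn_space" where
  "tandori E = \<lparr> elems = {f \<in> borel_measurable M. (\<forall>t\<in>space M. maj f t < \<infinity>) \<and>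
                     (\<lambda>t. real_of_ereal (maj f t)) \<in> elems E},
                 fnorm = (\<lambda>f. fnorm E (\<lambda>t. real_of_ereal (maj f t))) \<rparr>"

context
  fixes g :: "'a \<Rightarrow> real"
  assumes g: "g \<in> borel_measurable M" "\<And>s. s \<in> space M \<Longrightarrow> 0 \<le> g s" "hd g"
begin

lemma upto_eq: "t \<in> space M \<Longrightarrow> upto g t = ennreal (H g t * r t)"
  using H_eq[OF g(1,2,3)] hd_iff[OF g(1,2)] g(3) r_pos[of t] by simp

lemma H_nonneg: "t \<in> space M \<Longrightarrow> 0 \<le> H g t"
  using H_eq[OF g(1,2,3)] r_pos[of t] by simp

lemma H_measurable: "H g \<in> borel_measurable M"
proof -
  have "mono_on (space M) (\<lambda>t. enn2real (upto g t))"
    using upto_incr hd_iff[OF g(1,2)] g(3) by (intro monotone_onI enn2real_mono) auto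
  then have "(\<lambda>t. enn2real (upto g t)) \<in> borel_measurable M" by (rule mono_on_measurable)
  moreover have "r \<in> borel_measurable M"
    by (rule mono_on_measurable) (auto intro!: monotone_onI initial_mono)
  ultimately have "(\<lambda>t. enn2real (upto g t) / r t) \<in> borel_measurable M" by measurable
  then show ?thesis using H_eq[OF g] by (simp cong: measurable_cong)
qed

lemma H_compare:
  assumes f: "f \<in> borel_measurable M" "\<And>s. s \<in> space M \<Longrightarrow> 0 \<le> f s" and C: "0 \<le> C"
    and le: "\<And>t. t \<in> space M \<Longrightarrow> upto f t \<le> ennreal C * upto g t"
  shows "hd f" "\<And>t. t \<in> space M \<Longrightarrow> H f t \<le> C * H g t"
proof -
  have fin: "upto g t < \<infinity>" if "t \<in> space M" for t using that hd_iff[OF g(1,2)] g(3) by blast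
  have "upto f t < \<infinity>" if "t \<in> space M" for t
  proof -
    have "ennreal C * upto g t < \<infinity>" using fin[OF that] by (simp add: ennreal_mult_less_top)
    with le[OF that] show ?thesis by (rule le_less_trans)
  qed
  with hd_iff[OF f] show hd: "hd f" by blast
  fix t assume t: "t \<in> space M"
  have "enn2real (upto f t) \<le> enn2real (ennreal C * upto g t)"
    using fin[OF t] by (intro enn2real_mono le t) (simp add: ennreal_mult_less_top)
  also have "\<dots> = C * enn2real (upto g t)" using C by (simp add: enn2real_mult)
  finally show "H f t \<le> C * H g t"
    using r_pos[OF t] by (simp add: H_eq[OF g t] H_eq[OF f hd t] divide_right_mono)
qed

text \<open>The integral \<open>H g t * r t\<close> increases with \<open>t\<close>. Hence
  \<open>H g\<close> loses at most a factor 2 from \<open>t\<close> to any later point with at most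
  twice the scale, and by \<open>double\<close> these points have measure at least
  \<open>r t\<close>.\<close>

lemma H_le_rearr:
  assumes tm: "tame (H g)" and t: "t \<in> space M"
  shows "H g t \<le> 2 * rearr 1 (H g) t"
proof -
  have "H g t / 2 \<le> rearr 1 (H g) t"
  proof (rule dense_le)
    fix l assume l: "l < H g t / 2"
    show "l \<le> rearr 1 (H g) t"
    proof (rule rearr_ge[OF H_measurable tm _ t])
      have "{s \<in> space M. t \<le> s \<and> r s \<le> 2 * r t} \<subseteq> {s \<in> space M. l < \<bar>H g s\<bar>}"
      proof safe
        fix s assume s: "s \<in> space M" "t \<le> s" "r s \<le> 2 * r t"
        have "ennreal (H g t * r t) \<le> ennreal (H g s * r s)"
          using upto_incr[OF t s(1,2), of g] by (simp add: upto_eq t s)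
        then have "H g t * r t \<le> H g s * r s"
          using H_nonneg[OF s(1)] r_pos[OF s(1)] by (simp add: ennreal_le_iff)
        also have "\<dots> \<le> H g s * (2 * r t)" using s H_nonneg by (intro mult_left_mono) auto
        finally have "H g t \<le> 2 * H g s" using r_pos[OF t] by simp
        with l show "l < \<bar>H g s\<bar>" by simp
      qed
      then have "emeasure M {s \<in> space M. t \<le> s \<and> r s \<le> 2 * r t} \<le> dfun (H g) l"
        unfolding dfun_def by (intro emeasure_mono dfun_sets H_measurable)
      with double[OF t] show "ennreal (1 * r t) \<le> dfun (H g) l" by simp
    qed simp
  qed
  then show ?thesis by simp
qed

end

text \<open>If the dilated rearrangement exceeds \<open>l\<close> at \<open>t\<close>, then the
  ordinary one exceeds \<open>l\<close> on at least the fraction \<open>c\<close> of the initial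
  segment up to \<open>t\<close>, so its average there is at least \<open>c * l\<close>. This
  converts Hardy bounds into bounds for dilations.\<close>

lemma rearr_le_H:
  assumes x: "x \<in> borel_measurable M" "tame x" and c: "0 < c" "c \<le> 1" and t: "t \<in> space M"
    and hd: "hd (rearr 1 x)"
  shows "rearr c x t \<le> (1 / c) * H (rearr 1 x) t"
proof (rule dense_le)
  let ?x = "rearr 1 x"
  have xm: "?x \<in> borel_measurable M" by (intro rearr_measurable x) simp
  have x0: "0 \<le> ?x s" if "s \<in> space M" for s using that by (intro rearr_nonneg x) auto
  fix l assume l: "l < rearr c x t"
  show "l \<le> (1 / c) * H ?x t"
  proof (cases "0 \<le> l")
    case False
    then show ?thesis using H_nonneg[OF xm x0 hd t] c by (smt (verit) divide_nonneg_pos mult_nonneg_nonneg)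
  next
    case True
    let ?D = "{s \<in> space M. l < \<bar>?x s\<bar>}"
    let ?W = "({..t} \<inter> space M) \<inter> ?D"
    have Wm: "?W \<in> sets M" by (intro sets.Int initial_sets t dfun_sets xm)
    \<comment> \<open>Either \<open>t\<close> lies in the level set, which then contains the whole
      segment, or the level set lies entirely below \<open>t\<close> and nothing is lost by
      intersecting.\<close>
    have c1: "ennreal (c * r t) \<le> emeasure M ?W"
    proof (cases "t \<in> ?D")
      case tD: True
      have "?W = {..t} \<inter> space M"
      proof (intro equalityI subsetI IntI)
        fix s assume s: "s \<in> {..t} \<inter> space M"
        then have "?x t \<le> ?x s"
          using rearr_antimono[OF x, of 1] t by (auto dest: monotone_onD)
        with s tD x0 t show "s \<in> ?D" by auto
      qed auto
      then show ?thesis using initial[OF t] r_pos[OF t] c by (auto intro!: ennreal_leI mult_left_le_one_le)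
    next
      case False
      have "?W = ?D"
      proof (intro equalityI subsetI IntI)
        fix s assume s: "s \<in> ?D"
        then have ss: "s \<in> space M" by simp
        have "s \<le> t"
        proof (rule ccontr)
          assume "\<not> s \<le> t"
          then have "?x s \<le> ?x t"
            using rearr_antimono[OF x, of 1] t ss by (auto dest: monotone_onD)
          with s False x0 ss t show False by auto
        qed
        with ss show "s \<in> {..t}" "s \<in> space M" by auto
      qed auto
      then have "emeasure M ?W = dfun x l"
        using rearr_equimeasurable[OF x] True by (simp add: equimeasurable_dfun dfun_def[of "rearr 1 x"])
      with rearr_gtD[OF True l] show ?thesis by simp
    qed
    have "ennreal (l * (c * r t)) = ennreal l * ennreal (c * r t)" by (rule ennreal_mult'[OF True])
    also have "\<dots> \<le> ennreal l * emeasure M ?W" by (rule mult_left_mono[OF c1]) simp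
    also have "\<dots> = (\<integral>\<^sup>+ s. ennreal l * indicator ?W s \<partial>M)" by (rule nn_integral_cmult_indicator[symmetric, OF Wm])
    also have "\<dots> \<le> upto ?x t"
      unfolding upto_def by (intro nn_integral_mono) (use x0 in \<open>auto simp: indicator_def intro!: ennreal_leI\<close>)
    also have "\<dots> = ennreal (H ?x t * r t)" by (rule upto_eq[OF xm x0 hd t])
    finally have "l * (c * r t) \<le> H ?x t * r t"
      using H_nonneg[OF xm x0 hd t] r_pos[OF t] by (simp add: ennreal_le_iff)
    then have "l * c \<le> H ?x t" using r_pos[OF t] by (simp add: mult.assoc[symmetric])
    then show ?thesis using c by (simp add: field_simps)
  qed
qed

lemma rearr_in_space:
  assumes E: "symmetric_space M E" and x: "x \<in> elems E"
  shows "rearr 1 x \<in> elems E" "fnorm E (rearr 1 x) = fnorm E x"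
proof -
  have "x \<in> borel_measurable M" "tame x"
    using E x by (auto simp: symmetric_space_def intro: bis_meas tame_elems)
  from rearr_equimeasurable[OF this] rearr_measurable[OF this, of 1]
  show "rearr 1 x \<in> elems E" "fnorm E (rearr 1 x) = fnorm E x"
    using E x by (auto simp: symmetric_space_def)
qed

section \<open>Dilations and distribution estimates in symmetric spaces\<close>

context
  fixes E :: "'a fn_space" and C :: real
  assumes E: "symmetric_space M E" and C: "hardy_bounded E C"
begin

private lemma bis: "banach_ideal_space M E"
  using E by (simp add: symmetric_space_def)

text \<open>By \<open>rearr_le_H\<close> the dilation is dominated by a multiple of the Hardy
  average of the rearrangement, whose norm is that of \<open>x\<close>; hence the constant
  \<open>C / c\<close>.\<close>

lemma dilated_rearr_in_space:
  assumes x: "x \<in> elems E" and c: "0 < c" "c \<le> 1"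
  shows "rearr c x \<in> elems E" "fnorm E (rearr c x) \<le> (C / c) * fnorm E x"
proof -
  have xm: "x \<in> borel_measurable M" "tame x"
    using bis_meas[OF bis x] tame_elems[OF E x] by auto
  note x1 = rearr_in_space[OF E x]
  have Hx: "hd (rearr 1 x)" "H (rearr 1 x) \<in> elems E"
    "fnorm E (H (rearr 1 x)) \<le> C * fnorm E (rearr 1 x)"
    using C x1 by (auto simp: hardy_bounded_def)
  have Hc: "(\<lambda>t. (1 / c) * H (rearr 1 x) t) \<in> elems E" by (rule bis_scale[OF bis Hx(2)])
  have "AE t in M. \<bar>rearr c x t\<bar> \<le> \<bar>(1 / c) * H (rearr 1 x) t\<bar>"
  proof (rule AE_I2)
    fix t assume t: "t \<in> space M"
    show "\<bar>rearr c x t\<bar> \<le> \<bar>(1 / c) * H (rearr 1 x) t\<bar>"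
      using rearr_le_H[OF xm c t Hx(1)] rearr_nonneg[OF xm c(1) t] by linarith
  qed
  note * = idealD[OF bis_ideal[OF bis] Hc rearr_measurable[OF xm c(1)] this]
  show "rearr c x \<in> elems E" by (rule *)
  have "fnorm E (rearr c x) \<le> (1 / c) * fnorm E (H (rearr 1 x))"
    using *(2) bis_norm_scale[OF bis Hx(2), of "1 / c"] c by simp
  also have "\<dots> \<le> (1 / c) * (C * fnorm E (rearr 1 x))" using c by (intro mult_left_mono Hx) auto
  finally show "fnorm E (rearr c x) \<le> (C / c) * fnorm E x" by (simp add: x1)
qed

lemma rearr_dominated_in_space:
  assumes y: "y \<in> borel_measurable M" "tame y" and x: "x \<in> elems E"
    and le: "\<And>t. t \<in> space M \<Longrightarrow> rearr 1 y t \<le> x t"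
  shows "y \<in> elems E" "fnorm E y \<le> fnorm E x"
proof -
  have "AE t in M. \<bar>rearr 1 y t\<bar> \<le> \<bar>x t\<bar>"
  proof (rule AE_I2)
    fix t assume t: "t \<in> space M"
    show "\<bar>rearr 1 y t\<bar> \<le> \<bar>x t\<bar>" using le[OF t] rearr_nonneg[OF y _ t, of 1] by linarith
  qed
  note * = idealD[OF bis_ideal[OF bis] x rearr_measurable[OF y, of 1] this]
  have "equimeasurable M (rearr 1 y) y"
    using rearr_equimeasurable[OF y] by (simp add: equimeasurable_dfun)
  then have "y \<in> elems E \<and> fnorm E y = fnorm E (rearr 1 y)"
    using E *(1)[OF zero_less_one] y(1) unfolding symmetric_space_def by blast
  with *(2)[OF zero_less_one] show "y \<in> elems E" "fnorm E y \<le> fnorm E x" by auto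
qed

text \<open>Level sets larger by a factor \<open>N\<close> amount to a dilation by
  \<open>1 / N\<close> of the rearrangement. In this form, estimates of the measures of level sets
  become norm estimates.\<close>

lemma dfun_dominated_in_space:
  assumes y: "y \<in> borel_measurable M" and x: "x \<in> elems E" and N: "1 \<le> N"
    and le: "\<And>l. 0 \<le> l \<Longrightarrow> dfun y l \<le> ennreal N * dfun x l"
  shows "y \<in> elems E" "fnorm E y \<le> (C * N) * fnorm E x"
proof -
  have xm: "x \<in> borel_measurable M" "tame x"
    using bis_meas[OF bis x] tame_elems[OF E x] by auto
  have strict: "dfun y l < ennreal e" if "0 \<le> l" "dfun x l < ennreal (1 / N * e)" "0 < e" for l e
  proof -
    have "ennreal N * dfun x l < ennreal N * ennreal (1 / N * e)"
      using N that by (intro ennreal_mult_strict_left_mono) auto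
    also have "\<dots> = ennreal e" using N by (subst ennreal_mult'[symmetric]) auto
    finally show ?thesis using le[OF that(1)] by simp
  qed
  have ty: "tame y"
    unfolding tame_def
  proof (intro allI impI)
    fix e :: real assume "0 < e"
    then have "0 < 1 / N * e" using N by simp
    then obtain l where "0 \<le> l" "dfun x l < ennreal (1 / N * e)" using xm(2) unfolding tame_def by blast
    with strict \<open>0 < e\<close> show "\<exists>l\<ge>0. dfun y l < ennreal e" by blast
  qed
  have cmp: "rearr 1 y t \<le> rearr (1 / N) x t" if t: "t \<in> space M" for t
    unfolding rearr_def[of "1 / N"]
  proof (rule cInf_greatest)
    show "{l. 0 \<le> l \<and> dfun x l < ennreal (1 / N * r t)} \<noteq> {}"
      by (rule rearr_nonempty[OF xm _ t]) (use N in auto)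
    fix l assume "l \<in> {l. 0 \<le> l \<and> dfun x l < ennreal (1 / N * r t)}"
    then show "rearr 1 y t \<le> l" using strict[of l "r t"] r_pos[OF t] by (intro rearr_le) auto
  qed
  have N': "0 < 1 / N" "1 / N \<le> 1" using N by auto
  note R = dilated_rearr_in_space[OF x N']
  from rearr_dominated_in_space[OF y ty R(1) cmp] R(2)
  show "y \<in> elems E" "fnorm E y \<le> (C * N) * fnorm E x" by auto
qed

end

text \<open>The substantial clause is domination. If \<open>v\<close> in \<open>E\<close> dominates
  the partial sums of \<open>(1/2) ^ n * H |x n|\<close>, then the series of
  \<open>(1/2) ^ n * |x n|\<close> has Hardy average at most \<open>v\<close> after interchanging
  sum and integral; so it is finite almost everywhere and belongs to the Cesaro space.\<close>

lemma cesaro_dominating: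
  assumes bis: "banach_ideal_space M E" and C: "hardy_bounded E C"
  shows "dominating_ideal M (cesaro E)"
proof -
  note di = bis_dominating[OF bis]
  have el: "f \<in> elems (cesaro E) \<longleftrightarrow>
      f \<in> borel_measurable M \<and> hd (\<lambda>s. \<bar>f s\<bar>) \<and> H (\<lambda>s. \<bar>f s\<bar>) \<in> elems E" for f
    by (simp add: cesaro_def)
  have nm: "fnorm (cesaro E) f = fnorm E (H (\<lambda>s. \<bar>f s\<bar>))" for f by (simp add: cesaro_def)
  \<comment> \<open>With \<open>c = 1\<close> this is the ideal property; applied to a scalar and to
    its inverse it gives the two halves of homogeneity.\<close>
  have ideal: "x \<in> elems (cesaro E) \<and> fnorm (cesaro E) x \<le> c * fnorm (cesaro E) y"
    if y: "y \<in> elems (cesaro E)" and x: "x \<in> borel_measurable M"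
      and le: "AE t in M. \<bar>x t\<bar> \<le> c * \<bar>y t\<bar>" and c: "0 \<le> c" for x y c
  proof -
    have ym: "(\<lambda>s. \<bar>y s\<bar>) \<in> borel_measurable M" "hd (\<lambda>s. \<bar>y s\<bar>)" "H (\<lambda>s. \<bar>y s\<bar>) \<in> elems E"
      using y by (auto simp: el)
    have xm: "(\<lambda>s. \<bar>x s\<bar>) \<in> borel_measurable M" using x by simp
    have up: "upto (\<lambda>s. \<bar>x s\<bar>) t \<le> ennreal c * upto (\<lambda>s. \<bar>y s\<bar>) t" if "t \<in> space M" for t
      unfolding upto_cmult[OF ym(1) c that, symmetric]
      by (rule upto_mono_AE) (use le in \<open>auto elim: eventually_mono\<close>)
    note cmp = H_compare[OF ym(1) _ ym(2) xm _ c up, simplified]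
    have Hc: "(\<lambda>t. c * H (\<lambda>s. \<bar>y s\<bar>) t) \<in> elems E" by (rule bis_scale[OF bis ym(3)])
    have "AE t in M. \<bar>H (\<lambda>s. \<bar>x s\<bar>) t\<bar> \<le> \<bar>c * H (\<lambda>s. \<bar>y s\<bar>) t\<bar>"
    proof (rule AE_I2)
      fix t assume t: "t \<in> space M"
      show "\<bar>H (\<lambda>s. \<bar>x s\<bar>) t\<bar> \<le> \<bar>c * H (\<lambda>s. \<bar>y s\<bar>) t\<bar>"
        using cmp(2)[OF t] H_nonneg[OF xm _ cmp(1) t] by auto
    qed
    from idealD[OF bis_ideal[OF bis] Hc H_measurable[OF xm _ cmp(1)] this]
    show ?thesis using x cmp(1) bis_norm_scale[OF bis ym(3), of c] c by (auto simp: el nm)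
  qed
  have ip: "ideal_property M (cesaro E)"
    unfolding ideal_property_def
  proof (intro ballI impI)
    fix y x assume "y \<in> elems (cesaro E)" "x \<in> borel_measurable M" "AE t in M. \<bar>x t\<bar> \<le> \<bar>y t\<bar>"
    from ideal[OF this(1,2), of 1] this(3)
    show "x \<in> elems (cesaro E) \<and> fnorm (cesaro E) x \<le> fnorm (cesaro E) y" by simp
  qed
  have sc: "(\<lambda>t. c * x t) \<in> elems (cesaro E) \<and> fnorm (cesaro E) (\<lambda>t. c * x t) = \<bar>c\<bar> * fnorm (cesaro E) x"
    if x: "x \<in> elems (cesaro E)" for c x
  proof -
    have xm: "x \<in> borel_measurable M" using x by (simp add: el)
    have a: "(\<lambda>t. c * x t) \<in> elems (cesaro E) \<and> fnorm (cesaro E) (\<lambda>t. c * x t) \<le> \<bar>c\<bar> * fnorm (cesaro E) x" for c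
      by (rule ideal[OF x]) (use xm in \<open>auto simp: abs_mult\<close>)
    show ?thesis
    proof (cases "c = 0")
      case True
      have "0 \<le> fnorm (cesaro E) (\<lambda>t. c * x t)"
        using a[of c] di_nonneg[OF di] by (auto simp: el nm)
      with a[of c] True show ?thesis by auto
    next
      case False
      have "fnorm (cesaro E) x \<le> \<bar>1 / c\<bar> * fnorm (cesaro E) (\<lambda>t. c * x t)"
        using ideal[OF conjunct1[OF a[of c]] xm, of "\<bar>1 / c\<bar>"] False by (simp add: abs_mult)
      then have "\<bar>c\<bar> * fnorm (cesaro E) x \<le> fnorm (cesaro E) (\<lambda>t. c * x t)"
        using False by (simp add: field_simps)
      with a[of c] show ?thesis by auto
    qed
  qed
  have zero: "fnorm (cesaro E) x = 0 \<longleftrightarrow> (AE t in M. x t = 0)" if x: "x \<in> elems (cesaro E)" for x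
  proof
    have xm: "(\<lambda>s. \<bar>x s\<bar>) \<in> borel_measurable M" "hd (\<lambda>s. \<bar>x s\<bar>)" "H (\<lambda>s. \<bar>x s\<bar>) \<in> elems E"
      using x by (auto simp: el)
    {
      assume "fnorm (cesaro E) x = 0"
      then have H0: "AE t in M. H (\<lambda>s. \<bar>x s\<bar>) t = 0" using di_zero_iff[OF di xm(3)] by (simp add: nm)
      \<comment> \<open>Beyond each \<open>t\<close> there is a point where the average vanishes,
        and there the integral of \<open>|x|\<close> over everything below is zero.\<close>
      have "AE s in M. \<bar>x s\<bar> \<le> 0"
      proof (rule AE_upto)
        fix t assume t: "t \<in> space M"
        obtain t' where t': "t' \<in> space M" "t \<le> t'" "H (\<lambda>s. \<bar>x s\<bar>) t' = 0" by (rule AE_above[OF H0 t])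
        have "upto (\<lambda>s. \<bar>x s\<bar>) t' = 0" using upto_eq[OF xm(1) _ xm(2) t'(1)] t'(3) by simp
        from upto_zero_AE[OF xm(1) t'(1) this] t'(2)
        show "AE s in M. s \<le> t \<longrightarrow> \<bar>x s\<bar> \<le> 0" by (auto elim!: eventually_mono)
      qed
      then show "AE t in M. x t = 0" by simp
    next
      assume "AE t in M. x t = 0"
      then have "upto (\<lambda>s. \<bar>x s\<bar>) t = 0" if "t \<in> space M" for t
        by (subst upto_cong_AE[of t _ "\<lambda>_. 0"]) (auto simp: upto_def elim: eventually_mono)
      then have "AE t in M. H (\<lambda>s. \<bar>x s\<bar>) t = 0" using H_eq[OF xm(1) _ xm(2)] by (intro AE_I2) auto
      then show "fnorm (cesaro E) x = 0" using di_zero_iff[OF di xm(3)] by (simp add: nm)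
    }
  qed
  have dom: "\<exists>u\<in>elems (cesaro E). \<forall>n. AE t in M. \<bar>x n t\<bar> \<le> 2 ^ n * u t"
    if x: "\<forall>n::nat. x n \<in> elems (cesaro E) \<and> fnorm (cesaro E) (x n) \<le> 1" for x
  proof -
    have xm[measurable]: "x n \<in> borel_measurable M" for n using x by (auto simp: el)
    have ax: "(\<lambda>s. \<bar>x n s\<bar>) \<in> borel_measurable M" "hd (\<lambda>s. \<bar>x n s\<bar>)" "H (\<lambda>s. \<bar>x n s\<bar>) \<in> elems E"
      "fnorm E (H (\<lambda>s. \<bar>x n s\<bar>)) \<le> 1" for n
      using x by (auto simp: el nm)
    define h where "h n t = (1/2) ^ n * \<bar>H (\<lambda>s. \<bar>x n s\<bar>) t\<bar>" for n t
    have h: "h n \<in> elems E" "fnorm E (h n) \<le> (1/2) ^ n" for n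
      using bis_scale[OF bis di_abs(1)[OF di ax(3)]] di_abs[OF di ax(3)[of n]]
        bis_norm_scale[OF bis di_abs(1)[OF di ax(3)[of n]], of "(1/2) ^ n"] ax(4)[of n]
      unfolding h_def by (auto simp: mult_left_le)
    obtain v where v: "v \<in> elems E" "\<And>n. AE t in M. (\<Sum>i<n. h i t) \<le> v t"
      by (rule bis_series_dominated[OF bis, of h]) (use h in \<open>auto simp: h_def\<close>)
    \<comment> \<open>Formed in \<open>ennreal\<close>, because convergence of the series is only
      established through the bound for its integrals.\<close>
    define G where "G s = (\<Sum>n. ennreal ((1/2) ^ n * \<bar>x n s\<bar>))" for s
    have [measurable]: "G \<in> borel_measurable M" unfolding G_def by measurable
    let ?J = "\<lambda>t. \<integral>\<^sup>+ s. G s * indicator ({..t} \<inter> space M) s \<partial>M"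
    have J: "AE t in M. ?J t \<le> ennreal (r t * v t)"
    proof -
      have "AE t in M. \<forall>n. (\<Sum>i<n. h i t) \<le> v t" using v(2) by (simp add: AE_all_countable)
      with AE_space show ?thesis
      proof eventually_elim
        case (elim t)
        then have t: "t \<in> space M" by simp
        have "?J t = (\<integral>\<^sup>+ s. (\<Sum>n. ennreal ((1/2) ^ n * \<bar>x n s\<bar>) * indicator ({..t} \<inter> space M) s) \<partial>M)"
          unfolding G_def by (simp add: ennreal_suminf_multc)
        also have "\<dots> = (\<Sum>n. upto (\<lambda>s. (1/2) ^ n * \<bar>x n s\<bar>) t)"
          unfolding upto_def by (rule nn_integral_suminf) (rule upto_measurable[OF _ t], measurable)
        also have "\<dots> \<le> ennreal (r t * v t)"
        proof (rule suminf_le_const[OF summableI])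
          fix n
          have "upto (\<lambda>s. (1/2) ^ i * \<bar>x i s\<bar>) t = ennreal (h i t * r t)" for i
          proof -
            have "upto (\<lambda>s. (1/2) ^ i * \<bar>x i s\<bar>) t = ennreal ((1/2) ^ i) * ennreal (H (\<lambda>s. \<bar>x i s\<bar>) t * r t)"
              unfolding upto_cmult[OF ax(1) zero_le_power[of "1/2"] t, simplified]
              using upto_eq[OF ax(1) _ ax(2) t] by simp
            also have "\<dots> = ennreal (h i t * r t)"
              using H_nonneg[OF ax(1) _ ax(2) t] by (subst ennreal_mult'[symmetric]) (auto simp: h_def mult.assoc)
            finally show ?thesis .
          qed
          then have "(\<Sum>i<n. upto (\<lambda>s. (1/2) ^ i * \<bar>x i s\<bar>) t) = ennreal (\<Sum>i<n. h i t * r t)"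
            using r_pos[OF t] by (subst sum_ennreal[symmetric]) (auto simp: h_def)
          also have "\<dots> \<le> ennreal (r t * v t)"
            using elim r_pos[OF t] by (intro ennreal_leI) (simp flip: sum_distrib_right)
          finally show "(\<Sum>i<n. upto (\<lambda>s. (1/2) ^ i * \<bar>x i s\<bar>) t) \<le> ennreal (r t * v t)" .
        qed
        finally show ?case .
      qed
    qed
    \<comment> \<open>The bound by \<open>v\<close> holds almost everywhere only; monotonicity of
      the integral carries finiteness from a later good point back to every
      \<open>t\<close>.\<close>
    have Jfin: "?J t < \<infinity>" if t: "t \<in> space M" for t
    proof -
      obtain t' where t': "t' \<in> space M" "t \<le> t'" "?J t' \<le> ennreal (r t' * v t')"
        by (rule AE_above[OF J t])
      have "?J t \<le> ?J t'" using t'(2) by (intro nn_integral_mono mult_left_mono) (auto simp: indicator_def)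
      also note t'(3)
      finally show ?thesis by (simp add: le_less_trans)
    qed
    have Gfin: "AE s in M. G s < \<infinity>"
    proof (rule AE_upto)
      fix t assume t: "t \<in> space M"
      have [measurable]: "{..t} \<inter> space M \<in> sets M" by (rule initial_sets[OF t])
      have "AE s in M. G s * indicator ({..t} \<inter> space M) s \<noteq> \<infinity>"
        by (rule nn_integral_PInf_AE) (use Jfin[OF t] in auto)
      with AE_space show "AE s in M. s \<le> t \<longrightarrow> G s < \<infinity>"
        by eventually_elim (auto simp: indicator_def top.not_eq_extremum)
    qed
    define u where "u s = enn2real (G s)" for s
    have um: "u \<in> borel_measurable M" unfolding u_def by measurable
    have u0: "0 \<le> u s" for s by (simp add: u_def)
    have uJ: "upto u t = ?J t" for t
      unfolding upto_def
      by (rule nn_integral_cong_AE) (use Gfin in \<open>auto elim!: eventually_mono simp: u_def\<close>)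
    have hu: "hd u" using hd_iff[OF um u0] Jfin by (simp add: uJ)
    have "AE t in M. \<bar>H u t\<bar> \<le> \<bar>v t\<bar>"
      using J AE_space
    proof eventually_elim
      case (elim t)
      then have t: "t \<in> space M" and "ennreal (H u t * r t) \<le> ennreal (r t * v t)"
        using upto_eq[OF um u0 hu, of t] uJ[of t] by auto
      note this(2)
      also have "ennreal (r t * v t) \<le> ennreal (r t * \<bar>v t\<bar>)"
        using r_pos[OF t] by (intro ennreal_leI mult_left_mono) auto
      finally have "H u t * r t \<le> r t * \<bar>v t\<bar>" using r_pos[OF t] by (simp add: ennreal_le_iff)
      then have "H u t \<le> \<bar>v t\<bar>" using r_pos[OF t] by (simp add: mult.commute)
      then show ?case using H_nonneg[OF um u0 hu t] by simp
    qed
    from idealD(1)[OF bis_ideal[OF bis] v(1) H_measurable[OF um u0 hu] this]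
    have uin: "u \<in> elems (cesaro E)" using um hu by (simp add: el u0)
    have "AE t in M. \<bar>x n t\<bar> \<le> 2 ^ n * u t" for n
      using Gfin
    proof eventually_elim
      case (elim t)
      have "ennreal ((1/2) ^ n * \<bar>x n t\<bar>) \<le> G t"
        unfolding G_def by (rule term_le_suminf)
      also have "G t = ennreal (u t)" using elim unfolding u_def by (simp add: ennreal_enn2real)
      finally have "(1/2) ^ n * \<bar>x n t\<bar> \<le> u t" by (simp only: ennreal_le_iff[OF u0])
      then have "2 ^ n * ((1/2) ^ n * \<bar>x n t\<bar>) \<le> 2 ^ n * u t" by (rule mult_left_mono) simp
      then show ?case by (simp add: mult.assoc[symmetric] power_mult_distrib[symmetric])
    qed
    then show ?thesis by (intro bexI[OF _ uin] allI)
  qed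
  obtain w where w: "w \<in> elems E" "AE t in M. 0 < w t" by (rule di_weak_unit[OF di])
  \<comment> \<open>Boundedness of the Hardy operator places \<open>E\<close> inside its Cesaro
    space, so a weak unit of \<open>E\<close> serves again.\<close>
  have "w \<in> elems (cesaro E)"
    using di_abs[OF di w(1)] C bis_meas[OF bis w(1)] by (auto simp: el hardy_bounded_def)
  with w(2) have unit: "\<exists>w\<in>elems (cesaro E). AE t in M. 0 < w t" by blast
  have sub: "elems (cesaro E) \<subseteq> borel_measurable M" by (auto simp: el)
  have nonneg: "0 \<le> fnorm (cesaro E) x" if "x \<in> elems (cesaro E)" for x
    using that di_nonneg[OF di] by (simp add: el nm)
  show ?thesis
    unfolding dominating_ideal_def
  proof (intro conjI sub ip unit)
    show "\<forall>x\<in>elems (cesaro E). 0 \<le> fnorm (cesaro E) x \<and>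
        (fnorm (cesaro E) x = 0 \<longleftrightarrow> (AE t in M. x t = 0))"
      by (intro ballI conjI nonneg zero)
    show "\<forall>c. \<forall>x\<in>elems (cesaro E). (\<lambda>t. c * x t) \<in> elems (cesaro E) \<and>
        fnorm (cesaro E) (\<lambda>t. c * x t) = \<bar>c\<bar> * fnorm (cesaro E) x"
      by (intro allI ballI sc)
    show "\<forall>x. (\<forall>n::nat. x n \<in> elems (cesaro E) \<and> fnorm (cesaro E) (x n) \<le> 1) \<longrightarrow>
        (\<exists>u\<in>elems (cesaro E). \<forall>n. AE t in M. \<bar>x n t\<bar> \<le> 2 ^ n * u t)"
      using dom by (intro allI impI)
  qed
qed

end

section \<open>Multipliers of Cesaro spaces\<close>

lemma am_gm_power:
  fixes a :: "nat \<Rightarrow> real"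
  assumes "\<And>i. 0 \<le> a i"
  shows "(\<Prod>i<Suc n. a i) \<le> ((\<Sum>i<Suc n. a i) / Suc n) ^ Suc n"
proof -
  let ?p = "\<Prod>i<Suc n. a i"
  have p: "0 \<le> ?p" by (intro prod_nonneg) (use assms in auto)
  have "?p powr (1 / Suc n) \<le> (\<Sum>i<Suc n. a i) / Suc n"
    using arith_geom_mean[of "{..<Suc n}" a] assms by (simp add: sum_divide_distrib lessThan_empty_iff del: prod.lessThan_Suc sum.lessThan_Suc)
  then have "(?p powr (1 / Suc n)) ^ Suc n \<le> ((\<Sum>i<Suc n. a i) / Suc n) ^ Suc n"
    by (rule power_mono) simp
  moreover have "(?p powr (1 / Suc n)) ^ Suc n = ?p"
  proof (cases "?p = 0")
    case True
    then show ?thesis unfolding True by simp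
  next
    case False
    then have "0 < ?p powr (1 / Suc n)" by simp
    then have "(?p powr (1 / Suc n)) ^ Suc n = (?p powr (1 / Suc n)) powr (real (Suc n))"
      by (rule powr_realpow[symmetric])
    also have "\<dots> = ?p" using p by (simp add: powr_powr del: prod.lessThan_Suc)
    finally show ?thesis .
  qed
  ultimately show ?thesis by simp
qed

text \<open>Exponents may be negative, so the index set is enclosed in an integer interval ending at
  \<open>k\<close>. The geometric sum over the interval falls short of \<open>2 * 2 powi k\<close>
  by its smallest term.\<close>

lemma sum_dyadic_le:
  assumes "finite J" "\<And>j. j \<in> J \<Longrightarrow> j \<le> k"
  shows "(\<Sum>j\<in>J. 2 powi j) \<le> 2 * (2 powi k :: real)"
proof -
  have aux: "(\<Sum>j=k - int n..k. 2 powi j) \<le> 2 * 2 powi k - (2 powi (k - int n) :: real)" for n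
  proof (induction n)
    case (Suc n)
    have "{k - int (Suc n)..k} = insert (k - int (Suc n)) {k - int n..k}" by auto
    then have "(\<Sum>j=k - int (Suc n)..k. 2 powi j) = 2 powi (k - int (Suc n)) + (\<Sum>j=k - int n..k. 2 powi j :: real)"
      by simp
    moreover have "(2::real) powi (k - int n) = 2 * 2 powi (k - int (Suc n))"
      using power_int_add_1[of "2::real" "k - int (Suc n)"] by (simp add: algebra_simps)
    ultimately show ?case using Suc by linarith
  qed simp
  define n where "n = nat (k - Min (insert k J))"
  have "J \<subseteq> {k - int n..k}"
  proof
    fix j assume j: "j \<in> J"
    then have "Min (insert k J) \<le> j" using assms by (intro Min_le) auto
    with assms(2)[OF j] show "j \<in> {k - int n..k}" by (simp add: n_def)
  qed
  then have "(\<Sum>j\<in>J. 2 powi j) \<le> (\<Sum>j=k - int n..k. 2 powi j :: real)"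
    by (intro sum_mono2) auto
  also have "\<dots> \<le> 2 * 2 powi k" using aux[of n] zero_le_power_int[of "2::real" "k - int n"] by linarith
  finally show ?thesis .
qed

lemma fatouD:
  assumes "fatou_property M F" "\<And>n. X n \<in> elems F" "x \<in> borel_measurable M"
    and "AE t in M. (\<forall>n. 0 \<le> X n t \<and> X n t \<le> X (Suc n) t) \<and> (\<lambda>n. X n t) \<longlonglongrightarrow> x t"
    and "\<And>n. fnorm F (X n) \<le> c"
  shows "x \<in> elems F" "fnorm F x \<le> c"
proof -
  have "bdd_above (range (\<lambda>n. fnorm F (X n)))" using assms(5) by (intro bdd_aboveI[of _ c]) auto
  with assms(1-4) have x: "x \<in> elems F \<and> incseq (\<lambda>n. fnorm F (X n)) \<and>
        (\<lambda>n. fnorm F (X n)) \<longlonglongrightarrow> fnorm F x"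
    unfolding fatou_property_def by blast
  then show "x \<in> elems F" by blast
  show "fnorm F x \<le> c" by (rule LIMSEQ_le_const2) (use x assms(5) in blast)+
qed

text \<open>On the set where the supremum is infinite, every multiple of a weak unit has norm at most \<open>c\<close>.\<close>

lemma fatou_bounded_AE:
  assumes bis: "banach_ideal_space M F" and fatou: "fatou_property M F"
    and X: "\<And>n. X n \<in> elems F" "AE t in M. \<forall>n. 0 \<le> X n t \<and> X n t \<le> X (Suc n) t"
    and c: "\<And>n. fnorm F (X n) \<le> c"
  shows "AE t in M. bdd_above (range (\<lambda>n. X n t))"
proof -
  note di = bis_dominating[OF bis]
  have Xm[measurable]: "X n \<in> borel_measurable M" for n by (rule di_meas[OF di X(1)])
  obtain w where w: "w \<in> elems F" "AE t in M. 0 < w t" by (rule di_weak_unit[OF di])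
  have [measurable]: "w \<in> borel_measurable M" by (rule di_meas[OF di w(1)])
  define A where "A = {t \<in> space M. \<forall>N::nat. \<exists>n. real N < X n t}"
  have [measurable]: "A \<in> sets M" unfolding A_def by measurable
  define wA where "wA t = w t * indicator A t" for t
  have [measurable]: "wA \<in> borel_measurable M" unfolding wA_def by measurable
  have wA: "wA \<in> elems F"
    by (rule di_idealD(1)[OF di w(1)]) (auto simp: wA_def indicator_def)
  have bound: "real N * fnorm F wA \<le> c" for N :: nat
  proof -
    \<comment> \<open>Truncation at a multiple of the weak unit on the bad set \<open>A\<close>. On
      \<open>A\<close> it eventually equals that multiple because \<open>X n t\<close> is unbounded
      there; off \<open>A\<close> both are zero. Points without \<open>0 < w t\<close> are set to 0
      to keep domination by \<open>X n\<close>.\<close>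
    define Y where "Y n t = (if 0 < w t then min (X n t) (real N * wA t) else 0)" for n t
    have Ym: "Y n \<in> borel_measurable M" for n unfolding Y_def by measurable
    have "AE t in M. \<bar>Y n t\<bar> \<le> \<bar>X n t\<bar>" for n
      using X(2) by eventually_elim (auto simp: Y_def wA_def indicator_def)
    note Y = di_idealD[OF di X(1) Ym this]
    have conv: "AE t in M. (\<forall>n. 0 \<le> Y n t \<and> Y n t \<le> Y (Suc n) t) \<and> (\<lambda>n. Y n t) \<longlonglongrightarrow> real N * wA t"
      using X(2) w(2) AE_space
    proof eventually_elim
      case (elim t)
      have mono: "X i t \<le> X j t" if "i \<le> j" for i j
        using lift_Suc_mono_le[of "\<lambda>n. X n t"] elim that by blast
      have "\<exists>n0. \<forall>n\<ge>n0. Y n t = real N * wA t"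
      proof (cases "t \<in> A")
        case True
        obtain N' :: nat where "real N * wA t < real N'" using reals_Archimedean2 by blast
        moreover obtain n0 where "real N' < X n0 t" using True unfolding A_def by blast
        ultimately have "real N * wA t \<le> X n t" if "n \<ge> n0" for n using mono[OF that] by linarith
        then show ?thesis using elim by (intro exI[of _ n0]) (simp add: Y_def min_absorb2)
      next
        case False
        then show ?thesis using elim by (auto simp: Y_def wA_def min_def antisym)
      qed
      then have "(\<lambda>n. Y n t) \<longlonglongrightarrow> real N * wA t"
        by (intro tendsto_eventually) (auto simp: eventually_sequentially)
      moreover have "0 \<le> wA t" using elim by (auto simp: wA_def indicator_def)
      ultimately show ?case using elim by (auto simp: Y_def intro: min.coboundedI1)
    qed
    have "(\<lambda>t. real N * wA t) \<in> borel_measurable M" by measurable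
    from fatouD(2)[OF fatou Y(1) this conv order_trans[OF Y(2) c]]
    have "fnorm F (\<lambda>t. real N * wA t) \<le> c" .
    then show ?thesis using di_norm_scale[OF di wA, of "real N"] by simp
  qed
  have "fnorm F wA = 0"
  proof (rule ccontr)
    assume "fnorm F wA \<noteq> 0"
    then have p: "0 < fnorm F wA" using di_nonneg[OF di wA] by simp
    obtain N where "c / fnorm F wA < real N" using reals_Archimedean2 by blast
    with bound[of N] p show False by (simp add: field_simps)
  qed
  then have "AE t in M. wA t = 0" using di_zero_iff[OF di wA] by simp
  with w(2) AE_space show ?thesis
  proof eventually_elim
    case (elim t)
    then have "t \<notin> A" by (auto simp: wA_def)
    then obtain N :: nat where "\<not> (\<exists>n. real N < X n t)" using elim unfolding A_def by blast
    then show ?case by (intro bdd_aboveI[of _ "real N"]) (auto simp: not_less)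
  qed
qed

context hardy_setting
begin

lemma cesaro_elems:
  "f \<in> elems (cesaro E) \<longleftrightarrow> f \<in> borel_measurable M \<and> hd (\<lambda>s. \<bar>f s\<bar>) \<and> H (\<lambda>s. \<bar>f s\<bar>) \<in> elems E"
  by (simp add: cesaro_def)

lemma cesaro_norm: "fnorm (cesaro E) f = fnorm E (H (\<lambda>s. \<bar>f s\<bar>))"
  by (simp add: cesaro_def)

text \<open>A real bound on the integrals also gives definedness of the Hardy operator, so
  membership in a Cesaro space can be checked on \<open>upto\<close> alone.\<close>

lemma cesaroI:
  assumes bis: "banach_ideal_space M E" and f: "f \<in> borel_measurable M"
    and x: "x \<in> elems E" and le: "\<And>t. t \<in> space M \<Longrightarrow> upto (\<lambda>s. \<bar>f s\<bar>) t \<le> ennreal (x t * r t)"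
  shows "f \<in> elems (cesaro E)" "fnorm (cesaro E) f \<le> fnorm E x"
proof -
  have fm: "(\<lambda>s. \<bar>f s\<bar>) \<in> borel_measurable M" using f by simp
  have hd: "hd (\<lambda>s. \<bar>f s\<bar>)" using hd_iff[OF fm] le_less_trans[OF le] by simp
  have "AE t in M. \<bar>H (\<lambda>s. \<bar>f s\<bar>) t\<bar> \<le> \<bar>x t\<bar>"
  proof (rule AE_I2)
    fix t assume t: "t \<in> space M"
    have "ennreal (H (\<lambda>s. \<bar>f s\<bar>) t * r t) \<le> ennreal (\<bar>x t\<bar> * r t)"
    proof -
      have "ennreal (H (\<lambda>s. \<bar>f s\<bar>) t * r t) \<le> ennreal (x t * r t)"
        using upto_eq[OF fm _ hd t] le[OF t] by simp
      also have "\<dots> \<le> ennreal (\<bar>x t\<bar> * r t)"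
        using r_pos[OF t] by (intro ennreal_leI mult_right_mono) auto
      finally show ?thesis .
    qed
    then have "H (\<lambda>s. \<bar>f s\<bar>) t * r t \<le> \<bar>x t\<bar> * r t" using r_pos[OF t] by (simp add: ennreal_le_iff)
    then have "H (\<lambda>s. \<bar>f s\<bar>) t \<le> \<bar>x t\<bar>" using r_pos[OF t] by simp
    then show "\<bar>H (\<lambda>s. \<bar>f s\<bar>) t\<bar> \<le> \<bar>x t\<bar>" using H_nonneg[OF fm _ hd t] by simp
  qed
  from idealD[OF bis_ideal[OF bis] x H_measurable[OF fm _ hd] this]
  show "f \<in> elems (cesaro E)" "fnorm (cesaro E) f \<le> fnorm E x"
    using f hd by (auto simp: cesaro_elems cesaro_norm)
qed

lemma antimono_le_upto:
  assumes y: "antimono_on (space M) y" and t: "t \<in> space M" "0 \<le> y t"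
  shows "ennreal (y t * r t) \<le> upto y t"
proof -
  have "ennreal (y t * r t) = ennreal (y t) * emeasure M ({..t} \<inter> space M)"
    using t initial[OF t(1)] by (simp add: ennreal_mult')
  also have "\<dots> = (\<integral>\<^sup>+ s. ennreal (y t) * indicator ({..t} \<inter> space M) s \<partial>M)"
    by (rule nn_integral_cmult_indicator[symmetric, OF initial_sets[OF t(1)]])
  also have "\<dots> \<le> upto y t"
    unfolding upto_def using monotone_onD[OF y _ t(1)]
    by (intro nn_integral_mono) (auto simp: indicator_def intro: ennreal_leI)
  finally show ?thesis .
qed

lemma rearr_cong:
  assumes "x \<in> borel_measurable M" "y \<in> borel_measurable M" "AE s in M. x s = y s"
  shows "rearr c x t = rearr c y t"
proof -
  have "dfun x l = dfun y l" for l
    by (intro antisym dfun_le) (use assms in \<open>auto elim: eventually_mono\<close>)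
  then show ?thesis by (simp add: rearr_def)
qed

lemma rearr_rearr_le:
  assumes m: "m \<in> borel_measurable M" "tame m" and c: "0 < c" "0 < c'" and t: "t \<in> space M"
  shows "rearr c' (rearr c m) t \<le> rearr (c * c') m t"
  unfolding rearr_def[of "c * c'"]
proof (rule cInf_greatest)
  show "{l. 0 \<le> l \<and> dfun m l < ennreal (c * c' * r t)} \<noteq> {}"
    by (rule rearr_nonempty[OF m _ t]) (use c in auto)
  fix l assume "l \<in> {l. 0 \<le> l \<and> dfun m l < ennreal (c * c' * r t)}"
  then have l: "0 \<le> l" "dfun m l < ennreal (c * c' * r t)" by auto
  have "dfun (rearr c m) l \<le> ennreal (1 / c) * dfun m l" by (rule dfun_rearr_le[OF m c(1) l(1)])
  also have "\<dots> < ennreal (1 / c) * ennreal (c * c' * r t)"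
    using c by (intro ennreal_mult_strict_left_mono l) auto
  also have "\<dots> = ennreal (c' * r t)" using c by (subst ennreal_mult'[symmetric]) auto
  finally show "rearr c' (rearr c m) t \<le> l" by (rule rearr_le[OF l(1)])
qed

lemma tandori_majorant:
  assumes f: "f \<in> borel_measurable M" "\<forall>t\<in>space M. maj f t < \<infinity>"
  defines "d \<equiv> \<lambda>t. real_of_ereal (maj f t)"
  shows "antimono_on (space M) d" "\<And>t. t \<in> space M \<Longrightarrow> 0 \<le> d t" "AE t in M. \<bar>f t\<bar> \<le> d t"
proof -
  have fin: "maj f t = ereal (d t)" if "t \<in> space M" for t
    using f(2) maj_nonneg[OF f(1) that] that by (auto simp: d_def ereal_real)
  show "antimono_on (space M) d"
    using maj_antimono[OF f(1)] by (auto simp: monotone_on_def fin)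
  show "0 \<le> d t" if "t \<in> space M" for t using maj_nonneg[OF f(1) that] that by (simp add: fin)
  show "AE t in M. \<bar>f t\<bar> \<le> d t"
    using maj_ge[OF f(1)] AE_space by eventually_elim (simp add: fin)
qed

end

text \<open>Here \<open>CE\<close> and \<open>CF\<close> are bounds for the Hardy operator on
  \<open>E\<close> and \<open>F\<close>; the Cesaro spaces are written \<open>cesaro E\<close> and
  \<open>cesaro F\<close>.\<close>

locale factorizing_pair = hardy_setting M r K tk hd H maj
  for M :: "'a::linorder measure" and r K tk hd H maj +
  fixes E F :: "'a fn_space" and CE CF :: real
  assumes E: "symmetric_space M E" and F: "symmetric_space M F"
    and fatou: "fatou_property M F"
    and CE: "hardy_bounded E CE" and CF: "hardy_bounded F CF"
    and CE_pos: "0 < CE" and CF_pos: "0 < CF"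
    and factor: "F \<approx> product_space M E (multiplier_space M E F)"
begin

abbreviation "ME \<equiv> multiplier_space M E F"

lemma bisE: "banach_ideal_space M E" and bisF: "banach_ideal_space M F"
  using E F by (auto simp: symmetric_space_def)

lemmas diE = bis_dominating[OF bisE] and diF = bis_dominating[OF bisF]

lemmas diCE = cesaro_dominating[OF bisE CE] and diCF = cesaro_dominating[OF bisF CF]

lemma multiplier_meas: "m \<in> elems ME \<Longrightarrow> m \<in> borel_measurable M"
  by (simp add: multiplier_elems)

lemma multiplier_mult: "m \<in> elems ME \<Longrightarrow> z \<in> elems E \<Longrightarrow> (\<lambda>t. m t * z t) \<in> elems F"
  by (simp add: multiplier_elems)

lemmas multiplier_mult_norm = multiplier_norm_bound[OF diE diF space_pos]
lemmas multiplier_nonneg = multiplier_norm_nonneg[OF diE diF space_pos]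

text \<open>\<open>g\<close> need not lie in \<open>E\<close>, but the rearrangement
  \<open>y\<close> of \<open>H |g|\<close> does. As \<open>y\<close> is decreasing,
  \<open>y t * r t\<close> is below its integral up to \<open>t\<close>, so the integrals of
  \<open>|g|\<close> are at most twice those of \<open>y\<close>, and Hardy's lemma preserves this
  under the decreasing weight \<open>d\<close>.\<close>

lemma tandori_multiplies:
  assumes f: "f \<in> elems (tandori ME)" and g: "g \<in> elems (cesaro E)"
  shows "(\<lambda>t. f t * g t) \<in> elems (cesaro F)"
    "fnorm (cesaro F) (\<lambda>t. f t * g t) \<le> 2 * CF * fnorm (tandori ME) f * fnorm (cesaro E) g"
proof -
  define d where "d = (\<lambda>t. real_of_ereal (maj f t))"
  have fm: "f \<in> borel_measurable M" "\<forall>t\<in>space M. maj f t < \<infinity>" "d \<in> elems ME"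
    and fn: "fnorm (tandori ME) f = fnorm ME d"
    using f by (auto simp: tandori_def d_def)
  have d: "antimono_on (space M) d" "\<And>t. t \<in> space M \<Longrightarrow> 0 \<le> d t" "AE t in M. \<bar>f t\<bar> \<le> d t"
    using tandori_majorant[OF fm(1,2)] by (simp_all add: d_def)
  have gm: "g \<in> borel_measurable M" using g by (simp add: cesaro_elems)
  have ag: "(\<lambda>s. \<bar>g s\<bar>) \<in> borel_measurable M" "hd (\<lambda>s. \<bar>g s\<bar>)" "H (\<lambda>s. \<bar>g s\<bar>) \<in> elems E"
    using g by (auto simp: cesaro_elems)
  define y where "y = rearr 1 (H (\<lambda>s. \<bar>g s\<bar>))"
  have y: "y \<in> elems E" "fnorm E y = fnorm (cesaro E) g"
    unfolding y_def using rearr_in_space[OF E ag(3)] by (auto simp: cesaro_norm)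
  have Hm: "H (\<lambda>s. \<bar>g s\<bar>) \<in> borel_measurable M" "tame (H (\<lambda>s. \<bar>g s\<bar>))"
    using bis_meas[OF bisE ag(3)] tame_elems[OF E ag(3)] by auto
  have ym: "y \<in> borel_measurable M" by (rule bis_meas[OF bisE y(1)])
  have ya: "antimono_on (space M) y" unfolding y_def by (rule rearr_antimono[OF Hm]) simp
  have y0: "0 \<le> y t" if "t \<in> space M" for t unfolding y_def by (rule rearr_nonneg[OF Hm _ that]) simp
  have up: "upto (\<lambda>s. \<bar>g s\<bar>) t \<le> ennreal 2 * upto y t" if t: "t \<in> space M" for t
  proof -
    have "upto (\<lambda>s. \<bar>g s\<bar>) t = ennreal (H (\<lambda>s. \<bar>g s\<bar>) t * r t)" by (rule upto_eq[OF ag(1) _ ag(2) t]) simp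
    also have "\<dots> \<le> ennreal (2 * (y t * r t))"
      using H_le_rearr[OF ag(1) _ ag(2) Hm(2) t] r_pos[OF t]
      by (intro ennreal_leI) (simp add: y_def mult.assoc[symmetric])
    also have "\<dots> = ennreal 2 * ennreal (y t * r t)" by (rule ennreal_mult') simp
    also have "\<dots> \<le> ennreal 2 * upto y t"
      by (intro mult_left_mono antimono_le_upto ya t y0) simp
    finally show ?thesis .
  qed
  have dm: "d \<in> borel_measurable M" by (rule multiplier_meas[OF fm(3)])
  define dy where "dy = (\<lambda>t. d t * y t)"
  have dy: "dy \<in> elems F" "fnorm F dy \<le> fnorm ME d * fnorm E y"
    unfolding dy_def using multiplier_mult[OF fm(3) y(1)] multiplier_mult_norm[OF fm(3) y(1)] by auto
  have dym: "dy \<in> borel_measurable M" by (rule bis_meas[OF bisF dy(1)])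
  have dy0: "0 \<le> dy s" if "s \<in> space M" for s unfolding dy_def using d(2) y0 that by simp
  have Hdy: "hd dy" "H dy \<in> elems F" "fnorm F (H dy) \<le> CF * fnorm F dy"
    using CF dy(1) by (auto simp: hardy_bounded_def)
  have up2: "upto (\<lambda>s. \<bar>f s * g s\<bar>) t \<le> ennreal ((2 * H dy t) * r t)" if t: "t \<in> space M" for t
  proof -
    have "upto (\<lambda>s. \<bar>f s * g s\<bar>) t \<le> upto (\<lambda>s. d s * \<bar>g s\<bar>) t"
      by (rule upto_mono_AE) (use d(3) in \<open>auto elim!: eventually_mono simp: abs_mult intro: mult_right_mono\<close>)
    also have "\<dots> \<le> ennreal 2 * upto dy t"
      unfolding dy_def by (rule upto_antimono_weight[OF ag(1) ym d(1) _ _ t]) (fact d(2) up)+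
    also have "\<dots> = ennreal ((2 * H dy t) * r t)"
      using upto_eq[OF dym dy0 Hdy(1) t] by (simp add: ennreal_mult' mult.assoc)
    finally show ?thesis .
  qed
  have fg: "(\<lambda>t. f t * g t) \<in> borel_measurable M" using fm(1) gm by measurable
  have *: "(\<lambda>t. f t * g t) \<in> elems (cesaro F)"
    "fnorm (cesaro F) (\<lambda>t. f t * g t) \<le> fnorm F (\<lambda>t. 2 * H dy t)"
    by (rule cesaroI[OF bisF fg bis_scale[OF bisF Hdy(2), of 2]], rule up2, assumption)+
  show "(\<lambda>t. f t * g t) \<in> elems (cesaro F)" by (rule *(1))
  have "fnorm (cesaro F) (\<lambda>t. f t * g t) \<le> 2 * fnorm F (H dy)"
    using *(2) bis_norm_scale[OF bisF Hdy(2), of 2] by simp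
  also have "\<dots> \<le> 2 * (CF * (fnorm ME d * fnorm E y))"
    using Hdy(3) dy(2) CF_pos by (intro mult_left_mono order_trans[OF Hdy(3)]) auto
  finally show "fnorm (cesaro F) (\<lambda>t. f t * g t) \<le> 2 * CF * fnorm (tandori ME) f * fnorm (cesaro E) g"
    by (simp add: fn y(2) mult.assoc)
qed

text \<open>
  The values of \<open>z\<close> at dyadic points are transported to sets \<open>P k\<close> on which \<open>m\<close> exceeds half of
  its rearrangement.  These sets may overlap, but their measures grow geometrically, so that the
  maximum over \<open>k\<close> has a distribution controlled by that of \<open>z\<close>.
\<close>

lemma rearr_mult_antimono:
  assumes m: "m \<in> elems ME" and z: "z \<in> elems E" "antimono_on (space M) z"
    "\<And>t. t \<in> space M \<Longrightarrow> 0 \<le> z t"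
  shows "(\<lambda>t. rearr (1/4) m t * z t) \<in> elems F"
    "fnorm F (\<lambda>t. rearr (1/4) m t * z t) \<le> 32 * CF * CE * fnorm ME m * fnorm E z"
proof -
  define b where "b = rearr (1/4) m"
  have mm: "m \<in> borel_measurable M" "tame m"
    using multiplier_meas[OF m] tame_multiplier[OF E F m] by auto
  have [measurable]: "b \<in> borel_measurable M" "m \<in> borel_measurable M" "z \<in> borel_measurable M"
    unfolding b_def using rearr_measurable[OF mm, of "1/4"] mm(1) bis_meas[OF bisE z(1)] by auto
  have b0: "0 \<le> b t" if "t \<in> space M" for t unfolding b_def by (rule rearr_nonneg[OF mm _ that]) simp
  have ba: "antimono_on (space M) b" unfolding b_def by (rule rearr_antimono[OF mm]) simp
  have tks: "tk k \<in> space M" "r (tk k) = 2 powi k" if "k \<in> K" for k using tk[OF that] by auto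
  have "\<exists>P\<in>sets M. emeasure M P \<le> ennreal (2 powi k) \<and>
      (0 < b (tk k) \<longrightarrow> ennreal (2 powi k / 4) \<le> emeasure M P \<and> (\<forall>s\<in>P. b (tk k) < 2 * \<bar>m s\<bar>))"
    if k: "k \<in> K" for k
  proof (cases "0 < b (tk k)")
    case True
    then have "ennreal (2 powi k / 4) \<le> dfun m (b (tk k) / 2)"
      using rearr_gtD[of "b (tk k) / 2" "1/4" m "tk k"] tks(2)[OF k] by (simp add: b_def)
    moreover obtain \<rho> where \<rho>: "2 powi k / 4 \<le> \<rho>" "\<And>t. t \<in> space M \<Longrightarrow> 2 powi k / 4 \<le> r t \<Longrightarrow> \<rho> \<le> r t"
        "\<And>A. A \<in> sets M \<Longrightarrow> ennreal (2 powi k / 4) \<le> emeasure M A \<Longrightarrow>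
          \<exists>P\<in>sets M. P \<subseteq> A \<and> emeasure M P = ennreal \<rho>"
      using subset_exact[of "2 powi k / 4"] by auto
    ultimately have "\<exists>P\<in>sets M. P \<subseteq> {s \<in> space M. b (tk k) / 2 < \<bar>m s\<bar>} \<and> emeasure M P = ennreal \<rho>"
      unfolding dfun_def by (intro \<rho>(3) dfun_sets[OF mm(1)])
    then obtain P where P: "P \<in> sets M" "P \<subseteq> {s \<in> space M. b (tk k) / 2 < \<bar>m s\<bar>}"
        "emeasure M P = ennreal \<rho>" by (elim bexE conjE)
    \<comment> \<open>Rounding the measure up to \<open>\<rho>\<close> does not overshoot, because
      \<open>2 powi k\<close> is itself attained as \<open>r (tk k)\<close>.\<close>
    have "\<rho> \<le> 2 powi k" using \<rho>(2)[OF tks(1)[OF k]] tks(2)[OF k] by simp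
    moreover have "b (tk k) < 2 * \<bar>m s\<bar>" if "s \<in> P" for s using P(2) that by auto
    ultimately show ?thesis using P(1,3) \<rho>(1) by (intro bexI[OF _ P(1)]) (simp add: ennreal_leI)
  next
    case False
    then show ?thesis by (intro bexI[of _ "{}"]) auto
  qed
  then obtain P where P: "\<And>k. k \<in> K \<Longrightarrow> P k \<in> sets M"
      "\<And>k. k \<in> K \<Longrightarrow> emeasure M (P k) \<le> ennreal (2 powi k)"
      "\<And>k. k \<in> K \<Longrightarrow> 0 < b (tk k) \<Longrightarrow> ennreal (2 powi k / 4) \<le> emeasure M (P k)"
      "\<And>k s. k \<in> K \<Longrightarrow> 0 < b (tk k) \<Longrightarrow> s \<in> P k \<Longrightarrow> b (tk k) < 2 * \<bar>m s\<bar>"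
    by metis
  \<comment> \<open>A finite window of scales keeps the maximum below well defined; the Fatou
    property removes the window at the end.\<close>
  define Kn where "Kn n = K \<inter> {- int n..int n}" for n
  have Kn: "finite (Kn n)" "0 \<in> Kn n" "k \<in> Kn n \<Longrightarrow> k \<in> K" for n k
    using zero_K by (auto simp: Kn_def)
  define z' where "z' n s = Max ((\<lambda>k. z (tk k) * indicator (P k) s) ` Kn n)" for n s
  have z'm[measurable]: "z' n \<in> borel_measurable M" for n
    unfolding z'_def
  proof (rule borel_measurable_Max[OF Kn(1)])
    fix k assume "k \<in> Kn n"
    then have [measurable]: "P k \<in> sets M" using P(1) Kn(3) by blast
    show "(\<lambda>s. z (tk k) * indicator (P k) s) \<in> borel_measurable M" by measurable
  qed
  have z'_ge: "z (tk k) * indicator (P k) s \<le> z' n s" if "k \<in> Kn n" for k n s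
    unfolding z'_def using that Kn(1) by (intro Max_ge) auto
  have z'0: "0 \<le> z' n s" for n s
    using z'_ge[OF Kn(2)[of n], of s] z(3)[OF tks(1)[OF zero_K]]
    by (cases "s \<in> P 0") auto
  have z'_gtD: "\<exists>k\<in>Kn n. s \<in> P k \<and> l < z (tk k)" if "l < z' n s" "0 \<le> l" for n s l
  proof -
    have "z' n s \<in> (\<lambda>k. z (tk k) * indicator (P k) s) ` Kn n"
      unfolding z'_def using Kn(1) Kn(2)[of n] by (intro Max_in) (simp, blast)
    then obtain k where "k \<in> Kn n" "z' n s = z (tk k) * indicator (P k) s" by blast
    with that show ?thesis by (cases "s \<in> P k") auto
  qed
  \<comment> \<open>A level set of \<open>z' n\<close> is covered by the \<open>P k\<close> with
    \<open>l < z (tk k)\<close>. Their bounds sum to at most twice the largest one,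
    \<open>2 powi \<kappa>\<close>, and \<open>z\<close> exceeds \<open>l\<close> on the whole
    segment up to \<open>tk \<kappa>\<close>.\<close>
  have dz: "dfun (z' n) l \<le> ennreal 2 * dfun z l" if l: "0 \<le> l" for n l
  proof -
    define S where "S = {k \<in> Kn n. l < z (tk k)}"
    have fS: "finite S" and SK: "S \<subseteq> K" using Kn by (auto simp: S_def)
    have sub: "{s \<in> space M. l < \<bar>z' n s\<bar>} \<subseteq> (\<Union>k\<in>S. P k)"
    proof
      fix s assume "s \<in> {s \<in> space M. l < \<bar>z' n s\<bar>}"
      then have "l < z' n s" using z'0[of n s] by simp
      from z'_gtD[OF this l] show "s \<in> (\<Union>k\<in>S. P k)" by (auto simp: S_def)
    qed
    show ?thesis
    proof (cases "S = {}")
      case True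
      with sub have "{s \<in> space M. l < \<bar>z' n s\<bar>} = {}" by simp
      then show ?thesis unfolding dfun_def by (simp only: emeasure_empty zero_le)
    next
      case False
      define \<kappa> where "\<kappa> = Max S"
      have \<kappa>: "\<kappa> \<in> S" "\<And>k. k \<in> S \<Longrightarrow> k \<le> \<kappa>" unfolding \<kappa>_def using fS False by auto
      have \<kappa>K: "\<kappa> \<in> K" using \<kappa>(1) SK by auto
      have "dfun (z' n) l \<le> emeasure M (\<Union>k\<in>S. P k)"
        unfolding dfun_def using sub P(1) SK fS by (intro emeasure_mono sets.finite_UN) auto
      also have "\<dots> \<le> (\<Sum>k\<in>S. emeasure M (P k))"
        using P(1) SK fS by (intro emeasure_subadditive_finite) auto
      also have "\<dots> \<le> (\<Sum>k\<in>S. ennreal (2 powi k))" using P(2) SK by (intro sum_mono) auto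
      also have "\<dots> = ennreal (\<Sum>k\<in>S. 2 powi k)" by (rule sum_ennreal) simp
      also have "\<dots> \<le> ennreal (2 * 2 powi \<kappa>)" by (intro ennreal_leI sum_dyadic_le fS \<kappa>(2))
      also have "\<dots> = ennreal 2 * emeasure M ({..tk \<kappa>} \<inter> space M)"
        using initial[OF tks(1)[OF \<kappa>K]] tks(2)[OF \<kappa>K] by (simp add: ennreal_mult')
      also have "\<dots> \<le> ennreal 2 * dfun z l"
        unfolding dfun_def
      proof (intro mult_left_mono emeasure_mono dfun_sets)
        show "{..tk \<kappa>} \<inter> space M \<subseteq> {s \<in> space M. l < \<bar>z s\<bar>}"
        proof safe
          fix s assume s: "s \<le> tk \<kappa>" "s \<in> space M"
          have "z (tk \<kappa>) \<le> z s" using monotone_onD[OF z(2) s(2) tks(1)[OF \<kappa>K] s(1)] .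
          with \<kappa>(1) show "l < \<bar>z s\<bar>" by (auto simp: S_def)
        qed
      qed auto
      finally show ?thesis .
    qed
  qed
  have z'E: "z' n \<in> elems E" "fnorm E (z' n) \<le> (CE * 2) * fnorm E z" for n
    using dfun_dominated_in_space[OF E CE z'm z(1) _ dz] by auto
  \<comment> \<open>The points reached by a dyadic block of the window; by \<open>dyadic\<close>
    these sets exhaust the space.\<close>
  define G where "G n = {t \<in> space M. \<exists>k\<in>Kn n. tk k \<le> t \<and> r t \<le> 2 * 2 powi k}" for n
  have [measurable]: "G n \<in> sets M" for n
  proof -
    have "{t \<in> space M. tk k \<le> t} \<in> sets M" if "k \<in> K" for k
    proof -
      have "{t \<in> space M. t < tk k} \<in> sets M" by (rule down_closed[THEN conjunct1]) auto
      then have "space M - {t \<in> space M. t < tk k} \<in> sets M" by auto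
      also have "space M - {t \<in> space M. t < tk k} = {t \<in> space M. tk k \<le> t}" by auto
      finally show ?thesis .
    qed
    moreover have "{t \<in> space M. r t \<le> v} \<in> sets M" for v
      by (rule down_closed[THEN conjunct1]) (auto intro: order_trans initial_mono)
    ultimately have "(\<Union>k\<in>Kn n. {t \<in> space M. tk k \<le> t} \<inter> {t \<in> space M. r t \<le> 2 * 2 powi k}) \<in> sets M"
      using Kn by (intro sets.finite_UN sets.Int) auto
    also have "(\<Union>k\<in>Kn n. {t \<in> space M. tk k \<le> t} \<inter> {t \<in> space M. r t \<le> 2 * 2 powi k}) = G n"
      by (auto simp: G_def)
    finally show ?thesis .
  qed
  define q where "q n t = b t * z t * indicator (G n) t" for n t
  have qm[measurable]: "q n \<in> borel_measurable M" for n unfolding q_def by measurable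
  define w where "w n t = 2 * (m t * z' n t)" for n t
  have wF: "w n \<in> elems F" "fnorm F (w n) \<le> 2 * (fnorm ME m * ((CE * 2) * fnorm E z))" for n
  proof -
    note mz = multiplier_mult[OF m z'E(1)[of n]]
    show "w n \<in> elems F" unfolding w_def by (rule bis_scale[OF bisF mz])
    have "fnorm F (w n) = 2 * fnorm F (\<lambda>t. m t * z' n t)"
      unfolding w_def using bis_norm_scale[OF bisF mz, of 2] by simp
    also have "\<dots> \<le> 2 * (fnorm ME m * fnorm E (z' n))"
      by (intro mult_left_mono multiplier_mult_norm m z'E) simp
    also have "\<dots> \<le> 2 * (fnorm ME m * ((CE * 2) * fnorm E z))"
      by (intro mult_left_mono z'E multiplier_nonneg m) simp
    finally show "fnorm F (w n) \<le> 2 * (fnorm ME m * ((CE * 2) * fnorm E z))" .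
  qed
  \<comment> \<open>The largest block \<open>\<kappa>\<close> seeing the level \<open>l\<close>
    confines the level set of \<open>q n\<close> to measure \<open>2 * 2 powi \<kappa>\<close>,
    while \<open>w n\<close> exceeds \<open>l\<close> on \<open>P \<kappa>\<close>, of measure at
    least \<open>2 powi \<kappa> / 4\<close>. The quotient is 8.\<close>
  have dq: "dfun (q n) l \<le> ennreal 8 * dfun (w n) l" if l: "0 \<le> l" for n l
  proof -
    define S where "S = {k \<in> Kn n. l < b (tk k) * z (tk k)}"
    have fS: "finite S" and SK: "S \<subseteq> K" using Kn by (auto simp: S_def)
    have key: "\<exists>k\<in>S. r s \<le> 2 * 2 powi k" if s: "s \<in> space M" "l < \<bar>q n s\<bar>" for s
    proof -
      have "s \<in> G n" using s l by (cases "s \<in> G n") (auto simp: q_def)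
      then obtain k where k: "k \<in> Kn n" "tk k \<le> s" "r s \<le> 2 * 2 powi k" by (auto simp: G_def)
      have kK: "k \<in> K" using k Kn by blast
      have "l < b s * z s" using s \<open>s \<in> G n\<close> b0[OF s(1)] z(3)[OF s(1)] by (simp add: q_def)
      also have "\<dots> \<le> b (tk k) * z (tk k)"
        using monotone_onD[OF ba tks(1)[OF kK] s(1) k(2)] monotone_onD[OF z(2) tks(1)[OF kK] s(1) k(2)]
          b0 z(3) s(1) tks(1)[OF kK] by (intro mult_mono) auto
      finally show ?thesis using k by (auto simp: S_def)
    qed
    show ?thesis
    proof (cases "S = {}")
      case True
      with key have "{s \<in> space M. l < \<bar>q n s\<bar>} = {}" by blast
      then show ?thesis unfolding dfun_def by (simp only: emeasure_empty zero_le)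
    next
      case False
      define \<kappa> where "\<kappa> = Max S"
      have \<kappa>: "\<kappa> \<in> S" "\<And>k. k \<in> S \<Longrightarrow> k \<le> \<kappa>" unfolding \<kappa>_def using fS False by auto
      have \<kappa>K: "\<kappa> \<in> K" "\<kappa> \<in> Kn n" "l < b (tk \<kappa>) * z (tk \<kappa>)" using \<kappa>(1) SK by (auto simp: S_def)
      have bp: "0 < b (tk \<kappa>)" using \<kappa>K(3) l b0[OF tks(1)[OF \<kappa>K(1)]] by (cases "b (tk \<kappa>) = 0") auto
      have "dfun (q n) l \<le> emeasure M {t \<in> space M. ennreal (r t) \<le> ennreal (2 * 2 powi \<kappa>)}"
        unfolding dfun_def
      proof (rule emeasure_mono)
        show "{t \<in> space M. ennreal (r t) \<le> ennreal (2 * 2 powi \<kappa>)} \<in> sets M"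
          by (rule down_closed[THEN conjunct1]) (auto intro: order_trans initial_mono ennreal_leI)
        show "{s \<in> space M. l < \<bar>q n s\<bar>} \<subseteq> {t \<in> space M. ennreal (r t) \<le> ennreal (2 * 2 powi \<kappa>)}"
        proof safe
          fix s assume "s \<in> space M" "l < \<bar>q n s\<bar>"
          then obtain k where k: "k \<in> S" "r s \<le> 2 * 2 powi k" using key by blast
          have "(2::real) powi k \<le> 2 powi \<kappa>" using \<kappa>(2)[OF k(1)] by (intro power_int_increasing) auto
          with k show "ennreal (r s) \<le> ennreal (2 * 2 powi \<kappa>)" by (intro ennreal_leI) linarith
        qed
      qed
      also have "\<dots> \<le> ennreal (2 * 2 powi \<kappa>)" by (rule quantile_le)
      also have "\<dots> = ennreal 8 * ennreal (2 powi \<kappa> / 4)" by (subst ennreal_mult'[symmetric]) auto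
      also have "\<dots> \<le> ennreal 8 * emeasure M (P \<kappa>)" by (intro mult_left_mono P(3) \<kappa>K bp) simp
      also have "\<dots> \<le> ennreal 8 * dfun (w n) l"
        unfolding dfun_def
      proof (intro mult_left_mono emeasure_mono dfun_sets)
        show "w n \<in> borel_measurable M" by (rule bis_meas[OF bisF wF(1)])
        show "P \<kappa> \<subseteq> {s \<in> space M. l < \<bar>w n s\<bar>}"
        proof safe
          fix s assume s: "s \<in> P \<kappa>"
          show ss: "s \<in> space M" using s sets.sets_into_space[OF P(1)[OF \<kappa>K(1)]] by blast
          have "z (tk \<kappa>) \<le> z' n s" using z'_ge[OF \<kappa>K(2), of s] s by simp
          then have "b (tk \<kappa>) * z (tk \<kappa>) \<le> (2 * \<bar>m s\<bar>) * z' n s"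
            using P(4)[OF \<kappa>K(1) bp s] z(3)[OF tks(1)[OF \<kappa>K(1)]] by (intro mult_mono) auto
          with \<kappa>K(3) z'0[of n s] show "l < \<bar>w n s\<bar>" by (simp add: w_def abs_mult)
        qed
      qed auto
      finally show ?thesis .
    qed
  qed
  have qF: "q n \<in> elems F" "fnorm F (q n) \<le> (CF * 8) * fnorm F (w n)" for n
    using dfun_dominated_in_space[OF F CF qm wF(1) _ dq] by auto
  have qn: "fnorm F (q n) \<le> 32 * CF * CE * fnorm ME m * fnorm E z" for n
  proof -
    have "fnorm F (q n) \<le> (CF * 8) * (2 * (fnorm ME m * ((CE * 2) * fnorm E z)))"
      using CF_pos by (intro order_trans[OF qF(2)] mult_left_mono wF) auto
    then show ?thesis by (simp add: mult_ac)
  qed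
  have conv: "AE t in M. (\<forall>n. 0 \<le> q n t \<and> q n t \<le> q (Suc n) t) \<and> (\<lambda>n. q n t) \<longlonglongrightarrow> b t * z t"
  proof (rule AE_I2)
    fix t assume t: "t \<in> space M"
    have Gm: "t \<in> G i \<Longrightarrow> t \<in> G j" if "i \<le> j" for i j using that by (force simp: G_def Kn_def)
    obtain k where k: "k \<in> K" "tk k \<le> t" "r t \<le> 2 * 2 powi k" using dyadic[OF t] by blast
    have "k \<in> Kn (nat \<bar>k\<bar>)" using k(1) by (auto simp: Kn_def)
    then have "t \<in> G (nat \<bar>k\<bar>)" using k(2,3) t by (auto simp: G_def)
    then have "eventually (\<lambda>n. q n t = b t * z t) sequentially"
      using Gm by (auto simp: q_def eventually_sequentially intro!: exI[of _ "nat \<bar>k\<bar>"])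
    moreover have mono: "0 \<le> q n t \<and> q n t \<le> q (Suc n) t" for n
      using b0[OF t] z(3)[OF t] Gm[of n "Suc n"] by (cases "t \<in> G n") (auto simp: q_def)
    ultimately show "(\<forall>n. 0 \<le> q n t \<and> q n t \<le> q (Suc n) t) \<and> (\<lambda>n. q n t) \<longlonglongrightarrow> b t * z t"
      using mono by (blast intro: tendsto_eventually)
  qed
  have bzm: "(\<lambda>t. b t * z t) \<in> borel_measurable M" by measurable
  from fatouD[OF fatou qF(1) bzm conv qn]
  show "(\<lambda>t. rearr (1/4) m t * z t) \<in> elems F"
    "fnorm F (\<lambda>t. rearr (1/4) m t * z t) \<le> 32 * CF * CE * fnorm ME m * fnorm E z"
    by (simp_all add: b_def)
qed

text \<open>Rearranging the product makes \<open>z\<close> decreasing and halves both arguments, so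
  the dilation \<open>1/2\<close> of \<open>m\<close> becomes the \<open>1/4\<close> handled by
  \<open>rearr_mult_antimono\<close>. Dilating \<open>z\<close> costs \<open>2 * CE\<close>, which
  explains \<open>64 * CF * CE ^ 2\<close>.\<close>

lemma rearr_multiplier:
  assumes m: "m \<in> elems ME" and z: "z \<in> elems E"
  shows "(\<lambda>t. rearr (1/2) m t * z t) \<in> elems F"
    "fnorm F (\<lambda>t. rearr (1/2) m t * z t) \<le> 64 * CF * CE ^ 2 * fnorm ME m * fnorm E z"
proof -
  have mm: "m \<in> borel_measurable M" "tame m"
    using multiplier_meas[OF m] tame_multiplier[OF E F m] by auto
  have zm: "z \<in> borel_measurable M" "tame z"
    using bis_meas[OF bisE z] tame_elems[OF E z] by auto
  define m0 where "m0 = rearr (1/2) m"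
  have m0: "m0 \<in> borel_measurable M" "tame m0"
    unfolding m0_def using rearr_measurable[OF mm] tame_rearr[OF mm] by auto
  have z2: "rearr (1/2) z \<in> elems E" "fnorm E (rearr (1/2) z) \<le> (2 * CE) * fnorm E z"
    using dilated_rearr_in_space[OF E CE z, of "1/2"] by auto
  have z2a: "antimono_on (space M) (rearr (1/2) z)" by (rule rearr_antimono[OF zm]) simp
  have z20: "0 \<le> rearr (1/2) z t" if "t \<in> space M" for t by (rule rearr_nonneg[OF zm _ that]) simp
  have p: "(\<lambda>t. rearr (1/4) m t * rearr (1/2) z t) \<in> elems F"
    "fnorm F (\<lambda>t. rearr (1/4) m t * rearr (1/2) z t) \<le> 32 * CF * CE * fnorm ME m * fnorm E (rearr (1/2) z)"
    by (rule rearr_mult_antimono[OF m z2(1) z2a], rule z20, assumption)+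
  have le: "rearr 1 (\<lambda>t. m0 t * z t) t \<le> rearr (1/4) m t * rearr (1/2) z t" if t: "t \<in> space M" for t
  proof -
    have "rearr 1 (\<lambda>t. m0 t * z t) t \<le> rearr (1/2) m0 t * rearr (1/2) z t"
      using rearr_mult_le[OF m0 zm t, of 1] by simp
    also have "\<dots> \<le> rearr (1/4) m t * rearr (1/2) z t"
      using rearr_rearr_le[OF mm, of "1/2" "1/2"] t z20[OF t] by (intro mult_right_mono) (auto simp: m0_def)
    finally show ?thesis .
  qed
  have m0z: "(\<lambda>t. m0 t * z t) \<in> borel_measurable M" "tame (\<lambda>t. m0 t * z t)"
    using m0 zm tame_mult[OF m0 zm] by auto
  have res: "(\<lambda>t. m0 t * z t) \<in> elems F"
    "fnorm F (\<lambda>t. m0 t * z t) \<le> fnorm F (\<lambda>t. rearr (1/4) m t * rearr (1/2) z t)"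
    by (rule rearr_dominated_in_space[OF F CF m0z p(1)], rule le, assumption)+
  show "(\<lambda>t. rearr (1/2) m t * z t) \<in> elems F" using res(1) by (simp add: m0_def)
  have "fnorm F (\<lambda>t. m0 t * z t) \<le> 32 * CF * CE * fnorm ME m * fnorm E (rearr (1/2) z)"
    using res(2) p(2) by (rule order_trans)
  also have "\<dots> \<le> 32 * CF * CE * fnorm ME m * ((2 * CE) * fnorm E z)"
    using CF_pos CE_pos multiplier_nonneg[OF m] by (intro mult_left_mono z2) auto
  finally show "fnorm F (\<lambda>t. rearr (1/2) m t * z t) \<le> 64 * CF * CE ^ 2 * fnorm ME m * fnorm E z"
    by (simp add: m0_def power2_eq_square mult_ac)
qed

end

section \<open>Factorization of Cesaro spaces and cancellation\<close>

context factorizing_pair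
begin

text \<open>
  If \<open>H |v| = e m\<close> then \<open>H |v| \<le> 2 e\<^sub>1 m\<^sub>1\<close> with decreasing \<open>e\<^sub>1 \<in> E\<close> and decreasing multiplier \<open>m\<^sub>1\<close>,
  and dividing \<open>v\<close> by \<open>m\<^sub>1\<close> divides \<open>H |v|\<close> by at least \<open>m\<^sub>1\<close>.
\<close>

lemma cesaro_quotient:
  assumes v: "v \<in> elems (cesaro F)" and e: "e \<in> elems E" and m: "m \<in> elems ME"
    and em: "AE t in M. H (\<lambda>s. \<bar>v s\<bar>) t = e t * m t"
  defines "m1 \<equiv> rearr (1/2) m" and "g \<equiv> \<lambda>t. \<bar>v t\<bar> / rearr (1/2) m t"
  shows "g \<in> elems (cesaro E)" "fnorm (cesaro E) g \<le> 4 * CE * fnorm E e"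
    "AE t in M. \<bar>v t\<bar> = g t * m1 t"
proof -
  define w where "w = H (\<lambda>s. \<bar>v s\<bar>)"
  have vm: "v \<in> borel_measurable M" "hd (\<lambda>s. \<bar>v s\<bar>)" and wF: "w \<in> elems F"
    using v by (auto simp: cesaro_elems w_def)
  have av: "(\<lambda>s. \<bar>v s\<bar>) \<in> borel_measurable M" using vm by simp
  have wm: "w \<in> borel_measurable M" "tame w" using bis_meas[OF bisF wF] tame_elems[OF F wF] by auto
  have mm: "m \<in> borel_measurable M" "tame m"
    using multiplier_meas[OF m] tame_multiplier[OF E F m] by auto
  have ee: "e \<in> borel_measurable M" "tame e"
    using bis_meas[OF bisE e] tame_elems[OF E e] by auto
  have [measurable]: "m1 \<in> borel_measurable M" "v \<in> borel_measurable M"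
    unfolding m1_def using rearr_measurable[OF mm, of "1/2"] vm by auto
  have m1a: "antimono_on (space M) m1" unfolding m1_def by (rule rearr_antimono[OF mm]) simp
  have m10: "0 \<le> m1 t" if "t \<in> space M" for t unfolding m1_def by (rule rearr_nonneg[OF mm _ that]) simp
  define e1 where "e1 = rearr (1/2) e"
  have e1: "e1 \<in> elems E" "fnorm E e1 \<le> (2 * CE) * fnorm E e"
    using dilated_rearr_in_space[OF E CE e, of "1/2"] by (auto simp: e1_def)
  have e10: "0 \<le> e1 t" if "t \<in> space M" for t unfolding e1_def by (rule rearr_nonneg[OF ee _ that]) simp
  have wle: "w t \<le> 2 * (e1 t * m1 t)" if t: "t \<in> space M" for t
  proof -
    have "w t \<le> 2 * rearr 1 w t"
      unfolding w_def by (rule H_le_rearr[OF av _ vm(2) _ t]) (use wm in \<open>auto simp: w_def\<close>)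
    also have "rearr 1 w t = rearr 1 (\<lambda>t. e t * m t) t"
      by (rule rearr_cong) (use wm ee mm em in \<open>auto simp: w_def\<close>)
    also have "\<dots> \<le> e1 t * m1 t"
      using rearr_mult_le[OF ee mm t, of 1] by (simp add: e1_def m1_def)
    finally show ?thesis by simp
  qed
  have upv: "upto (\<lambda>s. \<bar>v s\<bar>) t = ennreal (w t * r t)" if "t \<in> space M" for t
    unfolding w_def by (rule upto_eq[OF av _ vm(2) that]) simp
  \<comment> \<open>Where \<open>m1\<close> vanishes, so does the average of \<open>|v|\<close>, and
    \<open>v\<close> is zero on the whole segment below. The convention that division by zero gives
    0 is then the correct value of \<open>g\<close>.\<close>
  have zero: "AE s in M. s \<le> t \<longrightarrow> v s = 0" if t: "t \<in> space M" "m1 t = 0" for t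
  proof -
    have "upto (\<lambda>s. \<bar>v s\<bar>) t = 0" using wle[OF t(1)] r_pos[OF t(1)] t
      by (simp add: upv ennreal_eq_0_iff mult_nonpos_nonneg)
    from upto_zero_AE[OF av t(1) this] show ?thesis by simp
  qed
  have gm: "g \<in> borel_measurable M" unfolding g_def m1_def[symmetric] by measurable
  have g0: "\<bar>g s\<bar> = \<bar>v s\<bar> / m1 s" if "s \<in> space M" for s using m10[OF that] by (simp add: g_def m1_def)
  have up: "upto (\<lambda>s. \<bar>g s\<bar>) t \<le> ennreal ((2 * e1 t) * r t)" if t: "t \<in> space M" for t
  proof (cases "m1 t = 0")
    case True
    have "upto (\<lambda>s. \<bar>g s\<bar>) t = upto (\<lambda>_. 0) t"
      by (rule upto_cong_AE) (use zero[OF t True] in \<open>auto elim!: eventually_mono simp: g_def\<close>)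
    then show ?thesis by (simp add: upto_def)
  next
    case False
    then have p: "0 < m1 t" using m10[OF t] by simp
    have "upto (\<lambda>s. \<bar>g s\<bar>) t \<le> upto (\<lambda>s. (1 / m1 t) * \<bar>v s\<bar>) t"
    proof (rule upto_mono_AE, rule AE_I2, rule impI)
      fix s assume s: "s \<in> space M" "s \<le> t"
      have "m1 t \<le> m1 s" by (rule monotone_onD[OF m1a s(1) t s(2)])
      then show "\<bar>g s\<bar> \<le> (1 / m1 t) * \<bar>v s\<bar>" using p g0[OF s(1)] by (simp add: frac_le)
    qed
    also have "\<dots> = ennreal (1 / m1 t) * ennreal (w t * r t)"
      using upto_cmult[OF av _ t, of "1 / m1 t"] p by (simp add: upv[OF t])
    also have "\<dots> = ennreal ((1 / m1 t) * (w t * r t))" using p by (intro ennreal_mult'[symmetric]) simp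
    also have "\<dots> \<le> ennreal ((2 * e1 t) * r t)"
    proof (rule ennreal_leI)
      have "w t * r t \<le> 2 * (e1 t * m1 t) * r t" using wle[OF t] r_pos[OF t] by (intro mult_right_mono) auto
      then show "(1 / m1 t) * (w t * r t) \<le> (2 * e1 t) * r t" using p by (simp add: field_simps)
    qed
    finally show ?thesis .
  qed
  have *: "g \<in> elems (cesaro E)" "fnorm (cesaro E) g \<le> fnorm E (\<lambda>t. 2 * e1 t)"
    by (rule cesaroI[OF bisE gm bis_scale[OF bisE e1(1), of 2]], rule up, assumption)+
  show "g \<in> elems (cesaro E)" by (rule *(1))
  have "fnorm (cesaro E) g \<le> 2 * fnorm E e1" using *(2) bis_norm_scale[OF bisE e1(1), of 2] by simp
  with e1(2) show "fnorm (cesaro E) g \<le> 4 * CE * fnorm E e" by simp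
  \<comment> \<open>Only zeros of \<open>m1\<close> could break this identity: below a zero
    \<open>v\<close> vanishes, and below a point with \<open>m1 t\<close> positive there are
    none.\<close>
  show "AE t in M. \<bar>v t\<bar> = g t * m1 t"
  proof (rule AE_upto)
    fix t assume t: "t \<in> space M"
    show "AE s in M. s \<le> t \<longrightarrow> \<bar>v s\<bar> = g s * m1 s"
    proof (cases "m1 t = 0")
      case True
      then show ?thesis using zero[OF t] by (auto elim!: eventually_mono simp: g_def)
    next
      case False
      show ?thesis
      proof (rule AE_I2, rule impI)
        fix s assume s: "s \<in> space M" "s \<le> t"
        have "m1 t \<le> m1 s" by (rule monotone_onD[OF m1a s(1) t s(2)])
        then have "m1 s \<noteq> 0" using False m10[OF t] by simp
        then show "\<bar>v s\<bar> = g s * m1 s" by (simp add: g_def m1_def)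
      qed
    qed
  qed
qed

text \<open>The product norm is an infimum that need not be attained. Raising \<open>C\<close> to
  \<open>C + 1\<close> leaves room for an actual factorization, as the positive norm of
  \<open>w\<close> makes the inequality strict.\<close>

lemma factor_bound:
  obtains C where "0 < C" "\<And>w. w \<in> elems F \<Longrightarrow> 0 < fnorm F w \<Longrightarrow>
    \<exists>e\<in>elems E. \<exists>m\<in>elems ME. (AE t in M. w t = e t * m t) \<and> fnorm E e * fnorm ME m \<le> C * fnorm F w"
proof -
  have eq: "elems F = elems (product_space M E ME)"
    using factor unfolding eq_equiv_norms_def by (rule conjunct1)
  from factor[unfolded eq_equiv_norms_def, THEN conjunct2]
  obtain C where C: "0 < C" "\<And>w. w \<in> elems F \<Longrightarrow> fnorm (product_space M E ME) w \<le> C * fnorm F w"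
    by (elim exE conjE) simp
  show ?thesis
  proof
    show "0 < C + 1" using C by simp
    fix w assume w: "w \<in> elems F" "0 < fnorm F w"
    let ?S = "{fnorm E x * fnorm ME y | x y.
                  x \<in> elems E \<and> y \<in> elems ME \<and> (AE t in M. w t = x t * y t)}"
    have ne: "?S \<noteq> {}" using w(1) unfolding eq by (auto simp: product_space_def)
    have "Inf ?S < (C + 1) * fnorm F w"
      using C(2)[OF w(1)] w(2) by (simp add: product_space_def algebra_simps)
    from cInf_lessD[OF ne this] obtain e m where em: "e \<in> elems E" "m \<in> elems ME"
        "AE t in M. w t = e t * m t" "fnorm E e * fnorm ME m < (C + 1) * fnorm F w"
      by blast
    then show "\<exists>e\<in>elems E. \<exists>m\<in>elems ME. (AE t in M. w t = e t * m t) \<and>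
        fnorm E e * fnorm ME m \<le> (C + 1) * fnorm F w"
      by (intro bexI[of _ e] bexI[of _ m] conjI) auto
  qed
qed

text \<open>Factorization through the unit ball of the Cesaro space and a decreasing multiplier
  carrying the whole norm. The multiplier bound is spelled out on each \<open>z\<close>, so that
  averages of such functions inherit it by the triangle inequality in \<open>F\<close>.\<close>

definition splits :: "real \<Rightarrow> ('a \<Rightarrow> real) \<Rightarrow> bool" where
  "splits B v \<longleftrightarrow> (\<exists>g h. g \<in> elems (cesaro E) \<and> fnorm (cesaro E) g \<le> 1 \<and>
      antimono_on (space M) h \<and> (\<forall>t\<in>space M. 0 \<le> h t) \<and>
      (\<forall>z\<in>elems E. (\<lambda>t. h t * z t) \<in> elems F \<and>
        fnorm F (\<lambda>t. h t * z t) \<le> B * fnorm (cesaro F) v * fnorm E z) \<and>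
      (AE t in M. \<bar>v t\<bar> \<le> \<bar>g t\<bar> * h t))"

lemma cesaro_factor:
  obtains B where "0 < B" "\<And>v. v \<in> elems (cesaro F) \<Longrightarrow> splits B v"
proof -
  obtain C where C: "0 < C" "\<And>w. w \<in> elems F \<Longrightarrow> 0 < fnorm F w \<Longrightarrow>
    \<exists>e\<in>elems E. \<exists>m\<in>elems ME. (AE t in M. w t = e t * m t) \<and> fnorm E e * fnorm ME m \<le> C * fnorm F w"
    by (rule factor_bound) blast
  \<comment> \<open>The factors come from the quotient \<open>g\<close>, from rearranging the
    multiplier, and from the given factorization of \<open>F\<close>.\<close>
  define B where "B = 4 * CE * (64 * CF * CE ^ 2) * C"
  show ?thesis
  proof
    show "0 < B" using CE_pos CF_pos C(1) by (simp add: B_def)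
    fix v assume v: "v \<in> elems (cesaro F)"
    define w where "w = H (\<lambda>s. \<bar>v s\<bar>)"
    have w: "w \<in> elems F" "fnorm (cesaro F) v = fnorm F w" using v by (auto simp: w_def cesaro_elems cesaro_norm)
    show "splits B v"
    proof (cases "fnorm F w = 0")
      \<comment> \<open>\<open>factor_bound\<close> requires a positive norm; here \<open>v\<close>
        is null, and \<open>h = 0\<close> with any unit vector splits it.\<close>
      case True
      then have v0: "AE t in M. v t = 0" using di_zero_iff[OF diCF v] w by simp
      obtain x where x: "x \<in> elems (cesaro E)" "fnorm (cesaro E) x = 1"
        by (rule di_unit_vector[OF diCE space_pos]) blast
      have "antimono_on (space M) (\<lambda>_. 0 :: real)" by (simp add: monotone_on_def)
      show ?thesis
        unfolding splits_def
        by (rule exI[of _ x], rule exI[of _ "\<lambda>_. 0"])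
          (use \<open>antimono_on _ _\<close> x v0 bis_zero[OF bisF] bis_norm_zero[OF bisF] True w(2)
            in \<open>auto elim: eventually_mono\<close>)
    next
      case False
      then have wp: "0 < fnorm F w" using di_nonneg[OF diF w(1)] by simp
      obtain e m where e: "e \<in> elems E" and m: "m \<in> elems ME" and em: "AE t in M. w t = e t * m t"
          and emn: "fnorm E e * fnorm ME m \<le> C * fnorm F w" using C(2)[OF w(1) wp] by blast
      define m1 where "m1 = rearr (1/2) m"
      define g where "g = (\<lambda>t. \<bar>v t\<bar> / m1 t)"
      have g: "g \<in> elems (cesaro E)" "fnorm (cesaro E) g \<le> 4 * CE * fnorm E e"
          "AE t in M. \<bar>v t\<bar> = g t * m1 t"
        using cesaro_quotient[OF v e m em[unfolded w_def]] by (simp_all add: g_def m1_def)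
      have mm: "m \<in> borel_measurable M" "tame m"
        using multiplier_meas[OF m] tame_multiplier[OF E F m] by auto
      have m1a: "antimono_on (space M) m1" unfolding m1_def by (rule rearr_antimono[OF mm]) simp
      have m10: "0 \<le> m1 t" if "t \<in> space M" for t unfolding m1_def by (rule rearr_nonneg[OF mm _ that]) simp
      \<comment> \<open>Rescaling by \<open>c\<close> shifts the norm of \<open>g\<close> into the
        decreasing factor. If \<open>c\<close> were zero, \<open>g\<close> and hence
        \<open>v\<close> would be null.\<close>
      define c where "c = fnorm (cesaro E) g"
      have "c \<noteq> 0"
      proof
        assume "c = 0"
        then have "AE t in M. g t = 0" using di_zero_iff[OF diCE g(1)] by (simp add: c_def)
        with g(3) have "AE t in M. v t = 0" by eventually_elim auto
        then have "fnorm (cesaro F) v = 0" using di_zero_iff[OF diCF v] by simp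
        with wp w(2) show False by simp
      qed
      then have c: "0 < c" using di_nonneg[OF diCE g(1)] by (simp add: c_def)
      note n = di_normalize[OF diCE g(1) c[unfolded c_def], folded c_def]
      have hz: "(\<lambda>t. c * m1 t * z t) \<in> elems F \<and>
          fnorm F (\<lambda>t. c * m1 t * z t) \<le> B * fnorm (cesaro F) v * fnorm E z" if z: "z \<in> elems E" for z
      proof -
        note mz = rearr_multiplier[OF m z, folded m1_def]
        have "fnorm F (\<lambda>t. c * (m1 t * z t)) = c * fnorm F (\<lambda>t. m1 t * z t)"
          using bis_norm_scale[OF bisF mz(1), of c] c by simp
        also have "\<dots> \<le> (4 * CE * fnorm E e) * (64 * CF * CE ^ 2 * fnorm ME m * fnorm E z)"
          using g(2) c mz di_nonneg[OF diF mz(1)] di_nonneg[OF diE e] CE_pos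
          by (intro mult_mono) (auto simp: c_def)
        also have "\<dots> = (4 * CE * (64 * CF * CE ^ 2)) * (fnorm E e * fnorm ME m) * fnorm E z"
          by (simp add: mult_ac)
        also have "\<dots> \<le> (4 * CE * (64 * CF * CE ^ 2)) * (C * fnorm F w) * fnorm E z"
          using emn CE_pos CF_pos di_nonneg[OF diE z] by (intro mult_right_mono mult_left_mono) auto
        finally show ?thesis
          using bis_scale[OF bisF mz(1), of c] w(2) by (simp add: B_def mult_ac)
      qed
      show ?thesis
        unfolding splits_def
      proof (rule exI[of _ "\<lambda>t. inverse c * g t"], rule exI[of _ "\<lambda>t. c * m1 t"], intro conjI)
        show "antimono_on (space M) (\<lambda>t. c * m1 t)"
          using m1a c by (auto simp: monotone_on_def)
        show "AE t in M. \<bar>v t\<bar> \<le> \<bar>inverse c * g t\<bar> * (c * m1 t)"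
          using g(3) AE_space
        proof eventually_elim
          case (elim t)
          have "g t * m1 t \<le> \<bar>g t\<bar> * m1 t" using m10 elim by (intro mult_right_mono) auto
          also have "\<dots> = \<bar>inverse c * g t\<bar> * (c * m1 t)" using c by (simp add: abs_mult)
          finally show ?case using elim by simp
        qed
      qed (use n hz m10 c in auto)
    qed
  qed
qed

text \<open>
  Cancellation.  Iterating the factorization \<open>f x\<^sub>n \<le> x\<^sub>n\<^sub>+\<^sub>1 h\<^sub>n\<close> inside the unit ball of the Cesaro
  space gives \<open>f\<^sup>n x\<^sub>0 \<le> x\<^sub>n h\<^sub>0 \<dots> h\<^sub>n\<^sub>-\<^sub>1\<close>.  All \<open>x\<^sub>n\<close> lie below \<open>2\<^sup>n u\<close>, so after taking \<open>n\<close>-th roots \<open>f\<close> is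
  eventually at most a constant times the arithmetic mean of the decreasing functions \<open>h\<^sub>i\<close>.
\<close>

lemma multiplier_decreasing_means:
  assumes f: "f \<in> elems (multiplier_space M (cesaro E) (cesaro F))"
    and B: "0 < B" and step: "\<And>v. v \<in> elems (cesaro F) \<Longrightarrow> splits B v"
  defines "k \<equiv> fnorm (multiplier_space M (cesaro E) (cesaro F)) f"
  obtains A :: "nat \<Rightarrow> 'a \<Rightarrow> real" where
    "\<And>n. antimono_on (space M) (A n)" "\<And>n t. t \<in> space M \<Longrightarrow> 0 \<le> A n t"
    "\<And>n z. z \<in> elems E \<Longrightarrow> (\<lambda>t. A n t * z t) \<in> elems F"
    "\<And>n z. z \<in> elems E \<Longrightarrow> fnorm F (\<lambda>t. A n t * z t) \<le> B * k * fnorm E z"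
    "AE t in M. \<exists>N. \<forall>n\<ge>N. \<bar>f t\<bar> \<le> 4 * A n t"
proof -
  note mb = multiplier_norm_bound[OF diCE diCF space_pos f, folded k_def]
  have k0: "0 \<le> k" unfolding k_def by (rule multiplier_norm_nonneg[OF diCE diCF space_pos f])
  have fx: "(\<lambda>t. f t * x t) \<in> elems (cesaro F)" if "x \<in> elems (cesaro E)" for x
    using f that by (simp add: multiplier_elems)
  define U where "U = {x \<in> elems (cesaro E). fnorm (cesaro E) x \<le> 1}"
  define Q where "Q x g h \<longleftrightarrow> g \<in> U \<and> antimono_on (space M) h \<and> (\<forall>t\<in>space M. 0 \<le> h t) \<and>
      (\<forall>z\<in>elems E. (\<lambda>t. h t * z t) \<in> elems F \<and> fnorm F (\<lambda>t. h t * z t) \<le> B * k * fnorm E z) \<and>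
      (AE t in M. \<bar>f t * x t\<bar> \<le> \<bar>g t\<bar> * h t)" for x g h
  have "\<exists>g h. Q x g h" if x: "x \<in> U" for x
  proof -
    have xc: "x \<in> elems (cesaro E)" "fnorm (cesaro E) x \<le> 1" using x by (auto simp: U_def)
    obtain g h where gh: "g \<in> elems (cesaro E)" "fnorm (cesaro E) g \<le> 1"
        "antimono_on (space M) h" "\<forall>t\<in>space M. 0 \<le> h t"
        "\<And>z. z \<in> elems E \<Longrightarrow> (\<lambda>t. h t * z t) \<in> elems F"
        "\<And>z. z \<in> elems E \<Longrightarrow> fnorm F (\<lambda>t. h t * z t) \<le> B * fnorm (cesaro F) (\<lambda>t. f t * x t) * fnorm E z"
        "AE t in M. \<bar>f t * x t\<bar> \<le> \<bar>g t\<bar> * h t"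
      using step[OF fx[OF xc(1)]] unfolding splits_def by blast
    have "k * fnorm (cesaro E) x \<le> k" using xc(2) k0 by (rule mult_left_le)
    with mb[OF xc(1)] have "fnorm (cesaro F) (\<lambda>t. f t * x t) \<le> k" by linarith
    then have "B * fnorm (cesaro F) (\<lambda>t. f t * x t) * fnorm E z \<le> B * k * fnorm E z" if "z \<in> elems E" for z
      using B di_nonneg[OF diE that] by (intro mult_right_mono mult_left_mono) auto
    then have "fnorm F (\<lambda>t. h t * z t) \<le> B * k * fnorm E z" if "z \<in> elems E" for z
      using gh(6)[OF that] that order_trans by blast
    note gh = gh(1-5,7) this
    show ?thesis
      by (rule exI[of _ g], rule exI[of _ h]) (use gh in \<open>auto simp: U_def Q_def\<close>)
  qed
  then have "\<forall>x. \<exists>p. x \<in> U \<longrightarrow> Q x (fst p) (snd p)" by (metis fst_conv snd_conv)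
  from choice[OF this] obtain p where p: "\<And>x. x \<in> U \<Longrightarrow> Q x (fst (p x)) (snd (p x))" by blast
  define \<phi> where "\<phi> x = fst (p x)" for x
  define \<psi> where "\<psi> x = snd (p x)" for x
  have Q: "Q x (\<phi> x) (\<psi> x)" if "x \<in> U" for x using p[OF that] by (simp add: \<phi>_def \<psi>_def)
  have step': "\<And>x. x \<in> U \<Longrightarrow> \<phi> x \<in> U"
      "\<And>x. x \<in> U \<Longrightarrow> antimono_on (space M) (\<psi> x)" "\<And>x t. x \<in> U \<Longrightarrow> t \<in> space M \<Longrightarrow> 0 \<le> \<psi> x t"
      "\<And>x z. x \<in> U \<Longrightarrow> z \<in> elems E \<Longrightarrow> (\<lambda>t. \<psi> x t * z t) \<in> elems F"
      "\<And>x z. x \<in> U \<Longrightarrow> z \<in> elems E \<Longrightarrow> fnorm F (\<lambda>t. \<psi> x t * z t) \<le> B * k * fnorm E z"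
      "\<And>x. x \<in> U \<Longrightarrow> AE t in M. \<bar>f t * x t\<bar> \<le> \<bar>\<phi> x t\<bar> * \<psi> x t"
    using Q unfolding Q_def by blast+
  \<comment> \<open>A strictly positive start is needed so that \<open>f ^ n * x 0\<close> still
    determines the size of \<open>f\<close> at almost every point.\<close>
  obtain x0 where x0: "x0 \<in> elems (cesaro E)" "fnorm (cesaro E) x0 = 1" "AE t in M. 0 < x0 t"
    by (rule di_unit_vector[OF diCE space_pos])
  define x where "x n = (\<phi> ^^ n) x0" for n
  have xU: "x n \<in> U" for n
    by (induction n) (use x0 step'(1) in \<open>auto simp: x_def U_def\<close>)
  have xS: "x (Suc n) = \<phi> (x n)" for n by (simp add: x_def)
  define h where "h n = \<psi> (x n)" for n
  note h = step'(2-6)[OF xU, folded h_def xS]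
  obtain u where u: "u \<in> elems (cesaro E)" "\<And>n. AE t in M. \<bar>x n t\<bar> \<le> 2 ^ n * u t"
    using di_dominate[OF diCE, of x] xU by (auto simp: U_def)
  define A where "A n t = (\<Sum>i<Suc n. h i t) / real (Suc n)" for n t
  show ?thesis
  proof
    show "antimono_on (space M) (A n)" for n
      using h(1) unfolding A_def monotone_on_def by (auto intro!: divide_right_mono sum_mono simp del: sum.lessThan_Suc)
    show "0 \<le> A n t" if "t \<in> space M" for n t
      unfolding A_def using h(2)[OF that] by (intro divide_nonneg_nonneg sum_nonneg) auto
    have Az: "(\<lambda>t. A n t * z t) = (\<lambda>t. (1 / real (Suc n)) * (\<Sum>i<Suc n. h i t * z t))" for n z
      by (auto simp: A_def sum_distrib_right fun_eq_iff simp del: sum.lessThan_Suc)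
    fix n z assume z: "z \<in> elems E"
    have S: "(\<lambda>t. \<Sum>i<Suc n. h i t * z t) \<in> elems F"
        "fnorm F (\<lambda>t. \<Sum>i<Suc n. h i t * z t) \<le> (\<Sum>i<Suc n. fnorm F (\<lambda>t. h i t * z t))"
      using bis_sum[OF bisF, of "{..<Suc n}" "\<lambda>i t. h i t * z t"] h(3)[OF z] by auto
    show "(\<lambda>t. A n t * z t) \<in> elems F" unfolding Az by (rule bis_scale[OF bisF S(1)])
    have "fnorm F (\<lambda>t. A n t * z t) = (1 / real (Suc n)) * fnorm F (\<lambda>t. \<Sum>i<Suc n. h i t * z t)"
      unfolding Az using bis_norm_scale[OF bisF S(1), of "1 / real (Suc n)"] by simp
    also have "\<dots> \<le> (1 / real (Suc n)) * (\<Sum>i<Suc n. B * k * fnorm E z)"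
      by (intro mult_left_mono order_trans[OF S(2)] sum_mono h(4)[OF z]) auto
    also have "\<dots> = B * k * fnorm E z" by (simp del: sum.lessThan_Suc)
    finally show "fnorm F (\<lambda>t. A n t * z t) \<le> B * k * fnorm E z" .
  next
    have pow: "AE t in M. \<bar>f t\<bar> ^ n * \<bar>x 0 t\<bar> \<le> \<bar>x n t\<bar> * (\<Prod>i<n. h i t)" for n
    proof (induction n)
      case (Suc n)
      from Suc h(5)[of n] AE_space show ?case
      proof eventually_elim
        case (elim t)
        have p: "0 \<le> (\<Prod>i<n. h i t)" using h(2) elim by (intro prod_nonneg) auto
        have "\<bar>f t\<bar> ^ Suc n * \<bar>x 0 t\<bar> \<le> \<bar>f t\<bar> * (\<bar>x n t\<bar> * (\<Prod>i<n. h i t))"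
          using mult_left_mono[OF elim(1), of "\<bar>f t\<bar>"] by (simp add: mult.assoc)
        also have "\<dots> = \<bar>f t * x n t\<bar> * (\<Prod>i<n. h i t)" by (simp add: abs_mult)
        also have "\<dots> \<le> (\<bar>x (Suc n) t\<bar> * h n t) * (\<Prod>i<n. h i t)"
          using elim(2) p by (rule mult_right_mono)
        finally show ?case by (simp add: mult_ac)
      qed
    qed simp
    have "AE t in M. (\<forall>n. \<bar>f t\<bar> ^ n * \<bar>x 0 t\<bar> \<le> \<bar>x n t\<bar> * (\<Prod>i<n. h i t)) \<and> (\<forall>n. \<bar>x n t\<bar> \<le> 2 ^ n * u t)"
      using pow u(2) by (simp add: AE_all_countable)
    moreover have "AE t in M. 0 < x 0 t" using x0(3) by (simp add: x_def)
    ultimately show "AE t in M. \<exists>N. \<forall>n\<ge>N. \<bar>f t\<bar> \<le> 4 * A n t"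
      using AE_space
    proof eventually_elim
      case (elim t)
      have u0: "0 < u t" using elim by (auto dest!: spec[of _ 0])
      \<comment> \<open>From \<open>N\<close> on, \<open>(1/2) ^ n\<close> outweighs the ratio of
        \<open>u\<close> to \<open>x 0\<close> at \<open>t\<close>. The constant 4 combines the
        growth \<open>2 ^ n\<close> of the dominating function with one more factor 2 per power,
        used for this purpose.\<close>
      obtain N where N: "(1/2) ^ N < x 0 t / u t"
        using real_arch_pow_inv[of "x 0 t / u t" "1/2"] elim u0 by auto
      have "\<bar>f t\<bar> \<le> 4 * A n t" if n: "n \<ge> N" for n
      proof (rule ccontr)
        assume "\<not> \<bar>f t\<bar> \<le> 4 * A n t"
        moreover have A0: "0 \<le> A n t"
          unfolding A_def using h(2) elim by (intro divide_nonneg_nonneg sum_nonneg) auto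
        ultimately have f0: "0 < \<bar>f t\<bar>" and Af: "2 * A n t \<le> \<bar>f t\<bar> / 2" by linarith+
        let ?n = "Suc n"
        have "\<bar>f t\<bar> ^ ?n * x 0 t \<le> \<bar>x ?n t\<bar> * (\<Prod>i<?n. h i t)"
          using elim by (auto simp del: power_Suc prod.lessThan_Suc dest!: spec[of _ ?n])
        also have "\<dots> \<le> (2 ^ ?n * u t) * A n t ^ ?n"
        proof (rule mult_mono)
          show "\<bar>x ?n t\<bar> \<le> 2 ^ ?n * u t" using elim by blast
          show "(\<Prod>i<?n. h i t) \<le> A n t ^ ?n"
            unfolding A_def using h(2) elim by (intro am_gm_power) auto
          show "0 \<le> (\<Prod>i<?n. h i t)" using h(2) elim by (intro prod_nonneg) auto
        qed (use u0 in simp)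
        also have "\<dots> = (2 * A n t) ^ ?n * u t" unfolding power_mult_distrib by (simp only: mult_ac)
        also have "\<dots> \<le> (\<bar>f t\<bar> / 2) ^ ?n * u t"
          using Af A0 u0 by (intro mult_right_mono power_mono) auto
        also have "\<dots> = \<bar>f t\<bar> ^ ?n * ((1/2) ^ ?n * u t)"
          by (simp add: power_divide del: power_Suc)
        finally have "x 0 t \<le> (1/2) ^ ?n * u t"
          by (rule mult_left_le_imp_le) (use f0 in simp)
        moreover have "(1/2::real) ^ ?n \<le> (1/2) ^ N" using n by (intro power_decreasing) auto
        ultimately have "x 0 t \<le> (1/2) ^ N * u t" using u0 by (meson less_imp_le mult_right_mono order_trans)
        with N u0 show False by (simp add: field_simps)
      qed
      then show ?case by blast
    qed
  qed
qed

text \<open>The limit inferior \<open>D\<close> of the means is the candidate majorant: tail infima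
  stay decreasing in \<open>t\<close>, obey the same multiplier bound, and increase with
  \<open>n\<close>, as the Fatou property requires. Then \<open>|f| \<le> 4 * D\<close> almost
  everywhere, and the least decreasing majorant of \<open>f\<close> is below
  \<open>4 * D\<close>.\<close>

lemma multiplier_in_tandori:
  assumes f: "f \<in> elems (multiplier_space M (cesaro E) (cesaro F))"
    and B: "0 < B" and step: "\<And>v. v \<in> elems (cesaro F) \<Longrightarrow> splits B v"
  shows "f \<in> elems (tandori ME)"
    "fnorm (tandori ME) f \<le> 4 * B * fnorm (multiplier_space M (cesaro E) (cesaro F)) f"
proof -
  define k where "k = fnorm (multiplier_space M (cesaro E) (cesaro F)) f"
  have fm: "f \<in> borel_measurable M" using f by (simp add: multiplier_elems)
  obtain A :: "nat \<Rightarrow> 'a \<Rightarrow> real" where A: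
    "\<And>n. antimono_on (space M) (A n)" "\<And>n t. t \<in> space M \<Longrightarrow> 0 \<le> A n t"
    "\<And>n z. z \<in> elems E \<Longrightarrow> (\<lambda>t. A n t * z t) \<in> elems F"
    "\<And>n z. z \<in> elems E \<Longrightarrow> fnorm F (\<lambda>t. A n t * z t) \<le> B * k * fnorm E z"
    "AE t in M. \<exists>N. \<forall>n\<ge>N. \<bar>f t\<bar> \<le> 4 * A n t"
    unfolding k_def by (rule multiplier_decreasing_means[OF f B step]) blast+
  define b where "b n t = Inf ((\<lambda>i. A i t) ` {n..})" for n t
  have bdd: "bdd_below ((\<lambda>i. A i t) ` {n..})" if "t \<in> space M" for n t
    using A(2)[OF that] by (intro bdd_belowI[of _ 0]) auto
  have b0: "0 \<le> b n t" if "t \<in> space M" for n t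
    unfolding b_def using A(2)[OF that] by (intro cINF_greatest) auto
  have bA: "b n t \<le> A n t" if "t \<in> space M" for n t
    unfolding b_def by (rule cINF_lower[OF bdd[OF that]]) simp
  have bS: "b n t \<le> b (Suc n) t" if "t \<in> space M" for n t
    unfolding b_def by (rule cINF_superset_mono[OF _ bdd[OF that]]) auto
  have ba: "antimono_on (space M) (b n)" for n
  proof (rule monotone_onI)
    fix s t assume st: "s \<in> space M" "t \<in> space M" "s \<le> t"
    show "b n t \<le> b n s"
      unfolding b_def
      by (rule cINF_mono[OF _ bdd[OF st(2)]]) (use monotone_onD[OF A(1) st] in auto)
  qed
  have bm[measurable]: "b n \<in> borel_measurable M" for n by (rule antimono_on_measurable[OF ba])
  \<comment> \<open>The modulus of \<open>z\<close> keeps the products nonnegative and increasing in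
    \<open>n\<close>.\<close>
  have bz: "(\<lambda>t. b n t * \<bar>z t\<bar>) \<in> elems F" "fnorm F (\<lambda>t. b n t * \<bar>z t\<bar>) \<le> B * k * fnorm E z"
    if z: "z \<in> elems E" for n z
  proof -
    have [measurable]: "z \<in> borel_measurable M" by (rule di_meas[OF diE z])
    have "AE t in M. \<bar>b n t * \<bar>z t\<bar>\<bar> \<le> \<bar>A n t * z t\<bar>"
    proof (rule AE_I2)
      fix t assume t: "t \<in> space M"
      show "\<bar>b n t * \<bar>z t\<bar>\<bar> \<le> \<bar>A n t * z t\<bar>"
        using b0[OF t, of n] bA[OF t, of n] by (simp add: abs_mult mult_right_mono)
    qed
    note * = di_idealD[OF diF A(3)[OF z] _ this]
    show "(\<lambda>t. b n t * \<bar>z t\<bar>) \<in> elems F" by (rule *) measurable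
    have "fnorm F (\<lambda>t. b n t * \<bar>z t\<bar>) \<le> fnorm F (\<lambda>t. A n t * z t)" by (rule *) measurable
    with A(4)[OF z, of n] show "fnorm F (\<lambda>t. b n t * \<bar>z t\<bar>) \<le> B * k * fnorm E z" by simp
  qed
  have bzmono: "0 \<le> b n t * \<bar>z t\<bar> \<and> b n t * \<bar>z t\<bar> \<le> b (Suc n) t * \<bar>z t\<bar>" if "t \<in> space M" for n t z
    using b0[OF that, of n] bS[OF that, of n] by (simp add: mult_right_mono)
  \<comment> \<open>Testing the multipliers on a weak unit of \<open>E\<close> shows that the tail
    infima stay bounded at almost every point.\<close>
  obtain w where w: "w \<in> elems E" "AE t in M. 0 < w t" by (rule di_weak_unit[OF diE])
  have "AE t in M. bdd_above (range (\<lambda>n. b n t * \<bar>w t\<bar>))"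
    by (rule fatou_bounded_AE[OF bisF fatou bz(1)[OF w(1)] AE_I2 bz(2)[OF w(1)]]) (use bzmono in blast)
  with w(2) have fin_AE: "AE t in M. bdd_above (range (\<lambda>n. b n t))"
  proof eventually_elim
    case (elim t)
    then obtain c where c: "\<And>n. b n t * \<bar>w t\<bar> \<le> c" unfolding bdd_above_def by auto
    have "b n t \<le> c / w t" for n using c[of n] elim by (simp add: field_simps)
    then show ?case by (intro bdd_aboveI[of _ "c / w t"]) auto
  qed
  \<comment> \<open>A bound at an earlier point is a bound at \<open>t\<close>, since the functions
    \<open>b n\<close> are decreasing; so \<open>D\<close> is finite everywhere.\<close>
  have fin: "bdd_above (range (\<lambda>n. b n t))" if t: "t \<in> space M" for t
  proof -
    obtain s where s: "s \<in> space M" "s \<le> t" "bdd_above (range (\<lambda>n. b n s))" by (rule AE_below[OF fin_AE t])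
    then obtain c where c: "\<And>n. b n s \<le> c" unfolding bdd_above_def by auto
    have "b n t \<le> c" for n using monotone_onD[OF ba s(1) t s(2), of n] c[of n] by simp
    then show ?thesis by (intro bdd_aboveI[of _ c]) auto
  qed
  define D where "D t = (SUP n. b n t)" for t
  have bD: "b n t \<le> D t" if "t \<in> space M" for n t
    unfolding D_def by (rule cSUP_upper[OF _ fin[OF that]]) simp
  have D0: "0 \<le> D t" if "t \<in> space M" for t using b0[OF that, of 0] bD[OF that, of 0] by simp
  have Da: "antimono_on (space M) D"
  proof (rule monotone_onI)
    fix s t assume st: "s \<in> space M" "t \<in> space M" "s \<le> t"
    show "D t \<le> D s"
      unfolding D_def[of t]
      by (rule cSUP_least) (auto intro: order_trans[OF monotone_onD[OF ba st] bD[OF st(1)]])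
  qed
  have lim: "(\<lambda>n. b n t) \<longlonglongrightarrow> D t" if t: "t \<in> space M" for t
    unfolding D_def by (rule LIMSEQ_incseq_SUP[OF fin[OF t]]) (use bS[OF t] in \<open>auto intro: incseq_SucI\<close>)
  have [measurable]: "D \<in> borel_measurable M" by (rule antimono_on_measurable[OF Da])
  have Dz: "(\<lambda>t. D t * \<bar>z t\<bar>) \<in> elems F" "fnorm F (\<lambda>t. D t * \<bar>z t\<bar>) \<le> B * k * fnorm E z"
    if z: "z \<in> elems E" for z
  proof -
    have [measurable]: "z \<in> borel_measurable M" by (rule di_meas[OF diE z])
    have zm: "(\<lambda>t. D t * \<bar>z t\<bar>) \<in> borel_measurable M" by measurable
    have "AE t in M. (\<forall>n. 0 \<le> b n t * \<bar>z t\<bar> \<and> b n t * \<bar>z t\<bar> \<le> b (Suc n) t * \<bar>z t\<bar>) \<and>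
        (\<lambda>n. b n t * \<bar>z t\<bar>) \<longlonglongrightarrow> D t * \<bar>z t\<bar>"
    proof (rule AE_I2)
      fix t assume t: "t \<in> space M"
      have "(\<lambda>n. b n t * \<bar>z t\<bar>) \<longlonglongrightarrow> D t * \<bar>z t\<bar>" by (intro tendsto_mult lim t tendsto_const)
      with bzmono[OF t]
      show "(\<forall>n. 0 \<le> b n t * \<bar>z t\<bar> \<and> b n t * \<bar>z t\<bar> \<le> b (Suc n) t * \<bar>z t\<bar>) \<and>
        (\<lambda>n. b n t * \<bar>z t\<bar>) \<longlonglongrightarrow> D t * \<bar>z t\<bar>" by blast
    qed
    from fatouD[OF fatou bz(1)[OF z] zm this bz(2)[OF z]]
    show "(\<lambda>t. D t * \<bar>z t\<bar>) \<in> elems F" "fnorm F (\<lambda>t. D t * \<bar>z t\<bar>) \<le> B * k * fnorm E z" .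
  qed
  have fD: "AE t in M. \<bar>f t\<bar> \<le> 4 * D t"
    using A(5) AE_space
  proof eventually_elim
    case (elim t)
    then obtain N where N: "\<And>n. n \<ge> N \<Longrightarrow> \<bar>f t\<bar> \<le> 4 * A n t" by blast
    have "\<bar>f t\<bar> / 4 \<le> A n t" if "n \<ge> N" for n using N[OF that] by simp
    then have "\<bar>f t\<bar> / 4 \<le> b N t" unfolding b_def by (intro cINF_greatest) auto
    then show ?case using bD[OF elim(2), of N] by simp
  qed
  have maj: "maj f t \<le> ereal (4 * D t)" if "t \<in> space M" for t
    by (rule maj_le[OF fm _ fD that]) (use Da in \<open>auto simp: monotone_on_def\<close>)
  have mfin: "\<forall>t\<in>space M. maj f t < \<infinity>"
    by (intro ballI le_less_trans[OF maj]) simp_all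
  define d where "d = (\<lambda>t. real_of_ereal (maj f t))"
  have d: "antimono_on (space M) d" "\<And>t. t \<in> space M \<Longrightarrow> 0 \<le> d t"
    using tandori_majorant[OF fm mfin] by (simp_all add: d_def)
  have dD: "d t \<le> 4 * D t" if t: "t \<in> space M" for t
    using maj[OF t] maj_nonneg[OF fm t] unfolding d_def by (cases "maj f t") auto
  have dm[measurable]: "d \<in> borel_measurable M" by (rule antimono_on_measurable[OF d(1)])
  have dz: "(\<lambda>t. d t * z t) \<in> elems F \<and> fnorm F (\<lambda>t. d t * z t) \<le> (4 * B * k) * fnorm E z"
    if z: "z \<in> elems E" for z
  proof -
    have [measurable]: "z \<in> borel_measurable M" by (rule di_meas[OF diE z])
    have "AE t in M. \<bar>d t * z t\<bar> \<le> \<bar>4 * (D t * \<bar>z t\<bar>)\<bar>"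
    proof (rule AE_I2)
      fix t assume t: "t \<in> space M"
      have "d t * \<bar>z t\<bar> \<le> 4 * D t * \<bar>z t\<bar>" using dD[OF t] by (rule mult_right_mono) simp
      then show "\<bar>d t * z t\<bar> \<le> \<bar>4 * (D t * \<bar>z t\<bar>)\<bar>" using d(2)[OF t] D0[OF t] by (simp add: abs_mult)
    qed
    note * = di_idealD[OF diF bis_scale[OF bisF Dz(1)[OF z], of 4] _ this]
    have "(\<lambda>t. d t * z t) \<in> elems F" by (rule *) measurable
    moreover have "fnorm F (\<lambda>t. d t * z t) \<le> fnorm F (\<lambda>t. 4 * (D t * \<bar>z t\<bar>))" by (rule *) measurable
    ultimately show ?thesis
      using Dz(2)[OF z] bis_norm_scale[OF bisF Dz(1)[OF z], of 4] by simp
  qed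
  have "d \<in> elems ME" using dm dz by (simp add: multiplier_elems)
  then show "f \<in> elems (tandori ME)" using fm mfin by (simp add: tandori_def d_def)
  have "fnorm ME d \<le> 4 * B * k"
    by (rule multiplier_norm_leI[OF diE diF space_pos]) (use dz in blast)
  then show "fnorm (tandori ME) f \<le> 4 * B * fnorm (multiplier_space M (cesaro E) (cesaro F)) f"
    by (simp add: tandori_def d_def k_def)
qed

theorem multiplier_cesaro:
  "multiplier_space M (cesaro E) (cesaro F) \<approx> tandori ME"
proof -
  obtain B where B: "0 < B" "\<And>v. v \<in> elems (cesaro F) \<Longrightarrow> splits B v"
    by (rule cesaro_factor) blast
  let ?X = "multiplier_space M (cesaro E) (cesaro F)"
  note incl = multiplier_in_tandori[OF _ B]
  have forth: "f \<in> elems ?X" "fnorm ?X f \<le> 2 * CF * fnorm (tandori ME) f" if f: "f \<in> elems (tandori ME)" for f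
  proof -
    have "f \<in> borel_measurable M" using f by (simp add: tandori_def)
    then show "f \<in> elems ?X" using tandori_multiplies(1)[OF f] by (simp add: multiplier_elems)
    show "fnorm ?X f \<le> 2 * CF * fnorm (tandori ME) f"
      by (rule multiplier_norm_leI[OF diCE diCF space_pos]) (rule tandori_multiplies(2)[OF f])
  qed
  have eq: "elems ?X = elems (tandori ME)" using incl(1) forth(1) by blast
  show ?thesis
    unfolding eq_equiv_norms_def
  proof (rule conjI[OF eq], rule exI[of _ "1 / (2 * CF)"], rule conjI[rotated],
      rule exI[of _ "4 * B"], intro conjI ballI)
    fix f assume f: "f \<in> elems ?X"
    show "1 / (2 * CF) * fnorm ?X f \<le> fnorm (tandori ME) f"
      using forth(2)[OF incl(1)[OF f]] CF_pos by (simp add: field_simps)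
    show "fnorm (tandori ME) f \<le> 4 * B * fnorm ?X f" by (rule incl(2)[OF f])
  qed (use B(1) CF_pos in auto)
qed

end

section \<open>The half line and the positive integers\<close>

lemma half_sets: "A \<in> sets half_line \<longleftrightarrow> A \<subseteq> {0<..} \<and> A \<in> sets lebesgue"
  by (subst sets_restrict_space_iff) auto

lemma half_emeasure: "A \<subseteq> {0<..} \<Longrightarrow> emeasure half_line A = emeasure lebesgue A"
  by (rule emeasure_restrict_space) auto

lemma half_Ioc: "0 \<le> x \<Longrightarrow> emeasure half_line {0<..x} = ennreal x"
  by (subst half_emeasure) auto

lemma half_initial: "0 < t \<Longrightarrow> {..t} \<inter> {0<..} = {0<..(t::real)}"
  by auto

lemma half_AE_off_subsingleton:
  assumes "\<And>s s'. s \<in> N \<Longrightarrow> s' \<in> N \<Longrightarrow> s = (s'::real)"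
  shows "AE s in half_line. s \<notin> N"
proof (cases "N = {}")
  case False
  then obtain x where "N = {x}" using assms by blast
  moreover have "AE s in lebesgue. s \<noteq> x" by (rule AE_I'[of "{x}"]) auto
  ultimately show ?thesis by (subst AE_restrict_space_iff) auto
qed simp

text \<open>A down-closed subset is an interval starting at 0. Its rational points are cofinal
  except possibly for a greatest element, a single point and hence null.\<close>

lemma half_down_closed:
  assumes D: "D \<subseteq> {0<..}" "\<And>s t. t \<in> D \<Longrightarrow> 0 < s \<Longrightarrow> s \<le> t \<Longrightarrow> s \<in> D"
  shows "D \<in> sets half_line \<and> (\<exists>T. countable T \<and> T \<subseteq> D \<and> (AE s in half_line. s \<in> D \<longrightarrow> (\<exists>t\<in>T. s \<le> t)))"
proof
  show "D \<in> sets half_line"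
  proof (cases "D = {} \<or> D = {0<..}")
    case False
    then obtain a where a: "0 < a" "a \<notin> D" using D(1) by auto
    have bdd: "bdd_above D" by (rule bdd_aboveI[of _ a]) (use D(2) a in force)
    have "{0<..<Sup D} \<subseteq> D"
    proof
      fix s assume s: "s \<in> {0<..<Sup D}"
      then obtain t where "t \<in> D" "s < t" using less_cSup_iff[of D s] bdd False by auto
      then show "s \<in> D" using D(2) s by auto
    qed
    moreover have "D \<subseteq> {0<..Sup D}" using D(1) cSup_upper[OF _ bdd] by auto
    moreover have "{0<..Sup D} \<subseteq> insert (Sup D) {0<..<Sup D}" by auto
    ultimately have "D = {0<..<Sup D} \<or> D = {0<..Sup D}" by fastforce
    then have "D \<in> sets lborel" by (elim disjE ssubst) simp_all
    then show ?thesis using D(1) by (simp add: half_sets)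
  qed (auto simp: half_sets)
  let ?N = "{s \<in> D. \<forall>t\<in>D \<inter> \<rat>. \<not> s \<le> t}"
  have "AE s in half_line. s \<notin> ?N"
  proof (rule half_AE_off_subsingleton)
    have less: False if s: "s \<in> ?N" "s' \<in> ?N" "s < s'" for s s'
    proof -
      obtain q where q: "q \<in> \<rat>" "s < q" "q < s'" using Rats_dense_in_real[OF s(3)] by blast
      have "q \<in> D" using D(2)[of s' q] D(1) s q by auto
      then have "q \<in> D \<inter> \<rat>" "s \<le> q" using q by auto
      with s(1) show False by blast
    qed
    show "s = s'" if "s \<in> ?N" "s' \<in> ?N" for s s'
      by (rule antisym; rule leI; rule notI)
        (rule less[OF that(2,1)], assumption, rule less[OF that], assumption)
  qed
  then have "AE s in half_line. s \<in> D \<longrightarrow> (\<exists>t\<in>D \<inter> \<rat>. s \<le> t)" by eventually_elim auto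
  moreover have "countable (D \<inter> \<rat>)" by (rule countable_subset[OF _ countable_rat]) auto
  ultimately show "\<exists>T. countable T \<and> T \<subseteq> D \<and> (AE s in half_line. s \<in> D \<longrightarrow> (\<exists>t\<in>T. s \<le> t))"
    by (intro exI[of _ "D \<inter> \<rat>"]) auto
qed

lemma half_quantile: "emeasure half_line {t \<in> space half_line. ennreal t \<le> v} = v"
proof (cases v)
  case (real x)
  then have "{t \<in> space half_line. ennreal t \<le> v} = {0<..x}" by auto
  then show ?thesis using real half_Ioc by simp
next
  case top
  have "emeasure lebesgue ({0<..} :: real set) = \<infinity>"
  proof (rule ccontr)
    assume "emeasure lebesgue ({0<..} :: real set) \<noteq> \<infinity>"
    then obtain x where x: "0 \<le> x" "emeasure lebesgue ({0<..} :: real set) = ennreal x"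
      by (cases "emeasure lebesgue ({0<..} :: real set)") auto
    have "emeasure lebesgue {0<..x + 1} \<le> emeasure lebesgue ({0<..} :: real set)"
      by (intro emeasure_mono) auto
    then show False using x by (simp del: ennreal_plus)
  qed
  moreover have "{t \<in> space half_line. ennreal t \<le> v} = {0<..}" using top by auto
  ultimately show ?thesis using top by (simp add: half_emeasure)
qed

text \<open>The measure of the part of \<open>A\<close> up to \<open>s\<close> depends on
  \<open>s\<close> with Lipschitz constant 1, so the intermediate value theorem finds an initial
  piece of measure exactly \<open>e\<close>; thus \<open>\<rho> = e\<close> is possible on the half
  line.\<close>

lemma half_subset_exact:
  assumes e: "0 < e" and A: "A \<in> sets half_line" "ennreal e \<le> emeasure half_line A"
  shows "\<exists>P\<in>sets half_line. P \<subseteq> A \<and> emeasure half_line P = ennreal e"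
proof (cases "emeasure half_line A = ennreal e")
  case False
  then have lt: "ennreal e < emeasure half_line A" using A(2) by simp
  have A': "A \<subseteq> {0<..}" and [measurable]: "A \<in> sets lebesgue" using A(1) by (auto simp: half_sets)
  define F where "F s = emeasure lebesgue (A \<inter> {0<..s})" for s
  have F_fin: "F s \<le> ennreal s" if "0 \<le> s" for s
  proof -
    have "F s \<le> emeasure lebesgue {0<..s}" unfolding F_def by (intro emeasure_mono) auto
    also have "\<dots> = ennreal s" using that by simp
    finally show ?thesis .
  qed
  have "(SUP n. F (real n)) = emeasure lebesgue (\<Union>n. A \<inter> {0<..real n})"
    unfolding F_def by (rule SUP_emeasure_incseq) (auto simp: incseq_def)
  also have "(\<Union>n. A \<inter> {0<..real n}) = A"
    using A' real_arch_simple by fastforce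
  also have "emeasure lebesgue A = emeasure half_line A" using A' by (simp add: half_emeasure)
  finally have "ennreal e < (SUP n. F (real n))" using lt by simp
  then obtain n where n: "ennreal e < F (real n)" by (auto simp: less_SUP_iff)
  have lip: "enn2real (F t) - enn2real (F s) \<le> t - s \<and> enn2real (F s) \<le> enn2real (F t)"
    if st: "0 \<le> s" "s \<le> t" for s t
  proof -
    have "F t \<le> emeasure lebesgue ((A \<inter> {0<..s}) \<union> {s<..t})"
      unfolding F_def using st by (intro emeasure_mono sets.Un sets.Int) auto
    also have "\<dots> \<le> F s + emeasure lebesgue {s<..t}"
      unfolding F_def by (intro emeasure_subadditive sets.Int) auto
    also have "emeasure lebesgue {s<..t} = ennreal (t - s)" using st by simp
    finally have le: "F t \<le> F s + ennreal (t - s)" .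
    have fin: "F s < \<infinity>" "F t < \<infinity>" using F_fin[of s] F_fin[of t] st by (auto intro: le_less_trans)
    have "enn2real (F t) \<le> enn2real (F s + ennreal (t - s))"
      using fin by (intro enn2real_mono le) simp
    also have "\<dots> = enn2real (F s) + (t - s)" using fin st by (simp add: enn2real_plus)
    finally have "enn2real (F t) - enn2real (F s) \<le> t - s" by simp
    moreover have "F s \<le> F t" unfolding F_def using st by (intro emeasure_mono) auto
    then have "enn2real (F s) \<le> enn2real (F t)" using fin by (intro enn2real_mono) auto
    ultimately show ?thesis by blast
  qed
  have "continuous_on {0..real n} (\<lambda>s. enn2real (F s))"
  proof (rule continuous_onI)
    fix s and d :: real assume s: "s \<in> {0..real n}" and d: "0 < d"
    have "dist (enn2real (F s')) (enn2real (F s)) \<le> d" if "s' \<in> {0..real n}" "dist s' s < d" for s'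
      using lip[of s s'] lip[of s' s] s that by (cases "s \<le> s'") (auto simp: dist_real_def)
    then show "\<exists>d'>0. \<forall>x'\<in>{0..real n}. dist x' s < d' \<longrightarrow>
        dist (enn2real (F x')) (enn2real (F s)) \<le> d" using d by blast
  qed
  moreover have "enn2real (F 0) \<le> e" using e by (simp add: F_def)
  moreover have "e \<le> enn2real (F (real n))"
    using n F_fin[of "real n"] e by (cases "F (real n)") (auto simp: ennreal_less_iff top_unique)
  ultimately obtain s where s: "0 \<le> s" "s \<le> real n" "enn2real (F s) = e"
    using IVT'[of "\<lambda>s. enn2real (F s)" 0 e "real n"] by auto
  have "F s < \<infinity>" using F_fin[OF s(1)] by (rule le_less_trans) simp
  then have "F s = ennreal e" using s(3) by (metis ennreal_enn2real infinity_ennreal_def)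
  then show ?thesis
    using A' by (intro bexI[of _ "A \<inter> {0<..s}"]) (auto simp: half_sets half_emeasure F_def le_infI1)
qed (use A in blast)

lemma half_upto:
  assumes "0 < t"
  shows "(\<integral>\<^sup>+ s. ennreal (g s) * indicator ({..t} \<inter> space half_line) s \<partial>half_line) =
    (\<integral>\<^sup>+ s. ennreal (g s) \<partial>lebesgue_on {0<..t})"
proof -
  have "(\<integral>\<^sup>+ s. ennreal (g s) * indicator ({..t} \<inter> space half_line) s \<partial>half_line) =
      (\<integral>\<^sup>+ s. ennreal (g s) * indicator ({..t} \<inter> space half_line) s * indicator {0<..} s \<partial>lebesgue)"
    by (rule nn_integral_restrict_space) simp
  also have "\<dots> = (\<integral>\<^sup>+ s. ennreal (g s) * indicator {0<..t} s \<partial>lebesgue)"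
    by (intro nn_integral_cong) (auto simp: indicator_def)
  also have "\<dots> = (\<integral>\<^sup>+ s. ennreal (g s) \<partial>lebesgue_on {0<..t})"
    by (rule nn_integral_restrict_space[symmetric]) simp
  finally show ?thesis .
qed

interpretation half: ordered_measure half_line "\<lambda>t. t" UNIV "\<lambda>k. 2 powi k"
proof
  show "\<exists>A::real set set. countable A \<and> A \<subseteq> sets half_line \<and> \<Union> A = space half_line \<and>
      (\<forall>a\<in>A. emeasure half_line a \<noteq> \<infinity>)"
  proof (intro exI[of _ "range (\<lambda>n::nat. {0<..real n})"] conjI ballI)
    show "\<Union> (range (\<lambda>n::nat. {0<..real n})) = space half_line"
      using real_arch_simple by fastforce
  qed (auto simp: half_sets half_Ioc)
  show "0 < t" if "t \<in> space half_line" for t using that by simp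
  show "emeasure half_line ({..t} \<inter> space half_line) = ennreal t" if "t \<in> space half_line" for t
    using that by (simp add: half_initial half_Ioc)
  show "D \<in> sets half_line \<and>
      (\<exists>T. countable T \<and> T \<subseteq> D \<and> (AE s in half_line. s \<in> D \<longrightarrow> (\<exists>t\<in>T. s \<le> t)))"
    if "D \<subseteq> space half_line" "\<And>s t. t \<in> D \<Longrightarrow> s \<in> space half_line \<Longrightarrow> s \<le> t \<Longrightarrow> s \<in> D" for D
    using half_down_closed[of D] that by simp
  show "emeasure half_line {t \<in> space half_line. ennreal t \<le> v} \<le> v" for v
    using half_quantile[of v] by simp
  show "emeasure half_line {t \<in> space half_line. ennreal t \<le> emeasure half_line A} = emeasure half_line A" for A
    by (rule half_quantile)
  show "ennreal t \<le> emeasure half_line {s \<in> space half_line. t \<le> s \<and> s \<le> 2 * t}"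
    if "t \<in> space half_line" for t
  proof -
    have "{s \<in> space half_line. t \<le> s \<and> s \<le> 2 * t} = {t..2 * t}" using that by auto
    moreover have "{t..2 * t} \<subseteq> {0<..}" using that by auto
    ultimately show ?thesis using that by (simp add: half_emeasure)
  qed
  show "\<exists>\<rho>\<ge>e. (\<forall>t\<in>space half_line. e \<le> t \<longrightarrow> \<rho> \<le> t) \<and>
      (\<forall>A\<in>sets half_line. ennreal e \<le> emeasure half_line A \<longrightarrow>
        (\<exists>P\<in>sets half_line. P \<subseteq> A \<and> emeasure half_line P = ennreal \<rho>))" if "0 < e" for e
    using half_subset_exact[OF that] by (intro exI[of _ e]) auto
  show "2 powi k \<in> space half_line \<and> 2 powi k = (2::real) powi k" for k by simp
  show "\<exists>k\<in>UNIV. 2 powi k \<le> t \<and> t \<le> 2 * 2 powi k" if "t \<in> space half_line" for t :: real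
  proof
    have t: "0 < t" using that by simp
    let ?k = "\<lfloor>log 2 t\<rfloor>"
    have p: "2 powi ?k = 2 powr ?k" by (simp add: powr_real_of_int')
    have "2 powr ?k \<le> 2 powr (log 2 t)" by (intro powr_mono) auto
    moreover have "2 powr (log 2 t) \<le> 2 powr (real_of_int ?k + 1)" by (intro powr_mono) linarith+
    moreover have "2 powr (log 2 t) = t" using t by simp
    ultimately show "2 powi ?k \<le> t \<and> t \<le> 2 * 2 powi ?k" by (simp add: p powr_add)
  qed simp
qed simp_all

lemma half_measurable_sub:
  assumes "f \<in> borel_measurable half_line" "A \<subseteq> {0<..}"
  shows "f \<in> borel_measurable (lebesgue_on A)"
  using measurable_restrict_mono[OF assms] .

lemma half_AE_sub:
  assumes "AE s in half_line. P s" "A \<subseteq> {0<..}" "A \<in> sets lebesgue"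
  shows "AE s in lebesgue_on A. P s"
  using assms by (subst AE_restrict_space_iff) (auto simp: AE_restrict_space_iff elim: eventually_mono)

lemma majorant_fun_antimono:
  assumes f: "f \<in> borel_measurable half_line" and st: "0 < s" "s \<le> t"
  shows "majorant_fun f t \<le> majorant_fun f s"
  unfolding majorant_fun_def[of f t]
proof (rule esssup_I)
  have "{t..} \<subseteq> {0<..}" using st by auto
  from half_measurable_sub[OF f this]
  show "(\<lambda>t. ereal \<bar>f t\<bar>) \<in> borel_measurable (lebesgue_on {t..})" by measurable
  have "AE u in lebesgue_on {s..}. ereal \<bar>f u\<bar> \<le> majorant_fun f s"
    unfolding majorant_fun_def by (rule esssup_AE)
  then have "AE u in lebesgue. u \<in> {s..} \<longrightarrow> ereal \<bar>f u\<bar> \<le> majorant_fun f s"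
    by (subst (asm) AE_restrict_space_iff) auto
  then show "AE u in lebesgue_on {t..}. ereal \<bar>f u\<bar> \<le> majorant_fun f s"
    by (subst AE_restrict_space_iff) (use st in \<open>auto elim!: eventually_mono\<close>)
qed

text \<open>For each fixed start the bound holds almost everywhere beyond it, but the start varies
  with \<open>s\<close>. Only rational starts \<open>q\<close> are used: if \<open>l\<close> lies
  strictly between the majorant at \<open>s\<close> and \<open>|f s|\<close>, some rational
  \<open>q \<le> s\<close> has majorant below \<open>l\<close>, unless \<open>s\<close> is the least
  point of \<open>U l\<close>. Each rational \<open>l\<close> thus excludes at most one
  point.\<close>

lemma majorant_fun_ge_AE:
  assumes f: "f \<in> borel_measurable half_line"
  shows "AE s in half_line. ereal \<bar>f s\<bar> \<le> majorant_fun f s"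
proof -
  define U where "U l = {s. 0 < s \<and> majorant_fun f s < ereal (real_of_rat l)}" for l
  let ?N = "\<lambda>l. {s \<in> U l. \<forall>q. real_of_rat q \<in> U l \<longrightarrow> \<not> real_of_rat q \<le> s}"
  have "AE s in half_line. s \<notin> ?N l" for l
  proof (rule half_AE_off_subsingleton)
    have less: False if s: "s \<in> ?N l" "s' \<in> ?N l" "s < s'" for s s'
    proof -
      obtain q where q: "s < real_of_rat q" "real_of_rat q < s'" using of_rat_dense[OF s(3)] by blast
      have "majorant_fun f (real_of_rat q) \<le> majorant_fun f s"
        using s q by (intro majorant_fun_antimono f) (auto simp: U_def)
      moreover have "0 < s" using s(1) by (simp add: U_def)
      then have "0 < real_of_rat q" using q(1) by linarith
      ultimately have "real_of_rat q \<in> U l" using s(1) unfolding U_def by (auto intro: le_less_trans)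
      moreover have "real_of_rat q \<le> s'" using q by simp
      ultimately show False using s(2) by blast
    qed
    show "s = s'" if "s \<in> ?N l" "s' \<in> ?N l" for s s'
      by (rule antisym; rule leI; rule notI)
        (rule less[OF that(2,1)], assumption, rule less[OF that], assumption)
  qed
  then have "AE s in half_line. \<forall>l. s \<notin> ?N l" unfolding AE_all_countable by (intro allI)
  moreover have "AE s in half_line. real_of_rat q \<le> s \<longrightarrow> ereal \<bar>f s\<bar> \<le> majorant_fun f (real_of_rat q)" for q
  proof -
    have "AE u in lebesgue_on {real_of_rat q..}. ereal \<bar>f u\<bar> \<le> majorant_fun f (real_of_rat q)"
      unfolding majorant_fun_def by (rule esssup_AE)
    then show ?thesis by (simp add: AE_restrict_space_iff) (auto elim: eventually_mono)
  qed
  then have "AE s in half_line. \<forall>q. real_of_rat q \<le> s \<longrightarrow> ereal \<bar>f s\<bar> \<le> majorant_fun f (real_of_rat q)"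
    unfolding AE_all_countable by (intro allI)
  ultimately show ?thesis
    using AE_space
  proof eventually_elim
    case (elim s)
    show ?case
    proof (rule ccontr)
      assume "\<not> ereal \<bar>f s\<bar> \<le> majorant_fun f s"
      then have "majorant_fun f s < ereal \<bar>f s\<bar>" by simp
      from ereal_dense3[OF this]
      obtain l where l: "majorant_fun f s < ereal (real_of_rat l)" "ereal (real_of_rat l) < ereal \<bar>f s\<bar>"
        by blast
      then have "s \<in> U l" using elim by (simp add: U_def)
      then obtain q where q: "real_of_rat q \<in> U l" "real_of_rat q \<le> s" using elim(1) by blast
      then have "ereal \<bar>f s\<bar> \<le> majorant_fun f (real_of_rat q)" using elim(2) by blast
      also have "\<dots> < ereal (real_of_rat l)" using q(1) by (simp add: U_def)
      finally show False using l by simp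
    qed
  qed
qed

interpretation half: hardy_setting half_line "\<lambda>t. t" UNIV "\<lambda>k. 2 powi k" hardy_defined hardy_fun majorant_fun
proof
  fix g :: "real \<Rightarrow> real"
  assume g: "g \<in> borel_measurable half_line" "\<And>s. s \<in> space half_line \<Longrightarrow> 0 \<le> g s"
  have up: "half.upto g t = (\<integral>\<^sup>+ s. ennreal (g s) \<partial>lebesgue_on {0<..t})" if "0 < t" for t
    unfolding half.upto_def by (rule half_upto[OF that])
  have gm: "g \<in> borel_measurable (lebesgue_on {0<..t})" for t
    by (rule half_measurable_sub[OF g(1)]) auto
  have g0: "AE s in lebesgue_on {0<..t}. 0 \<le> g s" for t
    by (rule AE_I2) (use g(2) in auto)
  have int: "integrable (lebesgue_on {0<..t}) g \<longleftrightarrow> half.upto g t < \<infinity>" if t: "0 < t" for t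
  proof -
    have "(\<integral>\<^sup>+ s. ennreal (norm (g s)) \<partial>lebesgue_on {0<..t}) = (\<integral>\<^sup>+ s. ennreal (g s) \<partial>lebesgue_on {0<..t})"
      by (rule nn_integral_cong) (use g(2) in auto)
    then show ?thesis using gm[of t] by (simp add: integrable_iff_bounded up[OF t])
  qed
  show "hardy_defined g \<longleftrightarrow> (\<forall>t\<in>space half_line. half.upto g t < \<infinity>)"
    using int by (auto simp: hardy_defined_def)
  fix t assume "hardy_defined g" and t: "t \<in> space half_line"
  have "(\<integral>s. g s \<partial>lebesgue_on {0<..t}) = enn2real (\<integral>\<^sup>+ s. ennreal (g s) \<partial>lebesgue_on {0<..t})"
    by (rule integral_eq_nn_integral[OF gm g0])
  then show "hardy_fun g t = enn2real (half.upto g t) / t"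
    using t by (simp add: hardy_fun_def up)
next
  fix f b :: "real \<Rightarrow> real" and t :: real
  assume f: "f \<in> borel_measurable half_line" and b: "antimono_on (space half_line) b"
    and fb: "AE s in half_line. \<bar>f s\<bar> \<le> b s" and t: "t \<in> space half_line"
  have sub: "{t..} \<subseteq> {0<..}" using t by auto
  show "majorant_fun f t \<le> ereal (b t)"
    unfolding majorant_fun_def
  proof (rule esssup_I)
    from half_measurable_sub[OF f sub]
    show "(\<lambda>t. ereal \<bar>f t\<bar>) \<in> borel_measurable (lebesgue_on {t..})" by measurable
    have "AE s in lebesgue_on {t..}. \<bar>f s\<bar> \<le> b s" by (rule half_AE_sub[OF fb sub]) simp
    with AE_space show "AE s in lebesgue_on {t..}. ereal \<bar>f s\<bar> \<le> ereal (b t)"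
    proof eventually_elim
      case (elim s)
      then have "b s \<le> b t" using t by (intro monotone_onD[OF b]) auto
      with elim show ?case by simp
    qed
  qed
next
  fix f :: "real \<Rightarrow> real" assume f: "f \<in> borel_measurable half_line"
  show "AE s in half_line. ereal \<bar>f s\<bar> \<le> majorant_fun f s" by (rule majorant_fun_ge_AE[OF f])
  show "antimono_on (space half_line) (majorant_fun f)"
    by (rule monotone_onI) (use majorant_fun_antimono[OF f] in auto)
  fix t assume t: "t \<in> space half_line"
  have sub: "{t..} \<subseteq> {0<..}" using t by auto
  \<comment> \<open>On a null space the essential supremum is \<open>-\<infinity>\<close>, so
    nonnegativity depends on the half line beyond \<open>t\<close> having positive measure.\<close>
  have "emeasure (lebesgue_on {t..}) (space (lebesgue_on {t..})) \<noteq> 0"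
  proof -
    have "emeasure lebesgue {t..t + 1} \<le> emeasure lebesgue {t..}" by (intro emeasure_mono) auto
    then show ?thesis by (auto simp: emeasure_restrict_space)
  qed
  then have "0 = esssup (lebesgue_on {t..}) (\<lambda>_. 0 :: ereal)" by (rule esssup_const[symmetric])
  also have "\<dots> \<le> majorant_fun f t" unfolding majorant_fun_def by (rule esssup_mono) auto
  finally show "0 \<le> majorant_fun f t" .
qed

theorem multiplier_cesaro_fun:
  assumes E: "symmetric_space half_line E" and F: "symmetric_space half_line F"
    and fatou: "fatou_property half_line F"
    and H: "hardy_bounded_fun E" "hardy_bounded_fun F"
    and factor: "eq_equiv_norms F (product_space half_line E (multiplier_space half_line E F))"
  shows "eq_equiv_norms (multiplier_space half_line (cesaro_fun E) (cesaro_fun F))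
    (tandori_fun (multiplier_space half_line E F))"
proof -
  have "\<exists>C>0. half.hardy_bounded X C" if X: "symmetric_space half_line X" "hardy_bounded_fun X" for X
  proof -
    have bis: "banach_ideal_space half_line X" using X by (simp add: symmetric_space_def)
    obtain C where C: "\<And>x. x \<in> elems X \<Longrightarrow> hardy_defined x \<and> hardy_fun x \<in> elems X \<and>
        fnorm X (hardy_fun x) \<le> C * fnorm X x" using X(2) unfolding hardy_bounded_fun_def by blast
    \<comment> \<open>The locale requires a positive constant, whereas the given \<open>C\<close>
      may be zero or negative.\<close>
    have "C * fnorm X x \<le> (\<bar>C\<bar> + 1) * fnorm X x" if "x \<in> elems X" for x
      using di_nonneg[OF bis_dominating[OF bis] that] by (intro mult_right_mono) auto
    then have "half.hardy_bounded X (\<bar>C\<bar> + 1)"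
      using C order_trans unfolding half.hardy_bounded_def by blast
    moreover have "0 < \<bar>C\<bar> + 1" by simp
    ultimately show ?thesis by blast
  qed
  then obtain CE CF where "0 < CE" "half.hardy_bounded E CE" "0 < CF" "half.hardy_bounded F CF"
    using E F H by blast
  then interpret factorizing_pair half_line "\<lambda>t. t" UNIV "\<lambda>k. 2 powi k" hardy_defined hardy_fun
      majorant_fun E F CE CF
    using E F fatou factor by unfold_locales
  have "half.cesaro X = cesaro_fun X" for X
    unfolding half.cesaro_def cesaro_fun_def by (simp only: simp_thms)
  moreover have "half.tandori X = tandori_fun X" for X
    unfolding half.tandori_def tandori_fun_def by (simp add: Ball_def)
  ultimately show ?thesis using multiplier_cesaro by (simp only:)
qed

section \<open>Counting measure on the positive integers\<close>

lemma pos_nat_upto: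
  assumes "1 \<le> (t::nat)" and "\<And>s. 1 \<le> s \<Longrightarrow> 0 \<le> g s"
  shows "(\<integral>\<^sup>+ s. ennreal (g s) * indicator ({..t} \<inter> space pos_nat) s \<partial>pos_nat) = ennreal (\<Sum>s=1..t. g s)"
proof -
  have "(\<integral>\<^sup>+ s. ennreal (g s) * indicator ({..t} \<inter> space pos_nat) s \<partial>pos_nat) =
      (\<Sum>s=1..t. ennreal (g s) * indicator ({..t} \<inter> space pos_nat) s)"
    by (rule nn_integral_count_space') auto
  also have "\<dots> = (\<Sum>s=1..t. ennreal (g s))" by (intro sum.cong) auto
  also have "\<dots> = ennreal (\<Sum>s=1..t. g s)" using assms(2) by (intro sum_ennreal) auto
  finally show ?thesis .
qed

lemma pos_nat_initial: "1 \<le> (t::nat) \<Longrightarrow> emeasure pos_nat {1..t} = ennreal (real t)"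
  by (subst emeasure_count_space_finite) (auto simp: ennreal_of_nat_eq_real_of_nat)

lemma pos_nat_quantile:
  "{t \<in> space pos_nat. ennreal (real t) \<le> ennreal x} = {1..nat \<lfloor>x\<rfloor>}"
proof (cases "0 \<le> x")
  case True
  then show ?thesis by (auto simp: le_nat_floor le_nat_iff le_floor_iff)
next
  case False
  then show ?thesis by (auto simp: ennreal_le_iff2)
qed

interpretation pos: ordered_measure pos_nat real "{0..}" "\<lambda>k. 2 ^ nat k"
proof
  show "\<exists>A::nat set set. countable A \<and> A \<subseteq> sets pos_nat \<and> \<Union> A = space pos_nat \<and>
      (\<forall>a\<in>A. emeasure pos_nat a \<noteq> \<infinity>)"
    by (rule exI[of _ "(\<lambda>n. {n}) ` {1..}"]) auto
  show "0 < real t" if "t \<in> space pos_nat" for t using that by simp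
  show "emeasure pos_nat ({..t} \<inter> space pos_nat) = ennreal (real t)" if "t \<in> space pos_nat" for t
  proof -
    have "{..t} \<inter> space pos_nat = {1..t}" by auto
    then show ?thesis using that pos_nat_initial by simp
  qed
  show "D \<in> sets pos_nat \<and>
      (\<exists>T. countable T \<and> T \<subseteq> D \<and> (AE s in pos_nat. s \<in> D \<longrightarrow> (\<exists>t\<in>T. s \<le> t)))"
    if "D \<subseteq> space pos_nat" for D
    using that by (intro conjI exI[of _ D]) (auto simp: AE_count_space)
  show "emeasure pos_nat {t \<in> space pos_nat. ennreal (real t) \<le> v} \<le> v" for v
  proof (cases v)
    case (real x)
    have "emeasure pos_nat {1..nat \<lfloor>x\<rfloor>} = ennreal (real (nat \<lfloor>x\<rfloor>))"
      by (subst emeasure_count_space_finite) (auto simp: ennreal_of_nat_eq_real_of_nat)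
    also have "\<dots> \<le> ennreal x" using real by (intro ennreal_leI) auto
    finally show ?thesis unfolding real(2) pos_nat_quantile .
  qed simp
  show "emeasure pos_nat {t \<in> space pos_nat. ennreal (real t) \<le> emeasure pos_nat A} = emeasure pos_nat A"
    if A: "A \<in> sets pos_nat" for A
  proof (cases "finite A")
    case True
    then have e: "emeasure pos_nat A = ennreal (real (card A))"
      using A by (subst emeasure_count_space_finite) (auto simp: ennreal_of_nat_eq_real_of_nat)
    show ?thesis unfolding e pos_nat_quantile
      by (subst emeasure_count_space_finite) (auto simp: ennreal_of_nat_eq_real_of_nat)
  next
    case False
    then have e: "emeasure pos_nat A = \<infinity>" using A by (simp add: emeasure_count_space_infinite)
    have "{t \<in> space pos_nat. ennreal (real t) \<le> \<infinity>} = {1..}" by auto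
    moreover have "emeasure pos_nat {1..} = \<infinity>"
      by (intro emeasure_count_space_infinite infinite_Ici) simp
    ultimately show ?thesis unfolding e by (simp only:)
  qed
  show "ennreal (real t) \<le> emeasure pos_nat {s \<in> space pos_nat. t \<le> s \<and> real s \<le> 2 * real t}"
    if "t \<in> space pos_nat" for t
  proof -
    have "{s \<in> space pos_nat. t \<le> s \<and> real s \<le> 2 * real t} = {t..2 * t}" using that by auto
    moreover have "emeasure pos_nat {t..2 * t} = ennreal (real (t + 1))"
      using that by (subst emeasure_count_space_finite) (auto simp: ennreal_of_nat_eq_real_of_nat)
    ultimately show ?thesis by (simp add: ennreal_leI del: ennreal_plus)
  qed
  \<comment> \<open>Counting measure takes integer values, so \<open>e\<close> is rounded up to its
    ceiling; an integer \<open>t\<close> above \<open>e\<close> is also above the ceiling.\<close>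
  show "\<exists>\<rho>\<ge>e. (\<forall>t\<in>space pos_nat. e \<le> real t \<longrightarrow> \<rho> \<le> real t) \<and>
      (\<forall>A\<in>sets pos_nat. ennreal e \<le> emeasure pos_nat A \<longrightarrow>
        (\<exists>P\<in>sets pos_nat. P \<subseteq> A \<and> emeasure pos_nat P = ennreal \<rho>))" if e: "0 < e" for e
  proof (intro exI[of _ "real (nat \<lceil>e\<rceil>)"] conjI ballI impI)
    show "e \<le> real (nat \<lceil>e\<rceil>)" by linarith
    show "real (nat \<lceil>e\<rceil>) \<le> real t" if "e \<le> real t" for t
      using that by (simp add: nat_le_iff ceiling_le_iff)
    fix A assume A: "A \<in> sets pos_nat" "ennreal e \<le> emeasure pos_nat A"
    have "\<exists>P. P \<subseteq> A \<and> finite P \<and> card P = nat \<lceil>e\<rceil>"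
    proof (cases "finite A")
      case True
      then have "emeasure pos_nat A = ennreal (real (card A))"
        using A by (subst emeasure_count_space_finite) (auto simp: ennreal_of_nat_eq_real_of_nat)
      with A(2) e have "e \<le> real (card A)" by (simp add: ennreal_le_iff)
      then have "nat \<lceil>e\<rceil> \<le> card A" by (simp add: nat_le_iff ceiling_le_iff)
      then show ?thesis using True by (metis obtain_subset_with_card_n)
    next
      case False
      then show ?thesis using infinite_arbitrarily_large by blast
    qed
    then obtain P where P: "P \<subseteq> A" "finite P" "card P = nat \<lceil>e\<rceil>" by blast
    have "emeasure pos_nat P = ennreal (real (nat \<lceil>e\<rceil>))"
      using A P by (subst emeasure_count_space_finite) (auto simp: ennreal_of_nat_eq_real_of_nat)
    then show "\<exists>P\<in>sets pos_nat. P \<subseteq> A \<and> emeasure pos_nat P = ennreal (real (nat \<lceil>e\<rceil>))"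
      using A P by (intro bexI[of _ P]) auto
  qed
  show "2 ^ nat k \<in> space pos_nat \<and> real (2 ^ nat k) = 2 powi k" if "k \<in> {0..}" for k
    using that by (simp add: power_int_def)
  show "\<exists>k\<in>{0..}. 2 ^ nat k \<le> t \<and> real t \<le> 2 * 2 powi k" if t: "t \<in> space pos_nat" for t
  proof -
    obtain n where n: "2 ^ n \<le> t" "t < 2 ^ (n + 1)" using ex_power_ivl1[of 2 t] t by auto
    have "real t \<le> real (2 ^ (n + 1))" using n by linarith
    then show ?thesis using n by (intro bexI[of _ "int n"]) (auto simp: power_int_def)
  qed
qed simp_all

text \<open>Finite sums always exist, so the definedness predicate is constantly true; the tail
  supremum may still be infinite.\<close>

interpretation pos: hardy_setting pos_nat real "{0..}" "\<lambda>k. 2 ^ nat k" "\<lambda>_. True" hardy_seq majorant_seq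
proof
  fix g :: "nat \<Rightarrow> real"
  assume g: "\<And>s. s \<in> space pos_nat \<Longrightarrow> 0 \<le> g s"
  have up: "pos.upto g t = ennreal (\<Sum>s=1..t. g s)" if "t \<in> space pos_nat" for t
    unfolding pos.upto_def by (rule pos_nat_upto) (use that g in auto)
  show "True \<longleftrightarrow> (\<forall>t\<in>space pos_nat. pos.upto g t < \<infinity>)"
    using up ennreal_less_top by (metis infinity_ennreal_def)
  show "hardy_seq g t = enn2real (pos.upto g t) / real t" if "t \<in> space pos_nat" for t
  proof -
    have "0 \<le> (\<Sum>s=1..t. g s)" by (intro sum_nonneg) (use g in auto)
    then show ?thesis unfolding up[OF that] hardy_seq_def by simp
  qed
next
  fix f b :: "nat \<Rightarrow> real" and t :: nat
  assume b: "antimono_on (space pos_nat) b" and fb: "AE s in pos_nat. \<bar>f s\<bar> \<le> b s" and t: "t \<in> space pos_nat"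
  show "majorant_seq f t \<le> ereal (b t)"
    unfolding majorant_seq_def
  proof (rule SUP_least)
    fix s assume s: "s \<in> {t..}"
    have "\<bar>f s\<bar> \<le> b s" using fb s t by (auto simp: AE_count_space)
    also have "\<dots> \<le> b t" using s t by (intro monotone_onD[OF b]) auto
    finally show "ereal \<bar>f s\<bar> \<le> ereal (b t)" by simp
  qed
next
  fix f :: "nat \<Rightarrow> real"
  have ge: "ereal \<bar>f s\<bar> \<le> majorant_seq f s" for s unfolding majorant_seq_def by (rule SUP_upper) simp
  then show "AE s in pos_nat. ereal \<bar>f s\<bar> \<le> majorant_seq f s" by simp
  show "antimono_on (space pos_nat) (majorant_seq f)"
    by (rule monotone_onI) (auto simp: majorant_seq_def intro!: SUP_subset_mono)
  show "0 \<le> majorant_seq f t" for t by (rule order_trans[OF _ ge]) simp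
qed

theorem multiplier_cesaro_seq:
  assumes E: "symmetric_space pos_nat E" and F: "symmetric_space pos_nat F"
    and fatou: "fatou_property pos_nat F"
    and H: "hardy_bounded_seq E" "hardy_bounded_seq F"
    and factor: "eq_equiv_norms F (product_space pos_nat E (multiplier_space pos_nat E F))"
  shows "eq_equiv_norms (multiplier_space pos_nat (cesaro_seq E) (cesaro_seq F))
    (tandori_seq (multiplier_space pos_nat E F))"
proof -
  have "\<exists>C>0. pos.hardy_bounded X C" if X: "symmetric_space pos_nat X" "hardy_bounded_seq X" for X
  proof -
    have bis: "banach_ideal_space pos_nat X" using X by (simp add: symmetric_space_def)
    obtain C where C: "\<And>x. x \<in> elems X \<Longrightarrow> hardy_seq x \<in> elems X \<and>
        fnorm X (hardy_seq x) \<le> C * fnorm X x" using X(2) unfolding hardy_bounded_seq_def by blast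
    have "C * fnorm X x \<le> (\<bar>C\<bar> + 1) * fnorm X x" if "x \<in> elems X" for x
      using di_nonneg[OF bis_dominating[OF bis] that] by (intro mult_right_mono) auto
    then have "pos.hardy_bounded X (\<bar>C\<bar> + 1)"
      using C order_trans unfolding pos.hardy_bounded_def by blast
    moreover have "0 < \<bar>C\<bar> + 1" by simp
    ultimately show ?thesis by blast
  qed
  then obtain CE CF where "0 < CE" "pos.hardy_bounded E CE" "0 < CF" "pos.hardy_bounded F CF"
    using E F H by blast
  then interpret factorizing_pair pos_nat real "{0..}" "\<lambda>k. 2 ^ nat k" "\<lambda>_. True" hardy_seq
      majorant_seq E F CE CF
    using E F fatou factor by unfold_locales
  have "pos.cesaro X = cesaro_seq X" for X
    unfolding pos.cesaro_def cesaro_seq_def by (simp only: simp_thms)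
  moreover have "pos.tandori X = tandori_seq X" for X
    unfolding pos.tandori_def tandori_seq_def
    by (simp only: space_count_space Ball_def atLeast_iff)
  ultimately show ?thesis using multiplier_cesaro by (simp only:)
qed

theorem theorem6:
  shows
    "(\<forall>E F :: real fn_space.
        symmetric_space half_line E \<and> symmetric_space half_line F \<and>
        fatou_property half_line E \<and> fatou_property half_line F \<and>
        hardy_bounded_fun E \<and> hardy_bounded_fun F \<and>
        F \<approx> product_space half_line E (multiplier_space half_line E F) \<longrightarrow>
        multiplier_space half_line (cesaro_fun E) (cesaro_fun F) \<approx>
          tandori_fun (multiplier_space half_line E F)) \<and>
     (\<forall>E F :: nat fn_space.
        symmetric_space pos_nat E \<and> symmetric_space pos_nat F \<and>
        fatou_property pos_nat E \<and> fatou_property pos_nat F \<and>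
        hardy_bounded_seq E \<and> hardy_bounded_seq F \<and>
        F \<approx> product_space pos_nat E (multiplier_space pos_nat E F) \<longrightarrow>
        multiplier_space pos_nat (cesaro_seq E) (cesaro_seq F) \<approx>
          tandori_seq (multiplier_space pos_nat E F))"
  using multiplier_cesaro_fun multiplier_cesaro_seq by blast

end
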